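(* Consider RP-VC$_n{\sim}e$, i.e. RP-VC$_n$ with vehicle sojourn times i.i.d. exponential with parameter $\lambda_z$ and recruitment durations i.i.d. exponential with parameter $\lambda_u$. The conditional mean time to failure at time $t=0$ with $\mathcal R(0)=0$ (all $n$ deployed groups have two vehicles) is C-MTTF $=\mathbb E[\widehat{\mathrm Q}_{0,0}]$, where $$\mathbb E[\widehat{\mathrm Q}_{0,0}]=\mathbb E[\widehat{\mathrm W}_{0,0}]\big(1+\beta'(1)A'(2)\big)+\beta'(n)\,\mathbb E[\widehat{\mathrm W}_{n,0}]+\sum_{i=1}^{n-1}\mathbb E[\widehat{\mathrm W}_{i,0}]\Big((i+1)\beta'(i+1)A'(i+2)+\beta'(i)\Big).$$ Here $\beta'(i)=\prod_{k=1}^{i}\alpha'(k)$ with $$\alpha'(k)=\frac{q_{k-1,0}}{1-k\,q_{k-1,0}\,A'(k+1)},$$ and $A'(\cdot)$ is given by $$A'(i)=\frac{p_{i-1,0}^{1}}{1-i\,q_{i-1,0}\,A'(i+1)},\qquad A'(n+1)=p_{n,0}^{1}.$$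
   Context: **Model.** $n$ groups of sub-tasks of an application are deployed on vehicles of a vehicular cloud (VC). Under the methodology RP-VC$_n$ each group is initially processed by two distinct vehicles. Vehicle sojourn times are i.i.d. with distribution $\mathfrak D_Z$ (here exponential with parameter $\lambda_z$), recruitment durations i.i.d. with distribution $\mathfrak R$ (here exponential with parameter $\lambda_u$), all independent. When one of the two vehicles of a group departs, the other becomes a recruiter and immediately starts recruiting a replacement (from a sufficiently large supply of vehicles that were in the VC when processing started); on completion the group again has two vehicles. If a recruiter departs before completing its recruitment, the application fails. $\mathcal R(t)$ is the number of deployed groups having only one vehicle at time $t$. C-MTTF (given the deployment, $\mathcal R(t)$ and $t$) is the expected time until one of the deployed groups fails. **Decomposed semi-Markov process (D-SMP) of RP-VC$_n$.** It is the semi-Markov process with states $S_{i,j}$ for $0\le i\le n-1$, $0\le j\le i+1$, together with $S_{n,0}$ and the absorbing failure state $F$; it starts in $S_{0,0}$. In $S_{i,j}$ exactly $i$ groups have a single vehicle (these are the $i$ recruiters) and there are $2n-i$ vehicles in total. $S_{i,j}^{\mathsf{Soj}}$ is the list of the $2n-i$ residual sojourn times and $S_{i,j}^{\mathsf{Rec}}$ the list of the $i$ residual recruitment durations ($S(r)$ denotes the $r$-th entry). Specifically, $S_{0,0}^{\mathsf{Soj}}=[Z_1,\dots,Z_{2n}]$ i.i.d. $\mathfrak D_Z$; entries of $S_{i,0}^{\mathsf{Soj}}$ ($i\ge1$) follow $\dot{\mathfrak X}$; entries of $S_{i,j}^{\mathsf{Soj}}$ ($j\ge1$) follow $\ddot{\mathfrak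 X}$; the first $i-1$ entries of $S_{i,0}^{\mathsf{Rec}}$ follow $\varphi$ and the last follows $\mathfrak R$; the first $j-1$ entries of $S_{i,j}^{\mathsf{Rec}}$ ($j\ge1$) follow $\gamma$ and the remaining $i-(j-1)$ follow $\psi$. Here, for independent $Z_1,Z_2\sim\mathfrak D_Z$, $U\sim\mathfrak R$: $\dot{\mathfrak X}$ is the law of $Z_1-Z_2$ (where $Z_1>Z_2$), $\ddot{\mathfrak X}$ of $Z_1-(Z_2+U)$ (where $Z_1>Z_2+U$), $\varphi$ of $W=U-Z'$ with $Z'\sim\dot{\mathfrak X}$ (where $U>Z'$), $\psi$ of $U-W$ with $W\sim\varphi$ (where $U>W$), $\gamma$ of $W-U$ with $W\sim\varphi$ (where $W>U$). Transitions from $S_{i,j}$: to $S_{i-1,k}$ ($1\le k\le i$), when the $k$-th recruiter completes its recruitment before any other event, with probability $$p_{i,j}^{k}=\Pr\Big[S_{i,j}^{\mathsf{Rec}}(k)<\min\Big\{\min_{1\le r\le 2n-i}S_{i,j}^{\mathsf{Soj}}(r),\ \min_{1\le h\le i,\,h\ne k}S_{i,j}^{\mathsf{Rec}}(h)\Big\}\Big];$$ to $S_{i+1,0}$, when a non-recruiter departs first, with probability $q_{i,j}=\frac{2(n-i)}{2n-i}\big(1-\sum_{k=1}^{i}p_{i,j}^{k}\big)$; to $F$, when a recruiter departs first, with probability $b_{i,j}=\frac{i}{2n-i}\big(1-\sum_{k=1}^{i}p_{i,j}^{k}\big)$. (For $i=0$ there are no recruiters: $p_{0,0}^k=p_{0,1}^k=0$.)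 $\widehat{\mathrm W}_{i,j}$ is the sojourn time of the D-SMP in $S_{i,j}$, with $$\mathbb E[\widehat{\mathrm W}_{i,j}]=\int_0^\infty\Pr\Big[\min\Big\{\min_{1\le r\le 2n-i}S_{i,j}^{\mathsf{Soj}}(r),\min_{1\le h\le i}S_{i,j}^{\mathsf{Rec}}(h)\Big\}>t\Big]dt.$$ $\widehat{\mathrm Q}_{i,j}$ is the time until the D-SMP reaches $F$ starting from $S_{i,j}$. *)

theory Defs
  imports "HOL-Probability.Probability"
begin

section \<open>The vehicular cloud with \<open>n\<close> duplicated groups\<close>

definition exp_law :: "real \<Rightarrow> real measure" where
  "exp_law l = density lborel (exponential_density l)"

text \<open>
  Vehicle \<open>v\<close> leaves the cloud at the absolute time \<open>Z v\<close>: every vehicle, deployed or still in the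
  supply, was in the cloud when processing started at time 0. The \<open>m\<close>-th recruitment that is started
  lasts for \<open>U m\<close>.
\<close>

definition vc_randomness ::
    "real measure \<Rightarrow> real measure \<Rightarrow> 'w measure \<Rightarrow> (nat \<Rightarrow> 'w \<Rightarrow> real) \<Rightarrow> (nat \<Rightarrow> 'w \<Rightarrow> real) \<Rightarrow> bool" where
  "vc_randomness DZ R M Z U \<longleftrightarrow>
     prob_space M \<and>
     (\<forall>v. Z v \<in> borel_measurable M \<and> distr M borel (Z v) = DZ) \<and>
     (\<forall>m. U m \<in> borel_measurable M \<and> distr M borel (U m) = R) \<and>
     prob_space.indep_vars M (\<lambda>_. borel) (case_sum Z U) UNIV"

text \<open>
  \<open>Duo a b\<close> is a group processed by the vehicles \<open>a\<close> and \<open>b\<close>. \<open>Solo a c\<close> is a group whose only vehicle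
  \<open>a\<close> is recruiting; \<open>c\<close> is the absolute time at which this recruitment would complete.
\<close>

datatype group_state = Duo nat nat | Solo nat real

fun group_event :: "(nat \<Rightarrow> real) \<Rightarrow> group_state \<Rightarrow> real" where
  "group_event z (Duo a b) = min (z a) (z b)"
| "group_event z (Solo a c) = min (z a) c"

text \<open>
  In \<open>Running G v m\<close> the groups \<open>0, \<dots>, n - 1\<close> are in the states given by \<open>G\<close>, no vehicle with
  number at least \<open>v\<close> has been deployed, and \<open>m\<close> recruitments have been started. The infinite supply,
  shared by all groups, is used in the order of the vehicle numbers; vehicles that have already left
  the cloud are skipped. \<open>Failed t\<close> records a failure at time \<open>t\<close>.
\<close>

datatype vc_state = Running "nat \<Rightarrow> group_state" nat nat | Failed real

definition vc_init :: "nat \<Rightarrow> vc_state" where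
  "vc_init n = Running (\<lambda>g. Duo (2 * g) (2 * g + 1)) (2 * n) 0"

fun vc_step :: "nat \<Rightarrow> (nat \<Rightarrow> real) \<Rightarrow> (nat \<Rightarrow> real) \<Rightarrow> vc_state \<Rightarrow> vc_state" where
  "vc_step n z u (Failed t) = Failed t"
| "vc_step n z u (Running G v m) =
     (let t = Min ((\<lambda>g. group_event z (G g)) ` {..<n});
          g = (LEAST g. g < n \<and> group_event z (G g) = t)
      in case G g of
           Duo a b \<Rightarrow> Running (G(g := Solo (if z a \<le> z b then b else a) (t + u m))) v (Suc m)
         | Solo a c \<Rightarrow>
             if z a < c then Failed t
             else let w = (LEAST w. v \<le> w \<and> t < z w) in Running (G(g := Duo a w)) (Suc w) m)"

definition vc_failure_time :: "nat \<Rightarrow> (nat \<Rightarrow> real) \<Rightarrow> (nat \<Rightarrow> real) \<Rightarrow> ennreal" where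
  "vc_failure_time n z u =
     (INF t \<in> {t. \<exists>k. (vc_step n z u ^^ k) (vc_init n) = Failed t}. ennreal t)"

text \<open>The conditional mean time to failure at time 0, when all \<open>n\<close> groups have two vehicles.\<close>

definition cmttf ::
    "nat \<Rightarrow> 'w measure \<Rightarrow> (nat \<Rightarrow> 'w \<Rightarrow> real) \<Rightarrow> (nat \<Rightarrow> 'w \<Rightarrow> real) \<Rightarrow> ennreal" where
  "cmttf n M Z U = (\<integral>\<^sup>+\<omega>. vc_failure_time n (\<lambda>v. Z v \<omega>) (\<lambda>m. U m \<omega>) \<partial>M)"


section \<open>Residual times in the states of the decomposed process\<close>

text \<open>The law of \<open>X - Y\<close> given \<open>X > Y\<close>, for independent \<open>X\<close>, \<open>Y\<close> with the laws \<open>M\<close>, \<open>N\<close>.\<close>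

definition residual_law :: "real measure \<Rightarrow> real measure \<Rightarrow> real measure" where
  "residual_law M N =
     distr (uniform_measure (M \<Otimes>\<^sub>M N) {(x, y). x > y}) borel (\<lambda>(x, y). x - y)"

definition xdot_law :: "real measure \<Rightarrow> real measure" where
  "xdot_law DZ = residual_law DZ DZ"

definition xddot_law :: "real measure \<Rightarrow> real measure \<Rightarrow> real measure" where
  "xddot_law DZ R = residual_law DZ (convolution DZ R)"

definition phi_law :: "real measure \<Rightarrow> real measure \<Rightarrow> real measure" where
  "phi_law DZ R = residual_law R (xdot_law DZ)"

definition psi_law :: "real measure \<Rightarrow> real measure \<Rightarrow> real measure" where
  "psi_law DZ R = residual_law R (phi_law DZ R)"

definition gamma_law :: "real measure \<Rightarrow> real measure \<Rightarrow> real measure" where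
  "gamma_law DZ R = residual_law (phi_law DZ R) R"

definition soj_law :: "real measure \<Rightarrow> real measure \<Rightarrow> nat \<Rightarrow> nat \<Rightarrow> real measure" where
  "soj_law DZ R i j =
     (if j \<ge> 1 then xddot_law DZ R else if i \<ge> 1 then xdot_law DZ else DZ)"

definition rec_law :: "real measure \<Rightarrow> real measure \<Rightarrow> nat \<Rightarrow> nat \<Rightarrow> nat \<Rightarrow> real measure" where
  "rec_law DZ R i j h =
     (if j \<ge> 1 then (if h \<le> j - 1 then gamma_law DZ R else psi_law DZ R)
      else (if h \<le> i - 1 then phi_law DZ R else R))"

text \<open>
  A sample is a pair \<open>(s, c)\<close> of the list \<open>s\<close> of residual sojourn times and the list \<open>c\<close> of residual
  recruitment durations, both indexed from 1.
\<close>

definition residuals ::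
    "nat \<Rightarrow> real measure \<Rightarrow> real measure \<Rightarrow> nat \<Rightarrow> nat \<Rightarrow> ((nat \<Rightarrow> real) \<times> (nat \<Rightarrow> real)) measure" where
  "residuals n DZ R i j =
     (\<Pi>\<^sub>M r \<in> {1..2 * n - i}. soj_law DZ R i j) \<Otimes>\<^sub>M (\<Pi>\<^sub>M h \<in> {1..i}. rec_law DZ R i j h)"

definition first_event :: "nat \<Rightarrow> nat \<Rightarrow> (nat \<Rightarrow> real) \<times> (nat \<Rightarrow> real) \<Rightarrow> real" where
  "first_event n i = (\<lambda>(s, c). Min (s ` {1..2 * n - i} \<union> c ` {1..i}))"

definition recruits_first :: "nat \<Rightarrow> nat \<Rightarrow> nat \<Rightarrow> (nat \<Rightarrow> real) \<times> (nat \<Rightarrow> real) \<Rightarrow> bool" where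
  "recruits_first n i k = (\<lambda>(s, c). c k < Min (s ` {1..2 * n - i} \<union> c ` ({1..i} - {k})))"

definition p_prob :: "nat \<Rightarrow> real measure \<Rightarrow> real measure \<Rightarrow> nat \<Rightarrow> nat \<Rightarrow> nat \<Rightarrow> real" where
  "p_prob n DZ R i j k =
     (if k \<in> {1..i}
      then measure (residuals n DZ R i j) {x \<in> space (residuals n DZ R i j). recruits_first n i k x}
      else 0)"

definition q_prob :: "nat \<Rightarrow> real measure \<Rightarrow> real measure \<Rightarrow> nat \<Rightarrow> nat \<Rightarrow> real" where
  "q_prob n DZ R i j =
     2 * (real n - real i) / (2 * real n - real i) * (1 - (\<Sum>k = 1..i. p_prob n DZ R i j k))"

definition mean_W :: "nat \<Rightarrow> real measure \<Rightarrow> real measure \<Rightarrow> nat \<Rightarrow> nat \<Rightarrow> real" where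
  "mean_W n DZ R i j =
     (LBINT t:{0..}. measure (residuals n DZ R i j)
        {x \<in> space (residuals n DZ R i j). first_event n i x > t})"


section \<open>Semi-Markov processes and the decomposed process\<close>

text \<open>
  \<open>X k\<close> is the \<open>k\<close>-th visited state and \<open>W k\<close> the sojourn time in it. \<open>K s s' t\<close> is the probability
  that the sojourn in \<open>s\<close> lasts at most \<open>t\<close> and ends with a transition to \<open>s'\<close>. No condition is put on
  the sojourn times in the absorbing states \<open>A\<close>.
\<close>

definition semi_markov ::
    "('s \<Rightarrow> 's \<Rightarrow> real \<Rightarrow> real) \<Rightarrow> 's set \<Rightarrow> 's \<Rightarrow> 'w measure \<Rightarrow> (nat \<Rightarrow> 'w \<Rightarrow> 's) \<Rightarrow> (nat \<Rightarrow> 'w \<Rightarrow> real) \<Rightarrow> bool" where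
  "semi_markov K A s0 M X W \<longleftrightarrow>
     prob_space M \<and>
     (\<forall>k. X k \<in> measurable M (count_space UNIV)) \<and>
     (\<forall>k. W k \<in> borel_measurable M) \<and>
     (AE \<omega> in M. X 0 \<omega> = s0) \<and>
     (\<forall>k. AE \<omega> in M. X k \<omega> \<in> A \<longrightarrow> X (Suc k) \<omega> = X k \<omega>) \<and>
     (\<forall>k s t. s k \<notin> A \<longrightarrow>
        measure M {\<omega> \<in> space M. (\<forall>m \<le> Suc k. X m \<omega> = s m) \<and> (\<forall>m \<le> k. W m \<omega> \<le> t m)} =
        measure M {\<omega> \<in> space M. (\<forall>m \<le> k. X m \<omega> = s m) \<and> (\<forall>m < k. W m \<omega> \<le> t m)}
          * K (s k) (s (Suc k)) (t k))"

definition hit_time :: "'s \<Rightarrow> (nat \<Rightarrow> 's) \<Rightarrow> (nat \<Rightarrow> real) \<Rightarrow> ennreal" where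
  "hit_time s x w = (INF k \<in> {k. x k = s}. \<Sum>m<k. ennreal (w m))"

definition mean_hit_time ::
    "'s \<Rightarrow> 'w measure \<Rightarrow> (nat \<Rightarrow> 'w \<Rightarrow> 's) \<Rightarrow> (nat \<Rightarrow> 'w \<Rightarrow> real) \<Rightarrow> ennreal" where
  "mean_hit_time s M X W = (\<integral>\<^sup>+\<omega>. hit_time s (\<lambda>k. X k \<omega>) (\<lambda>k. W k \<omega>) \<partial>M)"

datatype dstate = St nat nat | Fail

definition p_until :: "nat \<Rightarrow> real measure \<Rightarrow> real measure \<Rightarrow> nat \<Rightarrow> nat \<Rightarrow> nat \<Rightarrow> real \<Rightarrow> real" where
  "p_until n DZ R i j k t =
     measure (residuals n DZ R i j)
       {x \<in> space (residuals n DZ R i j). recruits_first n i k x \<and> first_event n i x \<le> t}"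

definition departure_until :: "nat \<Rightarrow> real measure \<Rightarrow> real measure \<Rightarrow> nat \<Rightarrow> nat \<Rightarrow> real \<Rightarrow> real" where
  "departure_until n DZ R i j t =
     measure (residuals n DZ R i j) {x \<in> space (residuals n DZ R i j). first_event n i x \<le> t}
     - (\<Sum>k = 1..i. p_until n DZ R i j k t)"

text \<open>
  As \<open>t\<close> tends to infinity, the entries tend to the transition probabilities: \<open>p_prob\<close> for
  \<open>St (i - 1) k\<close>, \<open>q_prob\<close> for \<open>St (i + 1) 0\<close>, and \<open>i / (2n - i) (1 - (\<Sum>k = 1..i. p_prob n DZ R i j k))\<close>
  for \<open>Fail\<close>; summed over all targets, they give the law of \<open>first_event\<close> at every finite \<open>t\<close>.
  The sojourn in \<open>Fail\<close> is infinite. From \<open>St 0 0\<close> only the states \<open>St i j\<close> with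
  \<open>i < n\<close>, \<open>j \<le> i + 1\<close> as well as \<open>St n 0\<close> and \<open>Fail\<close> are reached with positive probability.
\<close>

fun dsmp_kernel :: "nat \<Rightarrow> real measure \<Rightarrow> real measure \<Rightarrow> dstate \<Rightarrow> dstate \<Rightarrow> real \<Rightarrow> real" where
  "dsmp_kernel n DZ R (St i j) (St i' k) t =
     (if i = i' + 1 \<and> k \<in> {1..i} then p_until n DZ R i j k t
      else if i' = i + 1 \<and> k = 0
      then 2 * (real n - real i) / (2 * real n - real i) * departure_until n DZ R i j t
      else 0)"
| "dsmp_kernel n DZ R (St i j) Fail t = real i / (2 * real n - real i) * departure_until n DZ R i j t"
| "dsmp_kernel n DZ R Fail s t = 0"

definition dsmp ::
    "nat \<Rightarrow> real measure \<Rightarrow> real measure \<Rightarrow> nat \<Rightarrow> nat \<Rightarrow> 'w measure \<Rightarrow>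
     (nat \<Rightarrow> 'w \<Rightarrow> dstate) \<Rightarrow> (nat \<Rightarrow> 'w \<Rightarrow> real) \<Rightarrow> bool" where
  "dsmp n DZ R i j M X W \<longleftrightarrow> semi_markov (dsmp_kernel n DZ R) {Fail} (St i j) M X W"


section \<open>The coefficients of the closed form\<close>

text \<open>Used for \<open>2 \<le> i \<le> n + 1\<close> only; the first branch is meant for \<open>i = n + 1\<close>.\<close>

function A' :: "nat \<Rightarrow> real measure \<Rightarrow> real measure \<Rightarrow> nat \<Rightarrow> real" where
  "A' n DZ R i =
     (if i \<ge> n + 1 then p_prob n DZ R n 0 1
      else p_prob n DZ R (i - 1) 0 1 / (1 - real i * q_prob n DZ R (i - 1) 0 * A' n DZ R (i + 1)))"
  by pat_completeness auto
termination
  by (relation "Wellfounded.measure (\<lambda>(n, DZ, R, i). n + 1 - i)") auto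

declare A'.simps [simp del]

definition alpha' :: "nat \<Rightarrow> real measure \<Rightarrow> real measure \<Rightarrow> nat \<Rightarrow> real" where
  "alpha' n DZ R k =
     q_prob n DZ R (k - 1) 0 / (1 - real k * q_prob n DZ R (k - 1) 0 * A' n DZ R (k + 1))"

definition beta' :: "nat \<Rightarrow> real measure \<Rightarrow> real measure \<Rightarrow> nat \<Rightarrow> real" where
  "beta' n DZ R i = (\<Prod>k = 1..i. alpha' n DZ R k)"

end

theory Submission
  imports Defs
begin

text \<open>
  By the lack of memory all residual times are again exponential, so with \<open>i\<close> recruiters the next event
  comes after a mean time \<open>1 / D i\<close>, where \<open>D i = (2n - i) lz + i lu\<close>; it lowers \<open>i\<close> with probability
  \<open>i lu / D i\<close>, raises it with probability \<open>2 (n - i) lz / D i\<close>, and is a failure otherwise. For both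
  processes the mean time elapsed until the failure or the \<open>K\<close>-th event is therefore the \<open>K\<close>-th iterate
  \<open>V 0 K\<close> of the one-step equations of this birth-death chain. The iterates \<open>V b K\<close>, which charge an
  extra \<open>b\<close> for survival, converge for every \<open>b\<close> to the solution \<open>Q\<close> of these equations: the case
  \<open>b = 1\<close> shows that a failure occurs almost surely, the case \<open>b = 0\<close> that its mean time is \<open>Q 0\<close>.
  Eliminating the levels from above gives the closed form of \<open>Q 0\<close>.

  For the cloud itself the strong Markov property is obtained by induction on \<open>K\<close>: the first of
  independent exponential clocks rings, the residual times of the others are a fresh copy, and the
  one clock that is replaced has an exponential law by the lack of memory.
\<close>

section \<open>Competing exponential clocks\<close>

text \<open>A priori the mean times could be infinite, and an infinite value would satisfy the
  one-step equations as well. They are therefore approached from below by truncated times with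
  finite means and by monotone convergence, instead of being characterised by the equations. The
  charge \<open>b\<close> is paid exactly when no failure has occurred yet, so the means for
  \<open>b = 1\<close> and \<open>b = 0\<close> differ by the survival probability.

  The obstacle in the cloud is its bookkeeping in absolute time: a finished recruitment takes the
  first vehicle of the supply that is still present, so what is discarded depends on the past.
  Whatever the time, the supply is i.i.d. again after such a step, and this fact replaces any
  filtration. The other device is to give every group two slots, so that an event overwrites one
  coordinate of a product of exponential laws. As all slots with the same kind of contents have the
  same rate, only the number of recruiters influences the future.\<close>

lemma prob_space_exp_law: "l > 0 \<Longrightarrow> prob_space (exp_law l)"
  unfolding exp_law_def by (rule prob_space_exponential_density)

lemma sets_exp_law [simp, measurable_cong]: "sets (exp_law l) = sets borel"
  by (simp add: exp_law_def)

lemma space_exp_law [simp]: "space (exp_law l) = UNIV"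
  by (simp add: exp_law_def)

lemma nn_integral_exp_law:
  assumes [measurable]: "f \<in> borel_measurable borel"
  shows "(\<integral>\<^sup>+x. f x \<partial>exp_law l) = (\<integral>\<^sup>+x. ennreal (exponential_density l x) * f x \<partial>lborel)"
  unfolding exp_law_def by (subst nn_integral_density) auto

lemma AE_exp_law_pos: "AE x in exp_law l. x > 0"
  unfolding exp_law_def
  by (subst AE_density) (use AE_lborel_singleton[of 0] in \<open>auto simp: exponential_density_def elim: eventually_mono\<close>)

text \<open>An arbitrary test function is allowed, so that the lack of memory can be applied under
  further integrals. A shift of the variable by \<open>s\<close> turns the density at
  \<open>s + x\<close> into \<open>exp (- (l * s))\<close> times the density at
  \<open>x\<close>.\<close>

lemma exp_law_memoryless:
  assumes l: "l > 0" and s: "s \<ge> 0" and f[measurable]: "f \<in> borel_measurable borel"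
  shows "(\<integral>\<^sup>+x. f x * indicator {s<..} x \<partial>exp_law l)
         = ennreal (exp (- (l * s))) * (\<integral>\<^sup>+x. f (s + x) \<partial>exp_law l)"
proof -
  have "(\<integral>\<^sup>+x. f x * indicator {s<..} x \<partial>exp_law l)
      = (\<integral>\<^sup>+x. ennreal (exponential_density l x) * (f x * indicator {s<..} x) \<partial>lborel)"
    by (rule nn_integral_exp_law) measurable
  also have "\<dots> = (\<integral>\<^sup>+x. ennreal (exponential_density l (s + x)) * (f (s + x) * indicator {s<..} (s + x)) \<partial>lborel)"
    by (subst nn_integral_real_affine[where c=1 and t=s]) auto
  also have "\<dots> = (\<integral>\<^sup>+x. ennreal (exp (- (l * s))) * (ennreal (exponential_density l x) * f (s + x)) \<partial>lborel)"
  proof (rule nn_integral_cong_AE)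
    show "AE x in lborel. ennreal (exponential_density l (s + x)) * (f (s + x) * indicator {s<..} (s + x))
        = ennreal (exp (- (l * s))) * (ennreal (exponential_density l x) * f (s + x))"
      \<comment> \<open>At \<open>x = 0\<close> the strict indicator vanishes while the density does
        not, so this single point is left out.\<close>
      using AE_lborel_singleton[of 0]
    proof eventually_elim
      case (elim x)
      show ?case
      proof (cases "x > 0")
        case True
        then have "exponential_density l (s + x) = exp (- (l * s)) * exponential_density l x"
          using s by (simp add: exponential_density_def algebra_simps flip: exp_add)
        then show ?thesis
          using True l by (simp add: ennreal_mult exponential_density_nonneg mult_ac)
      next
        case False
        then show ?thesis using elim by (simp add: exponential_density_def)
      qed
    qed
  qed
  also have "\<dots> = ennreal (exp (- (l * s))) * (\<integral>\<^sup>+x. f (s + x) \<partial>exp_law l)"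
    by (subst nn_integral_cmult) (auto simp: nn_integral_exp_law)
  finally show ?thesis .
qed

lemma emeasure_exp_law_greaterThan:
  assumes "l > 0" "s \<ge> 0"
  shows "emeasure (exp_law l) {s<..} = ennreal (exp (- (l * s)))"
proof -
  interpret prob_space "exp_law l" by (rule prob_space_exp_law[OF assms(1)])
  show ?thesis
    using exp_law_memoryless[OF assms, of "\<lambda>_. 1"] emeasure_space_1 by simp
qed

section \<open>Products of exponential laws\<close>

lemma product_prob_space_exp_law:
  "(\<And>e. r e > 0) \<Longrightarrow> product_prob_space (\<lambda>e. exp_law (r e))"
  by (intro product_prob_spaceI prob_space_exp_law)

text \<open>The hazard rates of independent clocks add up in the survival factor, and the residual
  times of the survivors have the original joint law. The induction splits off one coordinate by
  Fubini.\<close>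

lemma PiM_exp_law_memoryless:
  fixes r :: "'e \<Rightarrow> real"
  assumes r: "\<And>e. r e > 0" and s: "s \<ge> 0" and "finite E"
    and "f \<in> borel_measurable (\<Pi>\<^sub>M e\<in>E. exp_law (r e))"
  shows "(\<integral>\<^sup>+x. f x * (\<Prod>e\<in>E. indicator {s<..} (x e)) \<partial>(\<Pi>\<^sub>M e\<in>E. exp_law (r e)))
         = ennreal (exp (- (sum r E * s))) * (\<integral>\<^sup>+x. f (\<lambda>e\<in>E. s + x e) \<partial>(\<Pi>\<^sub>M e\<in>E. exp_law (r e)))"
  using assms(3,4)
proof (induction E arbitrary: f rule: finite_induct)
  case empty
  interpret product_prob_space "\<lambda>e. exp_law (r e)" by (rule product_prob_space_exp_law[OF r])
  show ?case by (simp add: PiM_empty nn_integral_count_space_finite restrict_def)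
next
  case (insert k E)
  note [measurable] = insert.prems
  interpret product_prob_space "\<lambda>e. exp_law (r e)" by (rule product_prob_space_exp_law[OF r])
  let ?P = "\<lambda>E. \<Pi>\<^sub>M e\<in>E. exp_law (r e)"
  have eq: "(\<lambda>e\<in>insert k E. s + (x(k := y)) e) = (\<lambda>e\<in>E. s + x e)(k := s + y)" for x y
    using insert.hyps by (auto simp: fun_eq_iff)
  have "(\<integral>\<^sup>+x. f x * (\<Prod>e\<in>insert k E. indicator {s<..} (x e)) \<partial>?P (insert k E))
     = (\<integral>\<^sup>+x. (\<integral>\<^sup>+y. f (x(k := y)) * (\<Prod>e\<in>insert k E. indicator {s<..} ((x(k := y)) e)) \<partial>exp_law (r k)) \<partial>?P E)"
    using insert.hyps by (intro product_nn_integral_insert) measurable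
  also have "\<dots> = (\<integral>\<^sup>+x. (\<integral>\<^sup>+y. (f (x(k := y)) * (\<Prod>e\<in>E. indicator {s<..} (x e))) * indicator {s<..} y \<partial>exp_law (r k)) \<partial>?P E)"
  proof (intro nn_integral_cong)
    fix x y
    have "(\<Prod>e\<in>E. indicator {s<..} ((x(k := y)) e)) = (\<Prod>e\<in>E. indicator {s<..} (x e) :: ennreal)"
      using insert.hyps by (intro prod.cong) auto
    then show "f (x(k := y)) * (\<Prod>e\<in>insert k E. indicator {s<..} ((x(k := y)) e))
      = (f (x(k := y)) * (\<Prod>e\<in>E. indicator {s<..} (x e))) * indicator {s<..} y"
      using insert.hyps by (simp add: mult_ac)
  qed
  also have "\<dots> = (\<integral>\<^sup>+x. ennreal (exp (- (r k * s))) * (\<integral>\<^sup>+y. f (x(k := s + y)) * (\<Prod>e\<in>E. indicator {s<..} (x e)) \<partial>exp_law (r k)) \<partial>?P E)"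
  proof (intro nn_integral_cong exp_law_memoryless r s)
    fix x assume "x \<in> space (?P E)"
    then have [measurable]: "(\<lambda>y. x(k := y)) \<in> borel \<rightarrow>\<^sub>M ?P (insert k E)"
      by measurable
    show "(\<lambda>y. f (x(k := y)) * (\<Prod>e\<in>E. indicator {s<..} (x e))) \<in> borel_measurable borel"
      by measurable
  qed
  also have "\<dots> = ennreal (exp (- (r k * s))) * (\<integral>\<^sup>+x. (\<integral>\<^sup>+y. f (x(k := s + y)) \<partial>exp_law (r k)) * (\<Prod>e\<in>E. indicator {s<..} (x e)) \<partial>?P E)"
    by (subst nn_integral_cmult, measurable, intro arg_cong2[where f="(*)"] refl nn_integral_cong nn_integral_multc, measurable)
  also have "\<dots> = ennreal (exp (- (r k * s))) * (ennreal (exp (- (sum r E * s))) *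
      (\<integral>\<^sup>+x. (\<integral>\<^sup>+y. f ((\<lambda>e\<in>E. s + x e)(k := s + y)) \<partial>exp_law (r k)) \<partial>?P E))"
    by (subst insert.IH, measurable)
  also have "\<dots> = ennreal (exp (- (sum r (insert k E) * s))) *
      (\<integral>\<^sup>+x. (\<integral>\<^sup>+y. f ((\<lambda>e\<in>E. s + x e)(k := s + y)) \<partial>exp_law (r k)) \<partial>?P E)"
    using insert.hyps by (simp add: mult.assoc[symmetric] ennreal_mult[symmetric] algebra_simps flip: exp_add)
  also have "(\<integral>\<^sup>+x. (\<integral>\<^sup>+y. f ((\<lambda>e\<in>E. s + x e)(k := s + y)) \<partial>exp_law (r k)) \<partial>?P E)
     = (\<integral>\<^sup>+x. f (\<lambda>e\<in>insert k E. s + x e) \<partial>?P (insert k E))"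
  proof -
    have m: "(\<lambda>x. f (\<lambda>e\<in>insert k E. s + x e)) \<in> borel_measurable (?P (insert k E))" by measurable
    show ?thesis
      by (subst product_nn_integral_insert[OF insert.hyps m]) (simp only: eq)
  qed
  finally show ?case .
qed

text \<open>Overwriting coordinate \<open>k\<close> by an independent draw integrates its old value
  out, which amounts to a change of the rate at \<open>k\<close>. An event of the cloud acts on the
  clocks in this way.\<close>

lemma nn_integral_PiM_exp_law_update:
  fixes r :: "'e \<Rightarrow> real"
  assumes r: "\<And>e. r e > 0" and a: "a > 0" and E: "finite E" "k \<in> E"
    and f: "f \<in> borel_measurable (\<Pi>\<^sub>M e\<in>E. exp_law (r e))"
  shows "(\<integral>\<^sup>+y. (\<integral>\<^sup>+x. f (x(k := y)) \<partial>(\<Pi>\<^sub>M e\<in>E. exp_law (r e))) \<partial>exp_law a)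
       = (\<integral>\<^sup>+x. f x \<partial>(\<Pi>\<^sub>M e\<in>E. exp_law ((r(k := a)) e)))"
proof -
  define E' where "E' = E - {k}"
  have E': "E = insert k E'" "finite E'" "k \<notin> E'" using E by (auto simp: E'_def)
  interpret P: product_prob_space "\<lambda>e. exp_law (r e)" by (rule product_prob_space_exp_law[OF r])
  interpret Q: product_prob_space "\<lambda>e. exp_law ((r(k := a)) e)"
    by (rule product_prob_space_exp_law) (use r a in auto)
  have [measurable]: "f \<in> borel_measurable (\<Pi>\<^sub>M e\<in>insert k E'. exp_law (r e))"
    using f by (simp add: E')
  have s: "sets (\<Pi>\<^sub>M e\<in>insert k E'. exp_law ((r(k := a)) e)) = sets (\<Pi>\<^sub>M e\<in>insert k E'. exp_law (r e))"
    by (intro sets_PiM_cong) auto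
  have "(\<integral>\<^sup>+x. f x \<partial>(\<Pi>\<^sub>M e\<in>E. exp_law ((r(k := a)) e)))
    = (\<integral>\<^sup>+y. (\<integral>\<^sup>+x. f (x(k := y)) \<partial>(\<Pi>\<^sub>M e\<in>E'. exp_law ((r(k := a)) e))) \<partial>exp_law ((r(k := a)) k))"
    unfolding E'(1) using E' f
    by (intro Q.product_nn_integral_insert_rev) (auto simp: measurable_cong_sets[OF s refl])
  also have "(\<Pi>\<^sub>M e\<in>E'. exp_law ((r(k := a)) e)) = (\<Pi>\<^sub>M e\<in>E'. exp_law (r e))"
    using E' by (intro PiM_cong) auto
  finally have 1: "(\<integral>\<^sup>+x. f x \<partial>(\<Pi>\<^sub>M e\<in>E. exp_law ((r(k := a)) e)))
    = (\<integral>\<^sup>+y. (\<integral>\<^sup>+x. f (x(k := y)) \<partial>(\<Pi>\<^sub>M e\<in>E'. exp_law (r e))) \<partial>exp_law a)"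
    unfolding fun_upd_same .
  have "(\<integral>\<^sup>+x. f (x(k := y)) \<partial>(\<Pi>\<^sub>M e\<in>E. exp_law (r e)))
      = (\<integral>\<^sup>+x. f (x(k := y)) \<partial>(\<Pi>\<^sub>M e\<in>E'. exp_law (r e)))" for y
    unfolding E'(1) 
    using E' prob_space.emeasure_space_1[OF prob_space_exp_law[OF r[of k]]]
    by (subst P.product_nn_integral_insert) (auto intro!: measurable_compose[OF _ f[unfolded E'(1)]] measurable_fun_upd[where J="insert k E'"])
  then show ?thesis by (simp only: 1)
qed

section \<open>The race of independent clocks\<close>

definition beats_all :: "'e set \<Rightarrow> 'e \<Rightarrow> ('e \<Rightarrow> real) \<Rightarrow> bool" where
  "beats_all E k x \<longleftrightarrow> (\<forall>e\<in>E - {k}. x k < x e)"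

lemma measurable_beats_all [measurable]:
  assumes "finite E" "k \<in> E"
  shows "Measurable.pred (\<Pi>\<^sub>M e\<in>E. exp_law (r e)) (beats_all E k)"
proof -
  have [measurable]: "(\<lambda>x. x e) \<in> borel_measurable (\<Pi>\<^sub>M e\<in>E. exp_law (r e))" if "e \<in> E" for e
    using measurable_component_singleton[OF that, of "\<lambda>e. exp_law (r e)"] by (simp cong: measurable_cong_sets)
  show ?thesis
    unfolding beats_all_def using assms by (intro pred_intros_finite finite_Diff) measurable
qed

text \<open>Given the value \<open>s\<close> of clock \<open>k\<close>, the others have to outlive
  \<open>s\<close>, and what then remains of them is fresh. The right-hand side still integrates
  over coordinate \<open>k\<close>, which is overwritten by \<open>s\<close>, so that the law is the
  same for every winner.\<close>

lemma exp_law_beats_all: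
  fixes r :: "'e \<Rightarrow> real"
  assumes r: "\<And>e. r e > 0" and E: "finite E" "k \<in> E"
    and f[measurable]: "f \<in> borel_measurable (\<Pi>\<^sub>M e\<in>E. exp_law (r e))"
  shows "(\<integral>\<^sup>+x. f x * indicator {x. beats_all E k x} x \<partial>(\<Pi>\<^sub>M e\<in>E. exp_law (r e)))
       = ennreal (r k / sum r E) * (\<integral>\<^sup>+s. (\<integral>\<^sup>+x. f ((\<lambda>e\<in>E. s + x e)(k := s))
           \<partial>(\<Pi>\<^sub>M e\<in>E. exp_law (r e))) \<partial>exp_law (sum r E))"
proof -
  define E' where "E' = E - {k}"
  have E': "E = insert k E'" "finite E'" "k \<notin> E'" using E by (auto simp: E'_def)
  interpret product_prob_space "\<lambda>e. exp_law (r e)" by (rule product_prob_space_exp_law[OF r])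
  let ?P = "\<lambda>E. \<Pi>\<^sub>M e\<in>E. exp_law (r e)"
  have [measurable]: "f \<in> borel_measurable (?P (insert k E'))" using f by (simp add: E')
  have D: "sum r E > 0" using E r by (intro sum_pos) auto
  define g where "g s = (\<integral>\<^sup>+x. f ((\<lambda>e\<in>E'. s + x e)(k := s)) \<partial>?P E')" for s
  have g[measurable]: "g \<in> borel_measurable borel"
  proof -
    interpret PE': prob_space "?P E'" by (intro prob_space_PiM prob_space_exp_law r)
    have "(\<lambda>(s, x). (\<lambda>e\<in>E'. s + x e)(k := s)) \<in> borel \<Otimes>\<^sub>M ?P E' \<rightarrow>\<^sub>M ?P (insert k E')"
      unfolding case_prod_beta by (rule measurable_fun_upd[where J=E']) (auto simp: E'(3))
    then show ?thesis unfolding g_def by measurable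
  qed
  have "(\<integral>\<^sup>+x. f x * indicator {x. beats_all E k x} x \<partial>?P E)
      = (\<integral>\<^sup>+s. (\<integral>\<^sup>+x. f (x(k := s)) * indicator {x. beats_all E k x} (x(k := s)) \<partial>?P E') \<partial>exp_law (r k))"
    unfolding E'(1) using E' by (intro product_nn_integral_insert_rev) measurable
  also have "\<dots> = (\<integral>\<^sup>+s. (\<integral>\<^sup>+x. f (x(k := s)) * (\<Prod>e\<in>E'. indicator {s<..} (x e)) \<partial>?P E') \<partial>exp_law (r k))"
  proof (intro nn_integral_cong)
    fix s x
    have "(\<Prod>e\<in>E'. indicator {s<..} (x e) :: ennreal) = indicator {x. beats_all E k x} (x(k := s))"
    proof (cases "\<forall>e\<in>E'. s < x e")
      case True
      then show ?thesis by (auto simp: beats_all_def E'_def intro!: prod.neutral)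
    next
      case False
      then have "(\<Prod>e\<in>E'. indicator {s<..} (x e) :: ennreal) = 0"
        using E'(2) by (auto simp: prod_zero_iff indicator_def)
      then show ?thesis using False by (auto simp: beats_all_def E'_def)
    qed
    then show "f (x(k := s)) * indicator {x. beats_all E k x} (x(k := s)) = f (x(k := s)) * (\<Prod>e\<in>E'. indicator {s<..} (x e))"
      by simp
  qed
  also have "\<dots> = (\<integral>\<^sup>+s. ennreal (exp (- (sum r E' * s))) * g s \<partial>exp_law (r k))"
  proof (rule nn_integral_cong_AE)
    show "AE s in exp_law (r k). (\<integral>\<^sup>+x. f (x(k := s)) * (\<Prod>e\<in>E'. indicator {s<..} (x e)) \<partial>?P E')
       = ennreal (exp (- (sum r E' * s))) * g s"
      using AE_exp_law_pos
    proof eventually_elim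
      case (elim s)
      have "(\<lambda>x. x(k := s)) \<in> ?P E' \<rightarrow>\<^sub>M ?P (insert k E')" by measurable
      from PiM_exp_law_memoryless[OF r _ E'(2), of s "\<lambda>x. f (x(k := s))"] this elim
      show ?case by (simp add: g_def)
    qed
  qed
  \<comment> \<open>The density of clock \<open>k\<close> times the survival probability of the
    others is \<open>r k / sum r E\<close> times the density of the minimum of all clocks.\<close>
  also have "\<dots> = (\<integral>\<^sup>+s. ennreal (r k / sum r E) * (ennreal (exponential_density (sum r E) s) * g s) \<partial>lborel)"
  proof (subst nn_integral_exp_law, measurable, intro nn_integral_cong)
    fix s :: real
    have "exponential_density (r k) s * exp (- (sum r E' * s)) = r k / sum r E * exponential_density (sum r E) s"
    proof -
      have "exp (- s * r k) * exp (- (sum r E' * s)) = exp (- s * sum r E)"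
        using E' by (simp add: algebra_simps flip: exp_add)
      then show ?thesis using D by (simp add: exponential_density_def mult.assoc)
    qed
    then have "ennreal (exponential_density (r k) s) * ennreal (exp (- (sum r E' * s)))
       = ennreal (r k / sum r E) * ennreal (exponential_density (sum r E) s)"
      using D r[of k] by (simp add: ennreal_mult[symmetric] exponential_density_nonneg)
    then show "ennreal (exponential_density (r k) s) * (ennreal (exp (- (sum r E' * s))) * g s)
       = ennreal (r k / sum r E) * (ennreal (exponential_density (sum r E) s) * g s)"
      by (simp add: mult.assoc[symmetric])
  qed
  also have "\<dots> = ennreal (r k / sum r E) * (\<integral>\<^sup>+s. g s \<partial>exp_law (sum r E))"
    by (subst nn_integral_cmult, measurable, subst nn_integral_exp_law, measurable)
  \<comment> \<open>Coordinate \<open>k\<close> returns as a dummy variable, whose law has mass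
    1.\<close>
  also have "g = (\<lambda>s. \<integral>\<^sup>+x. f ((\<lambda>e\<in>E. s + x e)(k := s)) \<partial>?P E)"
  proof (rule ext)
    fix s :: real
    have u: "(\<lambda>e\<in>insert k E'. s + (x(k := y)) e)(k := s) = (\<lambda>e\<in>E'. s + x e)(k := s)" for x y
      using E' by (auto simp: fun_eq_iff)
    have m: "(\<lambda>x. f ((\<lambda>e\<in>insert k E'. s + x e)(k := s))) \<in> borel_measurable (?P (insert k E'))"
      by (rule measurable_compose[OF _ f[unfolded E'(1)]], rule measurable_fun_upd[where J="insert k E'"]) auto
    show "g s = (\<integral>\<^sup>+x. f ((\<lambda>e\<in>E. s + x e)(k := s)) \<partial>?P E)"
      unfolding E'(1) g_def
      by (subst product_nn_integral_insert[OF E'(2,3) m], subst u)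
         (use prob_space.emeasure_space_1[OF prob_space_exp_law[OF r[of k]]] in simp)
  qed
  finally show ?thesis .
qed

text \<open>That one clock beats all others holds almost surely because the probabilities
  \<open>r k / sum r E\<close> of these disjoint events add up to 1.\<close>

theorem exp_law_competition:
  fixes r :: "'e \<Rightarrow> real"
  assumes r: "\<And>e. r e > 0" and E: "finite E" "E \<noteq> {}"
    and f[measurable]: "f \<in> borel_measurable (\<Pi>\<^sub>M e\<in>E. exp_law (r e))"
  shows "(\<integral>\<^sup>+x. f x \<partial>(\<Pi>\<^sub>M e\<in>E. exp_law (r e)))
       = (\<Sum>k\<in>E. ennreal (r k / sum r E) * (\<integral>\<^sup>+s. (\<integral>\<^sup>+x. f ((\<lambda>e\<in>E. s + x e)(k := s))
           \<partial>(\<Pi>\<^sub>M e\<in>E. exp_law (r e))) \<partial>exp_law (sum r E)))"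
proof -
  let ?P = "\<Pi>\<^sub>M e\<in>E. exp_law (r e)"
  let ?b = "\<lambda>x. \<Sum>k\<in>E. indicator {x. beats_all E k x} x :: ennreal"
  interpret product_prob_space "\<lambda>e. exp_law (r e)" by (rule product_prob_space_exp_law[OF r])
  have D: "sum r E > 0" using E r by (intro sum_pos) auto
  interpret PE: prob_space ?P by (intro prob_space_PiM prob_space_exp_law r)
  interpret D: prob_space "exp_law (sum r E)" by (rule prob_space_exp_law[OF D])
  have m[measurable]: "(\<lambda>x. indicator {x. beats_all E k x} x :: ennreal) \<in> borel_measurable ?P" if "k \<in> E" for k
    using measurable_beats_all[OF E(1) that, of r] by (intro borel_measurable_indicator') simp
  have le: "?b x \<le> 1" for x
  proof (cases "\<exists>k\<in>E. beats_all E k x")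
    case True
    then obtain k where k: "k \<in> E" "beats_all E k x" by auto
    then have "\<not> beats_all E e x" if "e \<in> E" "e \<noteq> k" for e
      using that unfolding beats_all_def by (metis DiffI less_asym singletonD)
    then have "?b x = (\<Sum>e\<in>E. if e = k then 1 else 0)"
      using k by (intro sum.cong) auto
    then show ?thesis using E k by simp
  next
    case False
    then have "?b x = 0" by (intro sum.neutral) auto
    then show ?thesis by simp
  qed
  have "(\<integral>\<^sup>+x. ?b x \<partial>?P) = (\<Sum>k\<in>E. \<integral>\<^sup>+x. 1 * indicator {x. beats_all E k x} x \<partial>?P)"
    by (subst nn_integral_sum) (use E in auto)
  also have "\<dots> = (\<Sum>k\<in>E. ennreal (r k / sum r E))"
    by (intro sum.cong refl, subst exp_law_beats_all)
       (use r E D.emeasure_space_1 PE.emeasure_space_1 in auto)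
  also have "\<dots> = ennreal (\<Sum>k\<in>E. r k / sum r E)"
    using D r by (intro sum_ennreal) (simp add: less_imp_le)
  also have "\<dots> = 1" using D by (simp flip: sum_divide_distrib)
  finally have int: "(\<integral>\<^sup>+x. ?b x \<partial>?P) = 1" .
  have "(\<integral>\<^sup>+x. 1 - ?b x \<partial>?P) = (\<integral>\<^sup>+x. 1 \<partial>?P) - (\<integral>\<^sup>+x. ?b x \<partial>?P)"
    using int le by (intro nn_integral_diff) (auto simp del: nn_integral_indicator)
  also have "\<dots> = 0" using int PE.emeasure_space_1 by simp
  finally have "AE x in ?P. 1 - ?b x = 0"
    by (subst (asm) nn_integral_0_iff_AE) measurable
  then have "AE x in ?P. ?b x = 1"
    by eventually_elim (use le in \<open>metis antisym diff_eq_0_iff_ennreal ennreal_one_neq_top le_cases not_less_iff_gr_or_eq ennreal_minus_eq_0\<close>)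
  then have "(\<integral>\<^sup>+x. f x \<partial>?P) = (\<integral>\<^sup>+x. f x * ?b x \<partial>?P)"
    by (intro nn_integral_cong_AE) (auto elim: eventually_mono)
  also have "\<dots> = (\<Sum>k\<in>E. \<integral>\<^sup>+x. f x * indicator {x. beats_all E k x} x \<partial>?P)"
    by (subst nn_integral_sum[symmetric]) (use E in \<open>auto simp: sum_distrib_left\<close>)
  also have "\<dots> = (\<Sum>k\<in>E. ennreal (r k / sum r E) * (\<integral>\<^sup>+s. (\<integral>\<^sup>+x. f ((\<lambda>e\<in>E. s + x e)(k := s))
           \<partial>?P) \<partial>exp_law (sum r E)))"
    using r E by (intro sum.cong refl exp_law_beats_all) auto
  finally show ?thesis .
qed

section \<open>The states of the decomposed process under exponential laws\<close>

text \<open>For every fixed \<open>y\<close> the excess over \<open>y\<close> is again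
  \<open>exp_law a\<close>, with weight \<open>exp (- (a * y))\<close>. The weights integrate to the
  probability of the conditioning event and cancel, whatever law \<open>N\<close> has on the
  nonnegative reals. All residual laws of the model reduce to this one case,
  \<open>gamma_law\<close> and \<open>psi_law\<close> after \<open>phi_law\<close>.\<close>

lemma residual_law_exp_law:
  assumes a: "a > 0" and N: "prob_space N" "AE y in N. y \<ge> 0" and sN [measurable_cong, simp]: "sets N = sets borel"
  shows "residual_law (exp_law a) N = exp_law a"
proof (rule measure_eqI)
  interpret M: prob_space "exp_law a" by (rule prob_space_exp_law[OF a])
  interpret N: prob_space N by fact
  interpret P: pair_prob_space "exp_law a" N ..
  let ?S = "{(x, y). x > y} :: (real \<times> real) set"
  let ?P = "exp_law a \<Otimes>\<^sub>M N"
  have spN [simp]: "space N = UNIV" using sets_eq_imp_space_eq[OF sN] by simp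
  have S[measurable]: "?S \<in> sets ?P"
    using borel_measurable_pred_less[of snd ?P fst] by (simp add: pred_def space_pair_measure case_prod_beta')
  show "sets (residual_law (exp_law a) N) = sets (exp_law a)"
    by (simp add: residual_law_def)
  \<comment> \<open>The Laplace transform of \<open>N\<close> at \<open>a\<close>, which is also the
    probability of \<open>?S\<close>.\<close>
  define c where "c = (\<integral>\<^sup>+y. ennreal (exp (- (a * y))) \<partial>N)"
  have key: "emeasure ?P (?S \<inter> {(x, y). x - y \<in> A}) = emeasure (exp_law a) A * c" if [measurable]: "A \<in> sets borel" for A
  proof -
    have "{(x, y). x - y \<in> A} \<in> sets ?P"
      using measurable_sets[of "\<lambda>(x, y). x - y" ?P borel A] by (simp add: space_pair_measure vimage_def case_prod_beta')
    then have "?S \<inter> {(x, y). x - y \<in> A} \<in> sets ?P" by (rule sets.Int[OF S])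
    then have "emeasure ?P (?S \<inter> {(x, y). x - y \<in> A}) = (\<integral>\<^sup>+z. indicator (?S \<inter> {(x, y). x - y \<in> A}) z \<partial>?P)"
      by (rule nn_integral_indicator[symmetric])
    also have "\<dots> = (\<integral>\<^sup>+z. (case z of (x, y) \<Rightarrow> indicator A (x - y) * indicator {y<..} x) \<partial>?P)"
      by (intro nn_integral_cong) (auto split: split_indicator)
    also have "\<dots> = (\<integral>\<^sup>+y. (\<integral>\<^sup>+x. indicator A (x - y) * indicator {y<..} x \<partial>exp_law a) \<partial>N)"
    proof (subst P.nn_integral_snd[symmetric])
      have "(\<lambda>z::real \<times> real. indicator {snd z<..} (fst z) :: ennreal) = (\<lambda>z. indicator ?S z)"
        by (auto split: split_indicator)
      then have [measurable]: "(\<lambda>z. indicator {snd z<..} (fst z) :: ennreal) \<in> borel_measurable ?P"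
        by simp
      show "(\<lambda>z. case z of (x, y) \<Rightarrow> (indicator A (x - y) * indicator {y<..} x :: ennreal)) \<in> borel_measurable ?P"
        unfolding case_prod_beta' by measurable
    qed simp
    also have "\<dots> = (\<integral>\<^sup>+y. emeasure (exp_law a) A * ennreal (exp (- (a * y))) \<partial>N)"
    proof (rule nn_integral_cong_AE, use N(2) in eventually_elim)
      case (elim y)
      then show ?case
        using exp_law_memoryless[OF a elim, of "\<lambda>x. indicator A (x - y)"] by (simp add: mult.commute)
    qed
    also have "\<dots> = emeasure (exp_law a) A * c"
      unfolding c_def by (rule nn_integral_cmult) measurable
    finally show ?thesis .
  qed
  have c1: "emeasure ?P ?S = c"
    using key[of UNIV] M.emeasure_space_1 by simp
  \<comment> \<open>Cancellation in \<open>ennreal\<close> needs a divisor that is neither zero nor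
    infinite.\<close>
  have "c \<noteq> 0"
    unfolding c_def by (subst nn_integral_0_iff_AE) (auto simp: N.AE_False)
  moreover have "c \<noteq> \<top>"
    using P.emeasure_finite c1 by metis
  ultimately have c: "emeasure (exp_law a) A * c / c = emeasure (exp_law a) A" for A
    by (metis ennreal_times_divide ennreal_divide_self mult.right_neutral less_top)
  fix A assume "A \<in> sets (residual_law (exp_law a) N)"
  then have A[measurable]: "A \<in> sets borel" by (simp add: residual_law_def)
  have "emeasure (residual_law (exp_law a) N) A = emeasure (uniform_measure ?P ?S) {(x, y). x - y \<in> A}"
    unfolding residual_law_def
  proof (subst emeasure_distr)
    show "(\<lambda>(x, y). x - y) \<in> uniform_measure ?P ?S \<rightarrow>\<^sub>M borel"
      unfolding measurable_cong_sets[OF sets_uniform_measure refl] by measurable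
  qed (auto simp: space_pair_measure vimage_def case_prod_beta')
  also have "\<dots> = emeasure ?P (?S \<inter> {(x, y). x - y \<in> A}) / emeasure ?P ?S"
  proof (rule emeasure_uniform_measure[OF S])
    show "{(x, y). x - y \<in> A} \<in> sets ?P"
      using measurable_sets[of "\<lambda>(x, y). x - y" ?P borel A] by (simp add: space_pair_measure vimage_def case_prod_beta')
  qed
  finally show "emeasure (residual_law (exp_law a) N) A = emeasure (exp_law a) A"
    by (simp add: key c1 c)
qed

lemma AE_exp_law_nonneg: "AE x in exp_law l. x \<ge> 0"
  using AE_exp_law_pos by eventually_elim simp

lemma convolution_exp_law:
  assumes a: "a > 0" and b: "b > 0"
  shows "prob_space (convolution (exp_law a) (exp_law b))"
    and "AE x in convolution (exp_law a) (exp_law b). x \<ge> 0"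
proof -
  interpret M: prob_space "exp_law a" by (rule prob_space_exp_law[OF a])
  interpret N: prob_space "exp_law b" by (rule prob_space_exp_law[OF b])
  interpret P: pair_prob_space "exp_law a" "exp_law b" ..
  show "prob_space (convolution (exp_law a) (exp_law b))"
    unfolding convolution_def by (rule P.prob_space_distr) measurable
  have "AE x in exp_law a. AE y in exp_law b. 0 \<le> x + y"
    using AE_exp_law_nonneg[of a]
  proof eventually_elim
    case (elim x)
    then show ?case using AE_exp_law_nonneg[of b] by (auto elim: eventually_mono)
  qed
  then have "AE z in exp_law a \<Otimes>\<^sub>M exp_law b. 0 \<le> (case z of (x, y) \<Rightarrow> x + y)"
  proof (intro P.AE_pair_measure)
    show "{z \<in> space (exp_law a \<Otimes>\<^sub>M exp_law b). 0 \<le> (case z of (x, y) \<Rightarrow> x + y)} \<in> sets (exp_law a \<Otimes>\<^sub>M exp_law b)"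
      by measurable
  qed simp
  then show "AE x in convolution (exp_law a) (exp_law b). x \<ge> 0"
    unfolding convolution_def by (subst AE_distr_iff) auto
qed

lemma soj_law_exp_law:
  assumes "lz > 0" "lu > 0"
  shows "soj_law (exp_law lz) (exp_law lu) i j = exp_law lz"
  unfolding soj_law_def xddot_law_def xdot_law_def
  using assms
  by (simp add: residual_law_exp_law prob_space_exp_law AE_exp_law_nonneg convolution_exp_law)

lemma rec_law_exp_law:
  assumes "lz > 0" "lu > 0"
  shows "rec_law (exp_law lz) (exp_law lu) i j h = exp_law lu"
  unfolding rec_law_def psi_law_def gamma_law_def phi_law_def xdot_law_def
  using assms
  by (simp add: residual_law_exp_law prob_space_exp_law AE_exp_law_nonneg)

text \<open>The index \<open>j\<close> disappears on the right: states with the same number of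
  recruiters become indistinguishable, so the process can be lumped to its levels.\<close>

lemma residuals_exp_law:
  assumes "lz > 0" "lu > 0"
  shows "residuals n (exp_law lz) (exp_law lu) i j
    = (\<Pi>\<^sub>M r\<in>{1..2 * n - i}. exp_law lz) \<Otimes>\<^sub>M (\<Pi>\<^sub>M h\<in>{1..i}. exp_law lu)"
  using assms by (simp add: residuals_def soj_law_exp_law rec_law_exp_law)

section \<open>The law of the first event\<close>

definition total_rate :: "nat \<Rightarrow> real \<Rightarrow> real \<Rightarrow> nat \<Rightarrow> real" where
  "total_rate n lz lu i = (2 * real n - real i) * lz + real i * lu"

lemma total_rate_pos:
  assumes "n \<ge> 1" "i \<le> n" "lz > 0" "lu > 0"
  shows "total_rate n lz lu i > 0"
proof -
  have "2 * real n - real i > 0" using assms by linarith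
  then show ?thesis using assms by (auto simp: total_rate_def intro!: add_pos_nonneg)
qed

text \<open>The kernel is prescribed for every real time; at negative times \<open>max\<close>
  yields the survival probability 1.\<close>

lemma emeasure_exp_law_greaterThan_max:
  assumes "l > 0"
  shows "emeasure (exp_law l) {s<..} = ennreal (exp (- (l * max 0 s)))"
proof (cases "s \<ge> 0")
  case True
  then show ?thesis using emeasure_exp_law_greaterThan[OF assms, of s] by simp
next
  case False
  interpret prob_space "exp_law l" by (rule prob_space_exp_law[OF assms])
  have "emeasure (exp_law l) {s<..} = 1"
    using AE_exp_law_pos[of l] False by (intro emeasure_eq_1_AE) (auto elim: eventually_mono)
  then show ?thesis using False by simp
qed

lemma measure_exp_law_atMost:
  assumes "l > 0"
  shows "measure (exp_law l) {..t} = 1 - exp (- (l * max 0 t))"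
proof -
  interpret prob_space "exp_law l" by (rule prob_space_exp_law[OF assms])
  have "prob (space (exp_law l) - {t<..}) = 1 - prob {t<..}"
    by (rule prob_compl) simp
  moreover have "space (exp_law l) - {t<..} = {..t}" by auto
  ultimately show ?thesis
    by (simp add: emeasure_exp_law_greaterThan_max[OF assms] measure_def)
qed

lemma emeasure_PiM_exp_law_greaterThan:
  assumes l: "l > 0" and "finite E"
  shows "emeasure (\<Pi>\<^sub>M e\<in>E. exp_law l) (\<Pi>\<^sub>E e\<in>E. {t<..}) = ennreal (exp (- (real (card E) * l * max 0 t)))"
proof -
  interpret product_prob_space "\<lambda>_. exp_law l" by (intro product_prob_spaceI prob_space_exp_law l)
  show ?thesis
    using assms
    by (subst emeasure_PiM) (auto simp: emeasure_exp_law_greaterThan_max ennreal_power mult_ac simp flip: exp_of_nat_mult)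
qed

context
  fixes n i :: nat and lz lu :: real
  assumes n: "n \<ge> 1" and i: "i \<le> n" and lz: "lz > 0" and lu: "lu > 0"
begin

interpretation Soj: product_prob_space "\<lambda>_. exp_law lz" "{1..2 * n - i}"
  by (intro product_prob_spaceI prob_space_exp_law lz)
interpretation Rec: product_prob_space "\<lambda>_. exp_law lu" "{1..i}"
  by (intro product_prob_spaceI prob_space_exp_law lu)
interpretation Res: pair_prob_space "\<Pi>\<^sub>M r\<in>{1..2 * n - i}. exp_law lz" "\<Pi>\<^sub>M h\<in>{1..i}. exp_law lu" ..

lemma prob_space_residuals: "prob_space (residuals n (exp_law lz) (exp_law lu) i j)"
  unfolding residuals_exp_law[OF lz lu] by (rule Res.P.prob_space_axioms)

lemma first_event_greater:
  "first_event n i (s, c) > t \<longleftrightarrow> (\<forall>r\<in>{1..2 * n - i}. s r > t) \<and> (\<forall>h\<in>{1..i}. c h > t)"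
proof -
  have "{1..2 * n - i} \<noteq> {}" using n i by auto
  then show ?thesis by (auto simp: first_event_def)
qed

lemma first_event_greater_set:
  "{x \<in> space (residuals n (exp_law lz) (exp_law lu) i j). first_event n i x > t}
    = (\<Pi>\<^sub>E r\<in>{1..2 * n - i}. {t<..}) \<times> (\<Pi>\<^sub>E h\<in>{1..i}. {t<..})"
  unfolding residuals_exp_law[OF lz lu]
  by (auto simp: space_pair_measure space_PiM first_event_greater PiE_iff)

lemma measurable_first_event [measurable]:
  "first_event n i \<in> borel_measurable (residuals n (exp_law lz) (exp_law lu) i j)"
proof (rule borel_measurable_iff_greater[THEN iffD2], rule allI)
  fix t
  show "{x \<in> space (residuals n (exp_law lz) (exp_law lu) i j). first_event n i x > t}
      \<in> sets (residuals n (exp_law lz) (exp_law lu) i j)"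
    unfolding first_event_greater_set unfolding residuals_exp_law[OF lz lu]
    by (intro pair_measureI sets_PiM_I_finite) auto
qed

lemma measure_first_event_greater:
  "measure (residuals n (exp_law lz) (exp_law lu) i j)
     {x \<in> space (residuals n (exp_law lz) (exp_law lu) i j). first_event n i x > t}
   = exp (- (total_rate n lz lu i * max 0 t))"
proof -
  have "emeasure (residuals n (exp_law lz) (exp_law lu) i j)
       {x \<in> space (residuals n (exp_law lz) (exp_law lu) i j). first_event n i x > t}
     = ennreal (exp (- (real (2 * n - i) * lz * max 0 t))) * ennreal (exp (- (real i * lu * max 0 t)))"
    unfolding first_event_greater_set
    unfolding residuals_exp_law[OF lz lu]
    by (subst Rec.P.emeasure_pair_measure_Times)
       (auto simp: emeasure_PiM_exp_law_greaterThan lz lu intro!: sets_PiM_I_finite)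
  also have "\<dots> = ennreal (exp (- (total_rate n lz lu i * max 0 t)))"
    using i by (simp add: ennreal_mult[symmetric] total_rate_def algebra_simps of_nat_diff flip: exp_add)
  finally show ?thesis by (simp add: measure_def)
qed

lemma measure_first_event_le:
  "measure (residuals n (exp_law lz) (exp_law lu) i j)
     {x \<in> space (residuals n (exp_law lz) (exp_law lu) i j). first_event n i x \<le> t}
   = measure (exp_law (total_rate n lz lu i)) {..t}"
proof -
  interpret prob_space "residuals n (exp_law lz) (exp_law lu) i j" by (rule prob_space_residuals)
  show ?thesis
    using prob_neg[of "\<lambda>x. first_event n i x > t"]
    by (simp add: not_less measure_first_event_greater measure_exp_law_atMost[OF total_rate_pos[OF n i lz lu]])
qed

lemma mean_W_exp_law: "mean_W n (exp_law lz) (exp_law lu) i j = 1 / total_rate n lz lu i"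
proof -
  let ?D = "total_rate n lz lu i"
  interpret prob_space "exp_law ?D" by (rule prob_space_exp_law[OF total_rate_pos[OF n i lz lu]])
  have "(\<integral>\<^sup>+t. ennreal (exponential_density ?D t) \<partial>lborel) = 1"
    using emeasure_space_1 nn_integral_exp_law[of "\<lambda>_. 1" ?D] by simp
  then have 1: "(\<integral>t. exponential_density ?D t \<partial>lborel) = 1"
    by (subst integral_eq_nn_integral) (auto simp: exponential_density_nonneg total_rate_pos[OF n i lz lu])
  have "mean_W n (exp_law lz) (exp_law lu) i j = (\<integral>t. 1 / ?D * exponential_density ?D t \<partial>lborel)"
    unfolding mean_W_def measure_first_event_greater set_lebesgue_integral_def
    using total_rate_pos[OF n i lz lu] by (intro Bochner_Integration.integral_cong) (auto simp: exponential_density_def indicator_def)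
  also have "\<dots> = 1 / ?D"
    by (subst integral_mult_right_zero) (simp add: 1)
  finally show ?thesis .
qed

text \<open>The time of the first event is independent of which clock rings, hence the product. The
  recruitments compete among themselves, and the vehicles enter as a survival factor. A general set
  \<open>T\<close> serves \<open>p_prob\<close> (with \<open>UNIV\<close>) and
  \<open>p_until\<close> (with \<open>{..t}\<close>) at once.\<close>

lemma measure_recruits_first:
  assumes k: "k \<in> {1..i}" and T[measurable]: "T \<in> sets borel"
  shows "measure (residuals n (exp_law lz) (exp_law lu) i j)
     {x \<in> space (residuals n (exp_law lz) (exp_law lu) i j). recruits_first n i k x \<and> first_event n i x \<in> T}
   = lu / total_rate n lz lu i * measure (exp_law (total_rate n lz lu i)) T"
proof -
  let ?A = "{1..2 * n - i}" and ?B = "{1..i}" and ?D = "total_rate n lz lu i"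
  let ?PA = "\<Pi>\<^sub>M r\<in>?A. exp_law lz" and ?PB = "\<Pi>\<^sub>M h\<in>?B. exp_law lu"
  let ?a = "real (2 * n - i) * lz"
  interpret D: prob_space "exp_law ?D" by (rule prob_space_exp_law[OF total_rate_pos[OF n i lz lu]])
  have i0: "i > 0" using k by auto
  have D_eq: "?D = ?a + real i * lu" using i by (simp add: total_rate_def of_nat_diff)
  have Bl: "real i * lu > 0" using i0 lu by simp
  have mk[measurable]: "(\<lambda>c. c k) \<in> borel_measurable ?PB"
    using measurable_component_singleton[OF k, of "\<lambda>_. exp_law lu"] by (simp cong: measurable_cong_sets)
  have mA: "(\<lambda>s. s r) \<in> borel_measurable ?PA" if "r \<in> ?A" for r
    using measurable_component_singleton[OF that, of "\<lambda>_. exp_law lz"] by (simp cong: measurable_cong_sets)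
  have ev: "recruits_first n i k (s, c) \<and> first_event n i (s, c) \<in> T \<longleftrightarrow>
      (\<forall>r\<in>?A. s r > c k) \<and> beats_all ?B k c \<and> c k \<in> T" for s c
  proof -
    have ne: "?A \<noteq> {}" using n i by auto
    have rf: "recruits_first n i k (s, c) \<longleftrightarrow> (\<forall>r\<in>?A. s r > c k) \<and> beats_all ?B k c"
      unfolding recruits_first_def beats_all_def using ne by auto
    have "first_event n i (s, c) = c k" if "(\<forall>r\<in>?A. s r > c k) \<and> beats_all ?B k c"
      unfolding first_event_def prod.case
    proof (rule Min_eqI)
      fix y assume "y \<in> s ` ?A \<union> c ` ?B"
      then show "c k \<le> y"
      proof (elim UnE imageE)
        fix h assume "y = c h" "h \<in> ?B"
        then show ?thesis using that by (cases "h = k") (auto simp: beats_all_def intro: less_imp_le)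
      qed (use that in \<open>auto intro: less_imp_le\<close>)
    qed (use k in auto)
    then show ?thesis using rf by auto
  qed
  let ?S = "{x \<in> space (residuals n (exp_law lz) (exp_law lu) i j). recruits_first n i k x \<and> first_event n i x \<in> T}"
  have Sm: "?S \<in> sets (?PA \<Otimes>\<^sub>M ?PB)"
  proof -
    have [measurable]: "(\<lambda>x. fst x r) \<in> borel_measurable (?PA \<Otimes>\<^sub>M ?PB)" if "r \<in> ?A" for r
      using measurable_compose[OF measurable_fst mA[OF that]] .
    have [measurable]: "(\<lambda>x. snd x k) \<in> borel_measurable (?PA \<Otimes>\<^sub>M ?PB)"
      using measurable_compose[OF measurable_snd mk] .
    have [measurable]: "Measurable.pred (?PA \<Otimes>\<^sub>M ?PB) (\<lambda>x. beats_all ?B k (snd x))"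
      by (rule measurable_compose[OF measurable_snd measurable_beats_all]) (use k in auto)
    have "{x \<in> space (?PA \<Otimes>\<^sub>M ?PB). (\<forall>r\<in>?A. fst x r > snd x k) \<and> beats_all ?B k (snd x) \<and> snd x k \<in> T} \<in> sets (?PA \<Otimes>\<^sub>M ?PB)"
      by measurable
    moreover have "?S = {x \<in> space (?PA \<Otimes>\<^sub>M ?PB). (\<forall>r\<in>?A. fst x r > snd x k) \<and> beats_all ?B k (snd x) \<and> snd x k \<in> T}"
      unfolding residuals_exp_law[OF lz lu]
    proof (rule Collect_cong)
      fix x
      show "(x \<in> space (?PA \<Otimes>\<^sub>M ?PB) \<and> recruits_first n i k x \<and> first_event n i x \<in> T) \<longleftrightarrow>
        (x \<in> space (?PA \<Otimes>\<^sub>M ?PB) \<and> (\<forall>r\<in>?A. fst x r > snd x k) \<and> beats_all ?B k (snd x) \<and> snd x k \<in> T)"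
        using ev[of "fst x" "snd x"] by simp
    qed
    ultimately show ?thesis by simp
  qed
  \<comment> \<open>The probability that all \<open>2 * n - i\<close> vehicles outlast recruitment
    \<open>k\<close>, restricted to completion times in \<open>T\<close>.\<close>
  define f :: "(nat \<Rightarrow> real) \<Rightarrow> ennreal" where
    "f c = ennreal (exp (- (?a * max 0 (c k)))) * indicator T (c k)" for c
  have f[measurable]: "f \<in> borel_measurable ?PB" unfolding f_def by measurable
  have "emeasure (residuals n (exp_law lz) (exp_law lu) i j) ?S = (\<integral>\<^sup>+c. emeasure ?PA ((\<lambda>s. (s, c)) -` ?S) \<partial>?PB)"
    unfolding residuals_exp_law[OF lz lu]
    by (rule Res.emeasure_pair_measure_alt2) (use Sm in \<open>simp add: residuals_exp_law[OF lz lu]\<close>)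
  also have "\<dots> = (\<integral>\<^sup>+c. f c * indicator {c. beats_all ?B k c} c \<partial>?PB)"
  proof (intro nn_integral_cong)
    fix c assume c: "c \<in> space ?PB"
    have "(\<lambda>s. (s, c)) -` ?S = (if beats_all ?B k c \<and> c k \<in> T then (\<Pi>\<^sub>E r\<in>?A. {c k<..}) else {})"
      unfolding residuals_exp_law[OF lz lu]
    proof (rule set_eqI)
      fix s
      show "s \<in> (\<lambda>s. (s, c)) -` {x \<in> space (?PA \<Otimes>\<^sub>M ?PB). recruits_first n i k x \<and> first_event n i x \<in> T}
        \<longleftrightarrow> s \<in> (if beats_all ?B k c \<and> c k \<in> T then (\<Pi>\<^sub>E r\<in>?A. {c k<..}) else {})"
        using c ev[of s c] by (simp add: space_pair_measure space_PiM PiE_def Pi_iff) blast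
    qed
    then show "emeasure ?PA ((\<lambda>s. (s, c)) -` ?S) = f c * indicator {c. beats_all ?B k c} c"
      using emeasure_PiM_exp_law_greaterThan[OF lz, of ?A "c k"] by (auto simp: f_def)
  qed
  \<comment> \<open>Among \<open>i\<close> recruitments of equal rate, \<open>k\<close> wins with
    probability \<open>lu / (real i * lu) = 1 / real i\<close>.\<close>
  also have "\<dots> = ennreal (1 / real i) * (\<integral>\<^sup>+t. (\<integral>\<^sup>+x. f ((\<lambda>e\<in>?B. t + x e)(k := t)) \<partial>?PB) \<partial>exp_law (real i * lu))"
    using exp_law_beats_all[of "\<lambda>_. lu" ?B k f, OF lu _ k f] lu by simp
  also have "(\<lambda>t. \<integral>\<^sup>+x. f ((\<lambda>e\<in>?B. t + x e)(k := t)) \<partial>?PB) = (\<lambda>t. ennreal (exp (- (?a * max 0 t))) * indicator T t)"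
    using Rec.P.emeasure_space_1 by (simp add: f_def)
  also have "ennreal (1 / real i) * (\<integral>\<^sup>+t. ennreal (exp (- (?a * max 0 t))) * indicator T t \<partial>exp_law (real i * lu))
     = ennreal (1 / real i) * (\<integral>\<^sup>+t. ennreal (exponential_density (real i * lu) t) * (ennreal (exp (- (?a * max 0 t))) * indicator T t) \<partial>lborel)"
    by (subst nn_integral_exp_law) auto
  also have "\<dots> = (\<integral>\<^sup>+t. ennreal (1 / real i) * (ennreal (exponential_density (real i * lu) t) * (ennreal (exp (- (?a * max 0 t))) * indicator T t)) \<partial>lborel)"
    by (subst nn_integral_cmult) auto
  also have "\<dots> = (\<integral>\<^sup>+t. ennreal (lu / ?D) * (ennreal (exponential_density ?D t) * indicator T t) \<partial>lborel)"
  proof (intro nn_integral_cong)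
    fix t :: real
    \<comment> \<open>The survival factor of the vehicles raises the rate of the minimum from
      \<open>real i * lu\<close> to \<open>?D\<close>.\<close>
    have "1 / real i * (exponential_density (real i * lu) t * exp (- (?a * max 0 t))) = lu / ?D * exponential_density ?D t"
    proof (cases "t < 0")
      case False
      have "exp (- t * (real i * lu)) * exp (- (?a * t)) = exp (- t * ?D)"
        unfolding D_eq by (simp add: algebra_simps flip: exp_add)
      then show ?thesis using False i0 total_rate_pos[OF n i lz lu] by (simp add: exponential_density_def mult.assoc)
    qed (simp add: exponential_density_def)
    then have "ennreal (1 / real i) * (ennreal (exponential_density (real i * lu) t) * ennreal (exp (- (?a * max 0 t))))
       = ennreal (lu / ?D) * ennreal (exponential_density ?D t)"
      using Bl total_rate_pos[OF n i lz lu] lu by (simp add: ennreal_mult[symmetric] exponential_density_nonneg)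
    then show "ennreal (1 / real i) * (ennreal (exponential_density (real i * lu) t) * (ennreal (exp (- (?a * max 0 t))) * indicator T t))
      = ennreal (lu / ?D) * (ennreal (exponential_density ?D t) * indicator T t)"
      by (simp add: mult.assoc[symmetric])
  qed
  also have "\<dots> = ennreal (lu / ?D) * emeasure (exp_law ?D) T"
    by (subst nn_integral_cmult) (auto simp: nn_integral_exp_law[symmetric])
  also have "\<dots> = ennreal (lu / ?D * measure (exp_law ?D) T)"
    using lu total_rate_pos[OF n i lz lu] by (subst ennreal_mult) (auto simp: D.emeasure_eq_measure)
  finally show ?thesis using lu total_rate_pos[OF n i lz lu] by (simp add: measure_def[of "residuals n (exp_law lz) (exp_law lu) i j"])
qed

lemma p_prob_exp_law:
  "p_prob n (exp_law lz) (exp_law lu) i j k = (if k \<in> {1..i} then lu / total_rate n lz lu i else 0)"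
proof -
  interpret D: prob_space "exp_law (total_rate n lz lu i)" by (rule prob_space_exp_law[OF total_rate_pos[OF n i lz lu]])
  show ?thesis
    using measure_recruits_first[of k UNIV j] D.prob_space by (simp add: p_prob_def)
qed

lemma p_until_exp_law:
  "k \<in> {1..i} \<Longrightarrow> p_until n (exp_law lz) (exp_law lu) i j k t
    = lu / total_rate n lz lu i * measure (exp_law (total_rate n lz lu i)) {..t}"
  using measure_recruits_first[of k "{..t}" j] by (simp add: p_until_def)

lemma departure_until_exp_law:
  "departure_until n (exp_law lz) (exp_law lu) i j t
    = (2 * real n - real i) * lz / total_rate n lz lu i * measure (exp_law (total_rate n lz lu i)) {..t}"
proof -
  have "departure_until n (exp_law lz) (exp_law lu) i j t
    = (1 - real i * lu / total_rate n lz lu i) * measure (exp_law (total_rate n lz lu i)) {..t}"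
    unfolding departure_until_def measure_first_event_le by (simp add: p_until_exp_law left_diff_distrib)
  also have "1 - real i * lu / total_rate n lz lu i = (2 * real n - real i) * lz / total_rate n lz lu i"
    using total_rate_pos[OF n i lz lu] by (simp add: field_simps) (simp add: total_rate_def algebra_simps)
  finally show ?thesis .
qed

lemma q_prob_exp_law:
  "q_prob n (exp_law lz) (exp_law lu) i j = 2 * (real n - real i) * lz / total_rate n lz lu i"
proof -
  have "1 - real i * lu / total_rate n lz lu i = (2 * real n - real i) * lz / total_rate n lz lu i"
    using total_rate_pos[OF n i lz lu] by (simp add: field_simps) (simp add: total_rate_def algebra_simps)
  moreover have "2 * real n - real i \<noteq> 0" using n i by linarith
  ultimately show ?thesis by (simp add: q_prob_def p_prob_exp_law)
qed

end

section \<open>Expected absorption times of the level chain\<close>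

text \<open>From level \<open>i\<close>, which has \<open>i\<close> recruiters, each of them completes first with probability \<open>p i\<close>,
  a new recruitment starts with probability \<open>q i\<close>, and \<open>w i\<close> is the mean sojourn time. The values
  \<open>V b K (i - 1)\<close> at \<open>i = 0\<close> and \<open>V b K (i + 1)\<close> at \<open>i = n\<close> below are junk with coefficient 0.\<close>

locale level_chain =
  fixes n :: nat and p q w A :: "nat \<Rightarrow> real"
  assumes n_pos: "n \<ge> 1"
    and p_nonneg: "\<And>i. i \<le> n \<Longrightarrow> p i \<ge> 0"
    and q_nonneg: "\<And>i. i \<le> n \<Longrightarrow> q i \<ge> 0"
    and w_pos: "\<And>i. i \<le> n \<Longrightarrow> w i > 0"
    and q_0: "q 0 \<le> 1"
    and q_n: "q n = 0"
    and pq_less: "\<And>i. 1 \<le> i \<Longrightarrow> i \<le> n \<Longrightarrow> real i * p i + q i < 1"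
    and A_top: "A (n + 1) = p n"
    and A_rec: "\<And>i. 2 \<le> i \<Longrightarrow> i \<le> n \<Longrightarrow> A i = p (i - 1) / (1 - real i * q (i - 1) * A (i + 1))"
begin

text \<open>The expected number of visits to level \<open>i\<close>, started there, before the chain
  fails or drops below \<open>i\<close>: with probability \<open>(i + 1) * q i * A (i + 2)\<close>
  it goes up and comes back.\<close>

definition d :: "nat \<Rightarrow> real" where
  "d i = 1 / (1 - (real i + 1) * q i * A (i + 2))"

text \<open>The expected number of steps from level \<open>k - 1\<close> to level \<open>k\<close>,
  started in level \<open>k - 1\<close>, before the chain fails or drops below
  \<open>k - 1\<close>.\<close>

definition \<alpha> :: "nat \<Rightarrow> real" where
  "\<alpha> k = q (k - 1) * d (k - 1)"

text \<open>The expected time, started in level \<open>i\<close>, until the chain fails or drops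
  below \<open>i\<close>; the coefficient of \<open>w k\<close> is the expected number of visits to
  level \<open>k\<close> in this period.\<close>

definition c :: "nat \<Rightarrow> real" where
  "c i = (\<Sum>k = i..n. (\<Prod>m = Suc i..k. \<alpha> m) * (d k * w k))"

text \<open>From level \<open>i + 1\<close> the chain spends the mean time \<open>c (Suc i)\<close>
  at or above this level, and it continues from level \<open>i\<close> if it ever gets
  there.\<close>

fun Q :: "nat \<Rightarrow> real" where
  "Q 0 = c 0"
| "Q (Suc i) = c (Suc i) + (real i + 1) * A (i + 2) * Q i"

fun V :: "real \<Rightarrow> nat \<Rightarrow> nat \<Rightarrow> real" where
  "V b 0 i = b"
| "V b (Suc K) i = w i + real i * p i * V b K (i - 1) + q i * V b K (i + 1)"

text \<open>The top value and the recursion of \<open>A\<close> take one common form: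
  \<open>q n = 0\<close> makes \<open>d n = 1\<close>, whatever \<open>A (n + 2)\<close> is.\<close>

lemma A_Suc: "1 \<le> i \<Longrightarrow> i \<le> n \<Longrightarrow> A (i + 1) = p i * d i"
  using A_rec[of "i + 1"] A_top q_n by (cases "i = n") (auto simp: d_def algebra_simps)

text \<open>\<open>i * A (i + 1)\<close> is the probability of ever reaching level \<open>i - 1\<close> from level \<open>i\<close>.\<close>

lemma A_bounds:
  assumes "1 \<le> i" "i \<le> n"
  shows "A (i + 1) \<ge> 0" "real i * A (i + 1) < 1" "1 - (real i + 1) * q i * A (i + 2) > 0"
proof -
  have "A (i + 1) \<ge> 0 \<and> real i * A (i + 1) < 1 \<and> 1 - (real i + 1) * q i * A (i + 2) > 0"
    using assms(2,1)
  proof (induction i rule: inc_induct)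
    case base
    then show ?case using A_top p_nonneg[of n] pq_less[of n] q_n by simp
  next
    \<comment> \<open>The induction descends. A return probability below 1 from level
      \<open>i + 1\<close> bounds the denominator from below by \<open>1 - q i\<close>, which by
      \<open>pq_less\<close> exceeds \<open>real i * p i\<close>.\<close>
    case (step i)
    let ?x = "(real i + 1) * A (i + 2)"
    have x: "?x < 1" "A (i + 2) \<ge> 0" using step by (auto simp: add_ac)
    have i: "i \<le> n" "1 \<le> i" using step by auto
    have "q i * ?x \<le> q i * 1" using q_nonneg[OF i(1)] x by (intro mult_left_mono) auto
    then have den: "1 - (real i + 1) * q i * A (i + 2) > real i * p i" using pq_less[of i] i by (simp add: algebra_simps)
    have pi: "real i * p i \<ge> 0" using p_nonneg[OF i(1)] by simp
    define e where "e = 1 - (real i + 1) * q i * A (i + 2)"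
    have "A (i + 1) = p i / e" "e > real i * p i" "e > 0"
      using A_Suc[of i] i den pi by (auto simp: d_def e_def)
    moreover have "1 - (real i + 1) * q i * A (i + 2) > 0" using den pi by linarith
    ultimately show ?case using p_nonneg[OF i(1)] by simp
  qed
  then show "A (i + 1) \<ge> 0" "real i * A (i + 1) < 1" "1 - (real i + 1) * q i * A (i + 2) > 0" by auto
qed

text \<open>Level 0 needs its own argument: \<open>q 0\<close> may be 1, as it is in the cloud, and
  then only the chance of a failure before the return from level 1, expressed by
  \<open>A 2 < 1\<close>, keeps the denominator positive.\<close>

lemma d_inverse:
  assumes "i \<le> n"
  shows "1 - (real i + 1) * q i * A (i + 2) > 0"
proof (cases "i = 0")
  case True
  have "A 2 \<ge> 0" "A 2 < 1" using A_bounds[of 1] n_pos by (auto simp: numeral_2_eq_2)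
  then have "q 0 * A 2 < 1" using q_0 q_nonneg[of 0]
    by (metis less_eq_real_def less_le_trans mult_le_one mult_less_cancel_left2 mult_less_cancel_right2 mult_zero_left zero_less_one le0 linorder_not_le)
  then show ?thesis using True by (simp add: numeral_2_eq_2)
qed (use A_bounds[of i] assms in auto)

lemma d_pos: "i \<le> n \<Longrightarrow> d i > 0"
  using d_inverse[of i] by (simp add: d_def)

lemma c_n: "c n = w n"
  by (simp add: c_def d_def q_n)

text \<open>Each of the \<open>d i\<close> visits to level \<open>i\<close> costs its sojourn and
  possibly one excursion above; formally, the first summand is split off and
  \<open>\<alpha> (Suc i)\<close> is factored out of the others.\<close>

lemma c_rec: 
  assumes "i < n"
  shows "c i = d i * (w i + q i * c (Suc i))"
proof -
  have "(\<Sum>k = Suc i..n. (\<Prod>m = Suc i..k. \<alpha> m) * (d k * w k))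
     = (\<Sum>k = Suc i..n. \<alpha> (Suc i) * ((\<Prod>m = Suc (Suc i)..k. \<alpha> m) * (d k * w k)))"
  proof (intro sum.cong refl)
    fix k assume "k \<in> {Suc i..n}"
    then have "(\<Prod>m = Suc i..k. \<alpha> m) = \<alpha> (Suc i) * (\<Prod>m = Suc (Suc i)..k. \<alpha> m)"
      by (intro prod.atLeast_Suc_atMost) auto
    then show "(\<Prod>m = Suc i..k. \<alpha> m) * (d k * w k) = \<alpha> (Suc i) * ((\<Prod>m = Suc (Suc i)..k. \<alpha> m) * (d k * w k))"
      by simp
  qed
  also have "\<dots> = \<alpha> (Suc i) * c (Suc i)" by (simp add: c_def sum_distrib_left)
  finally show ?thesis
    using assms by (simp add: c_def[of i] sum.atLeast_Suc_atMost \<alpha>_def algebra_simps)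
qed

lemma c_pos: "i \<le> n \<Longrightarrow> c i > 0"
proof (induction i rule: inc_induct)
  case base
  then show ?case using w_pos by (simp add: c_n)
next
  case (step i)
  then show ?case
    using w_pos[of i] d_pos[of i] q_nonneg[of i]
    by (auto simp: c_rec intro!: mult_pos_pos add_pos_nonneg)
qed

lemma Q_pos: "i \<le> n \<Longrightarrow> Q i > 0"
proof (induction i)
  case (Suc i)
  then show ?case
    using c_pos[of "Suc i"] A_bounds(1)[of "Suc i"] by (auto intro!: add_pos_nonneg mult_nonneg_nonneg simp: add_ac)
qed (simp add: c_pos)

text \<open>Part of \<open>q i * Q (i + 1)\<close> is the multiple
  \<open>(i + 1) * q i * A (i + 2)\<close> of \<open>Q i\<close> itself. Moving it to the left-hand
  side produces the denominator of \<open>d i\<close>.\<close>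

lemma Q_eq:
  assumes i: "i \<le> n"
  shows "Q i = w i + real i * p i * Q (i - 1) + q i * Q (i + 1)"
proof -
  have Qi: "Q i = c i + real i * (p i * d i) * Q (i - 1)"
  proof (cases i)
    case (Suc m)
    then have "A (m + 2) = p i * d i" using A_Suc[of i] i by simp
    then show ?thesis using Suc by (simp add: mult.assoc)
  qed simp
  show ?thesis
  proof (cases "i = n")
    case True
    then show ?thesis using Qi by (simp add: c_n q_n d_def)
  next
    case False
    define e where "e = 1 - (real i + 1) * q i * A (i + 2)"
    have e: "e > 0" "d i = 1 / e" using d_inverse[OF i] by (auto simp: e_def d_def)
    have "e * Q i = w i + q i * c (Suc i) + real i * p i * Q (i - 1)"
    proof -
      have "Q i = d i * (w i + q i * c (Suc i) + real i * p i * Q (i - 1))"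
        using Qi c_rec[of i] False i by (simp add: algebra_simps)
      then have "e * Q i = (e * d i) * (w i + q i * c (Suc i) + real i * p i * Q (i - 1))"
        by simp
      then show ?thesis using e by simp
    qed
    then show ?thesis by (simp add: e_def algebra_simps)
  qed
qed

lemma Q_0: 
  "Q 0 = w 0 * (1 + \<alpha> 1 * A 2) + (\<Prod>k = 1..n. \<alpha> k) * w n
     + (\<Sum>i = 1..n - 1. w i * ((real i + 1) * (\<Prod>k = 1..i + 1. \<alpha> k) * A (i + 2) + (\<Prod>k = 1..i. \<alpha> k)))"
proof -
  \<comment> \<open>This is \<open>1 / (1 - x) = 1 + x / (1 - x)\<close>. It splits every summand
    into the two parts seen in the closed form; at the top level \<open>d n = 1\<close>, which
    leaves one term outside the sum.\<close>
  have dk: "d k = 1 + (real k + 1) * \<alpha> (k + 1) * A (k + 2)" if "k < n" for k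
    using d_inverse[of k] that by (simp add: \<alpha>_def d_def field_simps)
  have "Q 0 = (\<Sum>k = 0..n. (\<Prod>m = 1..k. \<alpha> m) * (d k * w k))" by (simp add: c_def)
  also have "\<dots> = (\<Sum>k = 0..n - 1. (\<Prod>m = 1..k. \<alpha> m) * (d k * w k)) + (\<Prod>m = 1..n. \<alpha> m) * (d n * w n)"
    using n_pos sum.atLeast0_atMost_Suc[of "\<lambda>k. (\<Prod>m = 1..k. \<alpha> m) * (d k * w k)" "n - 1"] by simp
  also have "(\<Sum>k = 0..n - 1. (\<Prod>m = 1..k. \<alpha> m) * (d k * w k)) = d 0 * w 0 + (\<Sum>k = 1..n - 1. (\<Prod>m = 1..k. \<alpha> m) * (d k * w k))"
    by (subst sum.atLeast_Suc_atMost) auto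
  also have "(\<Sum>k = 1..n - 1. (\<Prod>m = 1..k. \<alpha> m) * (d k * w k)) 
     = (\<Sum>i = 1..n - 1. w i * ((real i + 1) * (\<Prod>k = 1..i + 1. \<alpha> k) * A (i + 2) + (\<Prod>k = 1..i. \<alpha> k)))"
    by (intro sum.cong refl) (subst dk, use n_pos in \<open>auto simp: algebra_simps\<close>)
  finally show ?thesis using dk[of 0] n_pos by (simp add: d_def[of n] q_n numeral_2_eq_2 mult.commute)
qed

text \<open>The expected times \<open>Q\<close> themselves serve as weights in which the iteration contracts.\<close>

lemma V_tendsto:
  assumes "i \<le> n"
  shows "(\<lambda>K. V b K i) \<longlonglongrightarrow> Q i"
proof -
  \<comment> \<open>\<open>\<delta>\<close> is the least share of \<open>Q i\<close> that the first
    sojourn takes, and \<open>C\<close> is the initial error in units of \<open>Q\<close>.\<close>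
  define \<delta> where "\<delta> = Min ((\<lambda>i. w i / Q i) ` {..n})"
  define C where "C = Max ((\<lambda>i. \<bar>b - Q i\<bar> / Q i) ` {..n})"
  have \<delta>w: "\<delta> * Q i \<le> w i" if "i \<le> n" for i
  proof -
    have "\<delta> \<le> w i / Q i" unfolding \<delta>_def using that by (intro Min_le) auto
    then show ?thesis using Q_pos[OF that] by (simp add: field_simps)
  qed
  have \<delta>pos: "\<delta> > 0" unfolding \<delta>_def using w_pos Q_pos by (subst Min_gr_iff) auto
  have "Q 0 = w 0 + q 0 * Q 1" using Q_eq[of 0] by simp
  moreover have "q 0 * Q 1 \<ge> 0" using q_nonneg[of 0] Q_pos[of 1] n_pos by (intro mult_nonneg_nonneg) auto
  ultimately have "w 0 \<le> Q 0" by linarith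
  with \<delta>w[of 0] have "\<delta> * Q 0 \<le> 1 * Q 0" by simp
  then have \<delta>1: "\<delta> \<le> 1" using Q_pos[of 0] by (simp only: mult_le_cancel_right)
  have C: "\<bar>b - Q i\<bar> \<le> C * Q i" if "i \<le> n" for i
  proof -
    have "\<bar>b - Q i\<bar> / Q i \<le> C" unfolding C_def using that by (intro Max_ge) auto
    then show ?thesis using Q_pos[OF that] by (simp add: field_simps)
  qed
  have C0: "C \<ge> 0" using C[of 0] Q_pos[of 0] by (smt (verit) zero_le_mult_iff le0)
  have bound: "\<bar>V b K i - Q i\<bar> \<le> C * (1 - \<delta>) ^ K * Q i" if "i \<le> n" for K i
    using that
  proof (induction K arbitrary: i)
    case (Suc K)
    let ?B = "C * (1 - \<delta>) ^ K"
    have B0: "?B \<ge> 0" using C0 \<delta>1 by simp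
    have eq: "V b (Suc K) i - Q i = real i * p i * (V b K (i - 1) - Q (i - 1)) + q i * (V b K (i + 1) - Q (i + 1))"
      using Q_eq[OF Suc.prems] by (simp add: algebra_simps)
    have down: "\<bar>real i * p i * (V b K (i - 1) - Q (i - 1))\<bar> \<le> real i * p i * (?B * Q (i - 1))"
      using Suc.IH[of "i - 1"] Suc.prems p_nonneg[of i] by (simp add: abs_mult mult_left_mono)
    have up: "\<bar>q i * (V b K (i + 1) - Q (i + 1))\<bar> \<le> q i * (?B * Q (i + 1))"
    proof (cases "i = n")
      case False
      then show ?thesis using Suc.IH[of "i + 1"] Suc.prems q_nonneg[of i] by (simp only: abs_mult) (simp add: mult_left_mono)
    qed (simp add: q_n)
    have "\<bar>V b (Suc K) i - Q i\<bar> \<le> real i * p i * (?B * Q (i - 1)) + q i * (?B * Q (i + 1))"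
      unfolding eq using down up by linarith
    \<comment> \<open>The equation for \<open>Q\<close> evaluates the weighted sum over the
      neighbours; the sojourn time missing from it provides the factor
      \<open>1 - \<delta>\<close>.\<close>
    also have "real i * p i * (?B * Q (i - 1)) + q i * (?B * Q (i + 1)) = ?B * (Q i - w i)"
      using Q_eq[OF Suc.prems] by (simp add: algebra_simps del: Q.simps)
    also have "\<dots> \<le> ?B * ((1 - \<delta>) * Q i)"
      using \<delta>w[OF Suc.prems] B0 by (intro mult_left_mono) (auto simp: algebra_simps)
    finally show ?case by (simp add: mult_ac)
  qed (simp add: C)
  have "(\<lambda>K. C * (1 - \<delta>) ^ K * Q i) \<longlonglongrightarrow> C * 0 * Q i"
    using \<delta>pos \<delta>1 by (intro tendsto_intros LIMSEQ_realpow_zero) auto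
  then have "(\<lambda>K. V b K i - Q i) \<longlonglongrightarrow> 0"
    using Lim_null_comparison[of "\<lambda>K. V b K i - Q i" "\<lambda>K. C * (1 - \<delta>) ^ K * Q i" sequentially] bound[OF assms]
    by simp
  then show ?thesis by (simp add: LIM_zero_iff)
qed

lemma V_nonneg: "b \<ge> 0 \<Longrightarrow> i \<le> n \<Longrightarrow> V b K i \<ge> 0"
proof (induction K arbitrary: i)
  case (Suc K)
  have "q i * V b K (i + 1) \<ge> 0" using Suc q_nonneg[of i] q_n by (cases "i = n") auto
  then show ?case using Suc p_nonneg[of i] w_pos[of i] by (auto intro!: add_nonneg_nonneg less_imp_le)
qed simp

end

section \<open>The decomposed process\<close>

instance dstate :: countable
  by countable_datatype

section \<open>Decomposition over countably many values\<close>

lemma nn_integral_split_countable: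
  fixes Y :: "'a \<Rightarrow> 'c::countable"
  assumes M: "sigma_finite_measure M" and Y[measurable]: "Y \<in> M \<rightarrow>\<^sub>M count_space UNIV"
    and f[measurable]: "f \<in> borel_measurable M"
  shows "(\<integral>\<^sup>+x. f x \<partial>M) = (\<integral>\<^sup>+c. (\<integral>\<^sup>+x. f x * indicator {x. Y x = c} x \<partial>M) \<partial>count_space UNIV)"
proof -
  interpret sigma_finite_measure M by fact
  interpret C: sigma_finite_measure "count_space (UNIV :: 'c set)"
    by (rule sigma_finite_measure_count_space_countable) simp
  interpret pair_sigma_finite "count_space (UNIV :: 'c set)" M ..
  have m: "(\<lambda>x. f x * indicator {x. Y x = c} x) \<in> borel_measurable M" for c
  proof -
    have "(\<lambda>x. f x * indicator {c} (Y x)) \<in> borel_measurable M" by measurable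
    then show ?thesis by (simp add: indicator_def)
  qed
  have "f x = (\<integral>\<^sup>+c. f x * indicator {x. Y x = c} x \<partial>count_space UNIV)" for x
  proof -
    have "(\<integral>\<^sup>+c. f x * indicator {x. Y x = c} x \<partial>count_space UNIV) = (\<integral>\<^sup>+c. f x * indicator {Y x} c \<partial>count_space UNIV)"
      by (intro nn_integral_cong) (auto split: split_indicator)
    also have "\<dots> = f x"
      by (subst nn_integral_cmult_indicator) auto
    finally show ?thesis by simp
  qed
  then have "(\<integral>\<^sup>+x. f x \<partial>M) = (\<integral>\<^sup>+x. (\<integral>\<^sup>+c. f x * indicator {x. Y x = c} x \<partial>count_space UNIV) \<partial>M)"
    by simp
  also have "\<dots> = (\<integral>\<^sup>+c. (\<integral>\<^sup>+x. f x * indicator {x. Y x = c} x \<partial>M) \<partial>count_space UNIV)"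
    by (rule Fubini'[of "\<lambda>c x. f x * indicator {x. Y x = c} x"])
       (rule measurable_pair_measure_countable1, use m in auto)
  finally show ?thesis .
qed

lemma emeasure_split_countable:
  fixes Y :: "'a \<Rightarrow> 'c::countable"
  assumes M: "sigma_finite_measure M" and Y[measurable]: "Y \<in> M \<rightarrow>\<^sub>M count_space UNIV"
    and P[measurable]: "Measurable.pred M P"
  shows "emeasure M {x \<in> space M. P x}
    = (\<integral>\<^sup>+c. emeasure M {x \<in> space M. P x \<and> Y x = c} \<partial>count_space UNIV)"
proof -
  have "(\<integral>\<^sup>+x. indicator {x \<in> space M. P x} x * indicator {x. Y x = c} x \<partial>M)
      = emeasure M {x \<in> space M. P x \<and> Y x = c}" for c
  proof -
    have "(\<integral>\<^sup>+x. indicator {x \<in> space M. P x} x * indicator {x. Y x = c} x \<partial>M)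
       = (\<integral>\<^sup>+x. indicator {x \<in> space M. P x \<and> Y x = c} x \<partial>M)"
      by (intro nn_integral_cong) (auto split: split_indicator)
    then show ?thesis by simp
  qed
  then show ?thesis
    using nn_integral_split_countable[OF M Y, of "indicator {x \<in> space M. P x}"] by simp
qed

text \<open>The definition of \<open>semi_markov\<close> fixes the whole path and bounds all sojourn
  times up to step \<open>k\<close>. Summing over the countably many histories and letting the
  bounds on past sojourn times tend to infinity isolates step \<open>k\<close>.\<close>

lemma semi_markov_transition:
  fixes X :: "nat \<Rightarrow> 'a \<Rightarrow> 's::countable"
  assumes sm: "semi_markov K A s0 M X W" and s: "s \<notin> A" and K: "K s s' t \<ge> 0"
  shows "measure M {\<omega> \<in> space M. X (Suc k) \<omega> = s' \<and> X k \<omega> = s \<and> W k \<omega> \<le> t}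
    = measure M {\<omega> \<in> space M. X k \<omega> = s} * K s s' t"
proof -
  have [measurable]: "X m \<in> M \<rightarrow>\<^sub>M count_space UNIV" "W m \<in> borel_measurable M" for m
    using sm by (auto simp: semi_markov_def)
  interpret prob_space M using sm by (simp add: semi_markov_def)
  define B where "B J = {\<omega> \<in> space M. X (Suc k) \<omega> = s' \<and> X k \<omega> = s \<and> W k \<omega> \<le> t \<and> (\<forall>m<k. W m \<omega> \<le> J)}" for J
  define C where "C J = {\<omega> \<in> space M. X k \<omega> = s \<and> (\<forall>m<k. W m \<omega> \<le> J)}" for J
  have [measurable]: "B J \<in> sets M" "C J \<in> sets M" for J
    unfolding B_def C_def by measurable
  have all_le: "(\<forall>m\<le>j. P m) \<longleftrightarrow> (\<forall>m<j. P m) \<and> P j" for P and j :: nat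
    by (auto simp: order_le_less)
  \<comment> \<open>The states before step \<open>k\<close> form a single variable with values in a
    countable type.\<close>
  define H where "H \<omega> = map (\<lambda>m. X m \<omega>) [0..<k]" for \<omega>
  have H: "H \<in> M \<rightarrow>\<^sub>M count_space UNIV"
  proof -
    have "(\<lambda>\<omega>. H \<omega> = l) \<in> M \<rightarrow>\<^sub>M count_space UNIV" for l
    proof -
      have "(\<lambda>\<omega>. H \<omega> = l) = (\<lambda>\<omega>. length l = k \<and> (\<forall>m<k. X m \<omega> = l ! m))"
        by (auto simp: H_def list_eq_iff_nth_eq fun_eq_iff)
      then show ?thesis by simp
    qed
    then have "H -` {l} \<inter> space M \<in> sets M" for l
      using measurable_sets[of "\<lambda>\<omega>. H \<omega> = l" M "count_space UNIV" "{True}"]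
      by (simp add: vimage_def Int_def conj_commute)
    then show ?thesis by (auto simp: measurable_count_space_eq2_countable)
  qed
  have BC: "measure M (B J) = measure M (C J) * K s s' t" for J
  proof -
    have hist: "emeasure M {\<omega> \<in> space M. (X (Suc k) \<omega> = s' \<and> X k \<omega> = s \<and> W k \<omega> \<le> t \<and> (\<forall>m<k. W m \<omega> \<le> J)) \<and> H \<omega> = l}
       = emeasure M {\<omega> \<in> space M. (X k \<omega> = s \<and> (\<forall>m<k. W m \<omega> \<le> J)) \<and> H \<omega> = l} * ennreal (K s s' t)" (is "?L = ?R") for l
    proof (cases "length l = k")
      case False
      then have "H \<omega> \<noteq> l" for \<omega> by (auto simp: H_def)
      then show ?thesis by simp
    next
      case True
      then have Hl: "H \<omega> = l \<longleftrightarrow> (\<forall>m<k. X m \<omega> = l ! m)" for \<omega>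
        by (auto simp: H_def list_eq_iff_nth_eq)
      \<comment> \<open>The path handed to the definition is the history \<open>l\<close> followed
        by \<open>s\<close> and \<open>s'\<close>; the bounds are \<open>J\<close> for the past
        sojourn times and \<open>t\<close> for the current one.\<close>
      define u where "u m = (if m < k then l ! m else if m = k then s else s')" for m
      define v where "v m = (if m < k then J else t)" for m
      have "measure M {\<omega> \<in> space M. (\<forall>m \<le> Suc k. X m \<omega> = u m) \<and> (\<forall>m \<le> k. W m \<omega> \<le> v m)} =
        measure M {\<omega> \<in> space M. (\<forall>m \<le> k. X m \<omega> = u m) \<and> (\<forall>m < k. W m \<omega> \<le> v m)}
          * K (u k) (u (Suc k)) (v k)"
        using sm s by (auto simp: semi_markov_def u_def)
      also have "{\<omega> \<in> space M. (\<forall>m \<le> Suc k. X m \<omega> = u m) \<and> (\<forall>m \<le> k. W m \<omega> \<le> v m)}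
        = {\<omega> \<in> space M. (X (Suc k) \<omega> = s' \<and> X k \<omega> = s \<and> W k \<omega> \<le> t \<and> (\<forall>m<k. W m \<omega> \<le> J)) \<and> H \<omega> = l}"
        unfolding Hl all_le by (auto simp: u_def v_def less_Suc_eq)
      also have "{\<omega> \<in> space M. (\<forall>m \<le> k. X m \<omega> = u m) \<and> (\<forall>m < k. W m \<omega> \<le> v m)}
        = {\<omega> \<in> space M. (X k \<omega> = s \<and> (\<forall>m<k. W m \<omega> \<le> J)) \<and> H \<omega> = l}"
        unfolding Hl all_le by (auto simp: u_def v_def)
      finally show ?thesis
        by (simp add: emeasure_eq_measure ennreal_mult' u_def v_def)
    qed
    have "emeasure M (B J) = (\<integral>\<^sup>+l. emeasure M {\<omega> \<in> space M. (X k \<omega> = s \<and> (\<forall>m<k. W m \<omega> \<le> J)) \<and> H \<omega> = l} * ennreal (K s s' t) \<partial>count_space UNIV)"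
      unfolding B_def
      by (subst emeasure_split_countable[OF sigma_finite_measure_axioms H]) (measurable, simp only: hist)
    also have "\<dots> = emeasure M (C J) * ennreal (K s s' t)"
      unfolding C_def
      by (subst emeasure_split_countable[OF sigma_finite_measure_axioms H, of "\<lambda>\<omega>. X k \<omega> = s \<and> (\<forall>m<k. W m \<omega> \<le> J)"])
         (measurable, rule nn_integral_multc, simp)
    finally show ?thesis
      using K by (simp add: emeasure_eq_measure flip: ennreal_mult)
  qed
  have ex: "\<exists>j::nat. \<forall>m<k. W m \<omega> \<le> real j" for \<omega>
  proof -
    obtain j :: nat where "Max (insert 0 ((\<lambda>m. W m \<omega>) ` {..<k})) \<le> real j"
      using real_arch_simple by blast
    then show ?thesis by (intro exI[of _ j]) auto
  qed
  have inc: "incseq (\<lambda>j. B (real j))" "incseq (\<lambda>j. C (real j))"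
    unfolding B_def C_def by (fastforce intro!: incseq_SucI)+
  have "(\<lambda>j. measure M (B (real j))) \<longlonglongrightarrow> measure M (\<Union>j. B (real j))"
    by (intro finite_Lim_measure_incseq inc) auto
  moreover have "(\<lambda>j. measure M (C (real j))) \<longlonglongrightarrow> measure M (\<Union>j. C (real j))"
    by (intro finite_Lim_measure_incseq inc) auto
  then have "(\<lambda>j. measure M (C (real j)) * K s s' t) \<longlonglongrightarrow> measure M (\<Union>j. C (real j)) * K s s' t"
    by (intro tendsto_intros)
  ultimately have "measure M (\<Union>j. B (real j)) = measure M (\<Union>j. C (real j)) * K s s' t"
    unfolding BC by (rule LIMSEQ_unique)
  moreover have "(\<Union>j. B (real j)) = {\<omega> \<in> space M. X (Suc k) \<omega> = s' \<and> X k \<omega> = s \<and> W k \<omega> \<le> t}"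
    using ex by (auto simp: B_def)
  moreover have "(\<Union>j. C (real j)) = {\<omega> \<in> space M. X k \<omega> = s}"
    using ex by (auto simp: C_def)
  ultimately show ?thesis by simp
qed

lemma nn_integral_exp_law_ident:
  assumes "l > 0"
  shows "(\<integral>\<^sup>+x. ennreal x \<partial>exp_law l) = ennreal (1 / l)"
proof -
  have "(\<integral>\<^sup>+x. ennreal x \<partial>exp_law l) = (\<integral>\<^sup>+x. ennreal (exponential_density l x * x ^ 1) \<partial>lborel)"
    using assms by (subst nn_integral_exp_law) (auto simp: ennreal_mult' exponential_density_nonneg)
  also have "\<dots> = ennreal (1 / l)"
    using nn_integral_erlang_ith_moment[OF assms, of 0 1] by simp
  finally show ?thesis .
qed

section \<open>The level chain of the exponential model\<close>

definition down_prob :: "nat \<Rightarrow> real \<Rightarrow> real \<Rightarrow> nat \<Rightarrow> real" where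
  "down_prob n lz lu i = lu / total_rate n lz lu i"

definition up_prob :: "nat \<Rightarrow> real \<Rightarrow> real \<Rightarrow> nat \<Rightarrow> real" where
  "up_prob n lz lu i = 2 * (real n - real i) * lz / total_rate n lz lu i"

definition mean_sojourn :: "nat \<Rightarrow> real \<Rightarrow> real \<Rightarrow> nat \<Rightarrow> real" where
  "mean_sojourn n lz lu i = 1 / total_rate n lz lu i"

lemma level_chain_exp_law:
  assumes n: "n \<ge> 1" and lz: "lz > 0" and lu: "lu > 0"
  shows "level_chain n (down_prob n lz lu) (up_prob n lz lu) (mean_sojourn n lz lu) (A' n (exp_law lz) (exp_law lu))"
proof
  note D = total_rate_pos[OF n _ lz lu]
  show "up_prob n lz lu 0 \<le> 1"
    using n lz by (simp add: total_rate_def up_prob_def)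
  show "real i * down_prob n lz lu i + up_prob n lz lu i < 1"
    if i: "1 \<le> i" "i \<le> n" for i
  proof -
    \<comment> \<open>The gap is \<open>real i * lz\<close>, the rate at which some recruiter
      departs, and it is positive because \<open>i\<close> is at least 1.\<close>
    have "real i * lu + 2 * (real n - real i) * lz < total_rate n lz lu i"
      using i lz by (simp add: total_rate_def algebra_simps)
    then show ?thesis using D[OF i(2)] by (simp add: down_prob_def up_prob_def flip: add_divide_distrib)
  qed
  show "A' n (exp_law lz) (exp_law lu) (n + 1) = down_prob n lz lu n"
    using n by (subst A'.simps) (simp add: p_prob_exp_law[OF n _ lz lu] down_prob_def)
  show "A' n (exp_law lz) (exp_law lu) i = down_prob n lz lu (i - 1) /
      (1 - real i * up_prob n lz lu (i - 1) * A' n (exp_law lz) (exp_law lu) (i + 1))"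
    if "2 \<le> i" "i \<le> n" for i
    using that
    by (subst A'.simps) (auto simp: p_prob_exp_law[OF n _ lz lu] q_prob_exp_law[OF n _ lz lu] down_prob_def up_prob_def)
qed (use total_rate_pos[OF n _ lz lu] n lz lu in
      \<open>auto simp: less_imp_le down_prob_def up_prob_def mean_sojourn_def\<close>)

definition trans_prob :: "nat \<Rightarrow> real \<Rightarrow> real \<Rightarrow> nat \<Rightarrow> dstate \<Rightarrow> real" where
  "trans_prob n lz lu i s = (case s of
      St i' k \<Rightarrow>
        if i = i' + 1 \<and> k \<in> {1..i} then down_prob n lz lu i
        else if i' = i + 1 \<and> k = 0 then up_prob n lz lu i
        else 0
    | Fail \<Rightarrow> real i * lz / total_rate n lz lu i)"

locale exp_cloud =
  fixes n :: nat and lz lu :: real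
  assumes n: "n \<ge> 1" and lz: "lz > 0" and lu: "lu > 0"
begin

abbreviation "D \<equiv> total_rate n lz lu"

abbreviation "down \<equiv> down_prob n lz lu"
abbreviation "up \<equiv> up_prob n lz lu"
abbreviation "soj \<equiv> mean_sojourn n lz lu"

sublocale level_chain n down up soj "A' n (exp_law lz) (exp_law lu)"
  by (rule level_chain_exp_law[OF n lz lu])

lemma D_pos: "i \<le> n \<Longrightarrow> D i > 0"
  using total_rate_pos[OF n _ lz lu] .

lemma trans_prob_nonneg: "i \<le> n \<Longrightarrow> trans_prob n lz lu i s \<ge> 0"
  using D_pos[of i] p_nonneg[of i] q_nonneg[of i] lz by (auto simp: trans_prob_def split: dstate.split)

text \<open>For exponential clocks the next state and the sojourn time are independent given the
  current level, so the kernel is a product.\<close>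

lemma dsmp_kernel_exp_law:
  assumes i: "i \<le> n"
  shows "dsmp_kernel n (exp_law lz) (exp_law lu) (St i j) s t
    = trans_prob n lz lu i s * measure (exp_law (D i)) {..t}"
proof -
  have "2 * real n - real i \<noteq> 0" using n i by linarith
  then show ?thesis
    using i by (cases s)
       (auto simp: trans_prob_def down_prob_def up_prob_def p_until_exp_law[OF n _ lz lu] departure_until_exp_law[OF n i lz lu])
qed

lemma nn_integral_trans_prob:
  assumes i: "i \<le> n"
  shows "(\<integral>\<^sup>+s. ennreal (trans_prob n lz lu i s) * g s \<partial>count_space UNIV)
    = (\<Sum>k = 1..i. ennreal (down i) * g (St (i - 1) k))
      + ennreal (up i) * g (St (i + 1) 0) + ennreal (real i * lz / D i) * g Fail"
proof -
  let ?T = "insert Fail (insert (St (i + 1) 0) (St (i - 1) ` {1..i}))"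
  have "(\<integral>\<^sup>+s. ennreal (trans_prob n lz lu i s) * g s \<partial>count_space UNIV) = (\<Sum>s\<in>?T. ennreal (trans_prob n lz lu i s) * g s)"
    by (rule nn_integral_count_space') (auto simp: trans_prob_def image_iff split: dstate.split)
  also have "\<dots> = ennreal (trans_prob n lz lu i Fail) * g Fail + (ennreal (trans_prob n lz lu i (St (i + 1) 0)) * g (St (i + 1) 0)
     + (\<Sum>s\<in>St (i - 1) ` {1..i}. ennreal (trans_prob n lz lu i s) * g s))"
    by (subst sum.insert, simp, force, subst sum.insert, simp, force, rule refl)
  also have "(\<Sum>s\<in>St (i - 1) ` {1..i}. ennreal (trans_prob n lz lu i s) * g s) = (\<Sum>k = 1..i. ennreal (down i) * g (St (i - 1) k))"
    by (subst sum.reindex) (auto simp: inj_on_def trans_prob_def)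
  finally show ?thesis by (simp add: trans_prob_def add_ac)
qed

lemma sum_trans_prob:
  assumes i: "i \<le> n"
  shows "(\<integral>\<^sup>+s. ennreal (trans_prob n lz lu i s) \<partial>count_space UNIV) = 1"
proof -
  have "(\<integral>\<^sup>+s. ennreal (trans_prob n lz lu i s) \<partial>count_space UNIV)
     = of_nat i * ennreal (down i) + ennreal (up i) + ennreal (real i * lz / D i)"
    using nn_integral_trans_prob[OF i, of "\<lambda>_. 1"] by simp
  also have "\<dots> = ennreal (real i * down i + up i + real i * lz / D i)"
  proof -
    have "real i * down i \<ge> 0" "up i \<ge> 0" "real i * lz / D i \<ge> 0"
      using D_pos[OF i] p_nonneg[OF i] q_nonneg[OF i] lz by simp_all
    then show ?thesis
      by (simp only: ennreal_plus add_nonneg_nonneg) (simp only: ennreal_of_nat_eq_real_of_nat ennreal_mult' of_nat_0_le_iff)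
  qed
  also have "real i * down i + up i + real i * lz / D i = D i / D i"
    by (simp add: down_prob_def up_prob_def total_rate_def algebra_simps flip: add_divide_distrib)
  finally show ?thesis using D_pos[OF i] by simp
qed


section \<open>The mean hitting time of the failure state\<close>

context
  fixes N :: "'b measure" and X :: "nat \<Rightarrow> 'b \<Rightarrow> dstate" and W :: "nat \<Rightarrow> 'b \<Rightarrow> real"
  assumes dsmp: "dsmp n (exp_law lz) (exp_law lu) 0 0 N X W"
begin

interpretation prob_space N
  using dsmp by (simp add: dsmp_def semi_markov_def)

lemma measurable_XW [measurable]: "X k \<in> N \<rightarrow>\<^sub>M count_space UNIV" "W k \<in> borel_measurable N"
  using dsmp by (auto simp: dsmp_def semi_markov_def)

lemma AE_X_0: "AE \<omega> in N. X 0 \<omega> = St 0 0"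
  using dsmp by (simp add: dsmp_def semi_markov_def)

lemma AE_X_Fail: "AE \<omega> in N. X k \<omega> = Fail \<longrightarrow> X (Suc k) \<omega> = Fail"
proof -
  have "AE \<omega> in N. X k \<omega> \<in> {Fail} \<longrightarrow> X (Suc k) \<omega> = X k \<omega>"
    using dsmp by (simp add: dsmp_def semi_markov_def)
  then show ?thesis by eventually_elim auto
qed

lemma prob_transition_until:
  assumes i: "i \<le> n"
  shows "prob {\<omega> \<in> space N. X (Suc k) \<omega> = s \<and> X k \<omega> = St i j \<and> W k \<omega> \<le> t}
    = prob {\<omega> \<in> space N. X k \<omega> = St i j} * trans_prob n lz lu i s * measure (exp_law (D i)) {..t}"
  using semi_markov_transition[OF dsmp[unfolded dsmp_def], of "St i j" s t k] trans_prob_nonneg[OF i]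
  by (simp add: dsmp_kernel_exp_law[OF i])

lemma prob_transition:
  assumes i: "i \<le> n"
  shows "prob {\<omega> \<in> space N. X (Suc k) \<omega> = s \<and> X k \<omega> = St i j}
    = prob {\<omega> \<in> space N. X k \<omega> = St i j} * trans_prob n lz lu i s"
proof -
  interpret E: prob_space "exp_law (D i)" by (rule prob_space_exp_law[OF D_pos[OF i]])
  let ?S = "\<lambda>t::nat. {\<omega> \<in> space N. X (Suc k) \<omega> = s \<and> X k \<omega> = St i j \<and> W k \<omega> \<le> real t}"
  have "(\<lambda>t. prob (?S t)) \<longlonglongrightarrow> prob (\<Union>t. ?S t)"
    by (intro finite_Lim_measure_incseq) (auto simp: incseq_def)
  moreover have "(\<Union>t. ?S t) = {\<omega> \<in> space N. X (Suc k) \<omega> = s \<and> X k \<omega> = St i j}"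
    using real_arch_simple by auto
  moreover have "(\<lambda>t. E.prob {..real t}) \<longlonglongrightarrow> E.prob (\<Union>t. {..real t})"
    by (intro E.finite_Lim_measure_incseq) (auto simp: incseq_def)
  moreover have "(\<Union>t. {..real t}) = UNIV"
    using real_arch_simple by auto
  ultimately have l: "(\<lambda>t. prob (?S t)) \<longlonglongrightarrow> prob {\<omega> \<in> space N. X (Suc k) \<omega> = s \<and> X k \<omega> = St i j}"
    and r: "(\<lambda>t. E.prob {..real t}) \<longlonglongrightarrow> 1"
    using E.prob_space by auto
  have "(\<lambda>t. prob (?S t)) \<longlonglongrightarrow> prob {\<omega> \<in> space N. X k \<omega> = St i j} * trans_prob n lz lu i s * 1"
    unfolding prob_transition_until[OF i] by (intro tendsto_intros r)
  from LIMSEQ_unique[OF l this] show ?thesis by simp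
qed

lemma prob_sojourn_until:
  assumes i: "i \<le> n"
  shows "prob {\<omega> \<in> space N. X k \<omega> = St i j \<and> W k \<omega> \<le> t}
    = prob {\<omega> \<in> space N. X k \<omega> = St i j} * measure (exp_law (D i)) {..t}"
proof -
  let ?c = "prob {\<omega> \<in> space N. X k \<omega> = St i j} * measure (exp_law (D i)) {..t}"
  have "emeasure N {\<omega> \<in> space N. X k \<omega> = St i j \<and> W k \<omega> \<le> t}
     = (\<integral>\<^sup>+s. emeasure N {\<omega> \<in> space N. (X k \<omega> = St i j \<and> W k \<omega> \<le> t) \<and> X (Suc k) \<omega> = s} \<partial>count_space UNIV)"
    by (rule emeasure_split_countable[OF sigma_finite_measure_axioms]) measurable
  also have "\<dots> = (\<integral>\<^sup>+s. ennreal (trans_prob n lz lu i s) * ennreal ?c \<partial>count_space UNIV)"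
  proof (intro nn_integral_cong)
    fix s
    have "{\<omega> \<in> space N. (X k \<omega> = St i j \<and> W k \<omega> \<le> t) \<and> X (Suc k) \<omega> = s}
      = {\<omega> \<in> space N. X (Suc k) \<omega> = s \<and> X k \<omega> = St i j \<and> W k \<omega> \<le> t}" by auto
    then show "emeasure N {\<omega> \<in> space N. (X k \<omega> = St i j \<and> W k \<omega> \<le> t) \<and> X (Suc k) \<omega> = s}
      = ennreal (trans_prob n lz lu i s) * ennreal ?c"
      using trans_prob_nonneg[OF i]
      by (simp add: emeasure_eq_measure prob_transition_until[OF i] mult_ac flip: ennreal_mult)
  qed
  also have "\<dots> = ennreal ?c"
    by (subst nn_integral_multc) (simp_all add: sum_trans_prob[OF i])
  finally show ?thesis by (simp add: emeasure_eq_measure)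
qed

text \<open>Given that the \<open>k\<close>-th state is \<open>St i j\<close>, the distribution
  function of \<open>W k\<close> is exponential with rate \<open>D i\<close>, which determines the
  mean. If the condition has probability zero, both sides vanish.\<close>

lemma nn_integral_sojourn:
  assumes i: "i \<le> n"
  shows "(\<integral>\<^sup>+\<omega>. ennreal (W k \<omega>) * indicator {\<omega>. X k \<omega> = St i j} \<omega> \<partial>N)
    = emeasure N {\<omega> \<in> space N. X k \<omega> = St i j} * ennreal (soj i)"
proof -
  let ?S = "{\<omega> \<in> space N. X k \<omega> = St i j}"
  have S[measurable]: "?S \<in> sets N" by measurable
  have ind: "(\<integral>\<^sup>+\<omega>. ennreal (W k \<omega>) * indicator {\<omega>. X k \<omega> = St i j} \<omega> \<partial>N) = (\<integral>\<^sup>+\<omega>. ennreal (W k \<omega>) * indicator ?S \<omega> \<partial>N)"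
    by (intro nn_integral_cong) (auto split: split_indicator)
  show ?thesis
  proof (cases "prob ?S = 0")
    case True
    then have 0: "emeasure N ?S = 0" by (simp add: emeasure_eq_measure)
    then have "AE \<omega> in N. \<omega> \<notin> ?S" by (intro AE_not_in) auto
    then have "(\<integral>\<^sup>+\<omega>. ennreal (W k \<omega>) * indicator ?S \<omega> \<partial>N) = (\<integral>\<^sup>+\<omega>. 0 \<partial>N)"
      by (intro nn_integral_cong_AE) (auto elim: eventually_mono)
    then show ?thesis using ind 0 by simp
  next
    case False
    let ?M = "uniform_measure N ?S"
    have ne: "emeasure N ?S \<noteq> 0" "emeasure N ?S \<noteq> \<top>" using False by (auto simp: emeasure_eq_measure)
    interpret U: prob_space ?M using ne by (intro prob_space_uniform_measure) auto
    have "U.prob {\<omega> \<in> space ?M. W k \<omega> \<le> a} = 1 - exp (- a * D i)" if "a \<ge> 0" for a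
    proof -
      have "U.prob {\<omega> \<in> space ?M. W k \<omega> \<le> a} = prob (?S \<inter> {\<omega> \<in> space N. W k \<omega> \<le> a}) / prob ?S"
        using ne by (subst measure_uniform_measure) auto
      also have "?S \<inter> {\<omega> \<in> space N. W k \<omega> \<le> a} = {\<omega> \<in> space N. X k \<omega> = St i j \<and> W k \<omega> \<le> a}" by auto
      finally show ?thesis
        using False that by (simp add: prob_sojourn_until[OF i] measure_exp_law_atMost[OF D_pos[OF i]] mult.commute)
    qed
    then have "distributed ?M lborel (W k) (exponential_density (D i))"
      using U.exponential_distributed_iff[OF D_pos[OF i], of "W k"]
      by (simp add: measurable_cong_sets[OF sets_uniform_measure refl])
    then have d: "distr ?M lborel (W k) = exp_law (D i)"
      by (simp add: distributed_def exp_law_def)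
    have "ennreal (soj i) = (\<integral>\<^sup>+x. ennreal x \<partial>distr ?M lborel (W k))"
      by (simp add: d nn_integral_exp_law_ident[OF D_pos[OF i]] mean_sojourn_def)
    also have "\<dots> = (\<integral>\<^sup>+\<omega>. ennreal (W k \<omega>) \<partial>?M)"
      by (subst nn_integral_distr) (auto simp: measurable_cong_sets[OF sets_uniform_measure refl])
    also have "\<dots> = (\<integral>\<^sup>+\<omega>. ennreal (W k \<omega>) * indicator ?S \<omega> \<partial>N) / emeasure N ?S"
      by (rule nn_integral_uniform_measure) auto
    finally have "emeasure N ?S * ennreal (soj i)
      = emeasure N ?S * ((\<integral>\<^sup>+\<omega>. ennreal (W k \<omega>) * indicator ?S \<omega> \<partial>N) / emeasure N ?S)" by simp
    also have "\<dots> = emeasure N ?S * (\<integral>\<^sup>+\<omega>. ennreal (W k \<omega>) * indicator ?S \<omega> \<partial>N) / emeasure N ?S"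
      by (rule ennreal_times_divide)
    also have "\<dots> = (\<integral>\<^sup>+\<omega>. ennreal (W k \<omega>) * indicator ?S \<omega> \<partial>N)"
      by (subst mult.commute) (rule mult_divide_eq_ennreal[OF ne])
    finally show ?thesis using ind by simp
  qed
qed

lemma nn_integral_next_state:
  assumes i: "i \<le> n"
  shows "(\<integral>\<^sup>+\<omega>. g (X (Suc k) \<omega>) * indicator {\<omega>. X k \<omega> = St i j} \<omega> \<partial>N)
    = emeasure N {\<omega> \<in> space N. X k \<omega> = St i j} * (\<integral>\<^sup>+s. ennreal (trans_prob n lz lu i s) * g s \<partial>count_space UNIV)"
proof -
  have m: "(\<lambda>\<omega>. indicator {\<omega>. X k \<omega> = St i j} \<omega> :: ennreal) \<in> borel_measurable N"
    by (rule borel_measurable_indicator') simp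
  have "(\<integral>\<^sup>+\<omega>. g (X (Suc k) \<omega>) * indicator {\<omega>. X k \<omega> = St i j} \<omega> \<partial>N)
     = (\<integral>\<^sup>+s. (\<integral>\<^sup>+\<omega>. g (X (Suc k) \<omega>) * indicator {\<omega>. X k \<omega> = St i j} \<omega> * indicator {\<omega>. X (Suc k) \<omega> = s} \<omega> \<partial>N) \<partial>count_space UNIV)"
    by (rule nn_integral_split_countable[OF sigma_finite_measure_axioms]) (use m in measurable)
  also have "\<dots> = (\<integral>\<^sup>+s. emeasure N {\<omega> \<in> space N. X k \<omega> = St i j} * (ennreal (trans_prob n lz lu i s) * g s) \<partial>count_space UNIV)"
  proof (intro nn_integral_cong)
    fix s
    have "(\<integral>\<^sup>+\<omega>. g (X (Suc k) \<omega>) * indicator {\<omega>. X k \<omega> = St i j} \<omega> * indicator {\<omega>. X (Suc k) \<omega> = s} \<omega> \<partial>N)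
      = (\<integral>\<^sup>+\<omega>. g s * indicator {\<omega> \<in> space N. X (Suc k) \<omega> = s \<and> X k \<omega> = St i j} \<omega> \<partial>N)"
      by (intro nn_integral_cong) (auto split: split_indicator)
    also have "\<dots> = g s * emeasure N {\<omega> \<in> space N. X (Suc k) \<omega> = s \<and> X k \<omega> = St i j}"
      by (rule nn_integral_cmult_indicator) measurable
    finally show "(\<integral>\<^sup>+\<omega>. g (X (Suc k) \<omega>) * indicator {\<omega>. X k \<omega> = St i j} \<omega> * indicator {\<omega>. X (Suc k) \<omega> = s} \<omega> \<partial>N)
      = emeasure N {\<omega> \<in> space N. X k \<omega> = St i j} * (ennreal (trans_prob n lz lu i s) * g s)"
      using trans_prob_nonneg[OF i] by (simp add: emeasure_eq_measure prob_transition[OF i] ennreal_mult mult_ac)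
  qed
  also have "\<dots> = emeasure N {\<omega> \<in> space N. X k \<omega> = St i j} * (\<integral>\<^sup>+s. ennreal (trans_prob n lz lu i s) * g s \<partial>count_space UNIV)"
    by (rule nn_integral_cmult) simp
  finally show ?thesis .
qed

definition valid :: "dstate \<Rightarrow> bool" where
  "valid s \<longleftrightarrow> (case s of St i j \<Rightarrow> i \<le> n | Fail \<Rightarrow> True)"

text \<open>Level \<open>n + 1\<close> is never entered because \<open>up n = 0\<close>. The facts
  about the kernel are available up to level \<open>n\<close>.\<close>

lemma AE_valid: "AE \<omega> in N. valid (X k \<omega>)"
proof (induction k)
  case 0
  show ?case using AE_X_0 by eventually_elim (simp add: valid_def)
next
  case (Suc k)
  have "AE \<omega> in N. X k \<omega> = s \<longrightarrow> valid s \<longrightarrow> valid (X (Suc k) \<omega>)" for s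
  proof (cases s)
    case (St i j)
    show ?thesis
    proof (cases "i \<le> n")
      case True
      have "AE \<omega> in N. \<not> (X (Suc k) \<omega> = s' \<and> X k \<omega> = s)" if "\<not> valid s'" for s'
      proof -
        have "up i = 0" if "\<not> Suc i \<le> n"
          using that True q_n by (cases "i = n") auto
        then have "trans_prob n lz lu i s' = 0"
          using that True by (auto simp: valid_def trans_prob_def split: dstate.splits)
        then have "emeasure N {\<omega> \<in> space N. X (Suc k) \<omega> = s' \<and> X k \<omega> = s} = 0"
          by (simp add: emeasure_eq_measure St prob_transition[OF True])
        then show ?thesis by (intro AE_I'[of "{\<omega> \<in> space N. X (Suc k) \<omega> = s' \<and> X k \<omega> = s}"]) auto
      qed
      then have "AE \<omega> in N. \<forall>s'. \<not> valid s' \<longrightarrow> \<not> (X (Suc k) \<omega> = s' \<and> X k \<omega> = s)"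
        by (subst AE_all_countable) auto
      then show ?thesis by eventually_elim auto
    qed (simp add: St valid_def)
  next
    case Fail
    then show ?thesis using AE_X_Fail[of k] by (auto simp: valid_def elim: eventually_mono)
  qed
  then have "AE \<omega> in N. \<forall>s. X k \<omega> = s \<longrightarrow> valid s \<longrightarrow> valid (X (Suc k) \<omega>)"
    by (subst AE_all_countable) auto
  with Suc.IH show ?case by eventually_elim auto
qed

text \<open>Sojourn times in \<open>Fail\<close> are unconstrained, so they are replaced by 0; the
  sums then stay constant after the failure.\<close>

definition elapsed :: "nat \<Rightarrow> 'b \<Rightarrow> ennreal" where
  "elapsed k \<omega> = (\<Sum>m<k. if X m \<omega> = Fail then 0 else ennreal (W m \<omega>))"

text \<open>The mean value still to be collected from state \<open>s\<close> in at most
  \<open>K\<close> steps, the charge \<open>b\<close> included; it depends on the level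
  only.\<close>

definition pot :: "real \<Rightarrow> nat \<Rightarrow> dstate \<Rightarrow> ennreal" where
  "pot b K s = (case s of St i j \<Rightarrow> ennreal (V b K i) | Fail \<Rightarrow> 0)"

lemma measurable_elapsed [measurable]: "elapsed k \<in> borel_measurable N"
  unfolding elapsed_def by measurable

lemma V_Suc_ennreal:
  assumes b: "b \<ge> 0" and i: "i \<le> n"
  shows "ennreal (V b (Suc K) i) = ennreal (soj i) + of_nat i * (ennreal (down i) * ennreal (V b K (i - 1)))
    + ennreal (up i) * ennreal (V b K (i + 1))"
proof (cases "i = n")
  \<comment> \<open>At the top level the sign of \<open>V b K (n + 1)\<close> is unknown, so
    \<open>ennreal\<close> cannot be distributed over that product; its coefficient is 0.\<close>
  case True
  have "V b K (n - 1) \<ge> 0" using V_nonneg[OF b] by simp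
  then show ?thesis using True w_pos[of n] p_nonneg[of n]
    by (simp add: q_n ennreal_plus ennreal_mult ennreal_of_nat_eq_real_of_nat mult.assoc)
next
  case False
  have "V b K (i - 1) \<ge> 0" "V b K (i + 1) \<ge> 0" using V_nonneg[OF b] False i by simp_all
  moreover have "up i \<ge> 0" "down i \<ge> 0" "soj i \<ge> 0"
    using q_nonneg[OF i] p_nonneg[OF i] w_pos[OF i] by simp_all
  ultimately show ?thesis
    by (simp add: ennreal_plus ennreal_mult ennreal_of_nat_eq_real_of_nat mult.assoc)
qed

text \<open>The Markov property is used only through the laws of the pairs \<open>(X k, W k)\<close>
  and \<open>(X k, X (Suc k))\<close>: after splitting over \<open>X k\<close>, the mean sojourn and
  the mean next value combine to one iteration of \<open>V\<close>.\<close>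

lemma nn_integral_pot_step:
  assumes b: "b \<ge> 0"
  shows "(\<integral>\<^sup>+\<omega>. (if X k \<omega> = Fail then 0 else ennreal (W k \<omega>)) + pot b K (X (Suc k) \<omega>) \<partial>N)
    = (\<integral>\<^sup>+\<omega>. pot b (Suc K) (X k \<omega>) \<partial>N)"
proof -
  have m: "(\<lambda>\<omega>. indicator {\<omega>. X k \<omega> = s} \<omega> :: ennreal) \<in> borel_measurable N" for s
    by (rule borel_measurable_indicator') simp
  have "(\<integral>\<^sup>+\<omega>. ((if X k \<omega> = Fail then 0 else ennreal (W k \<omega>)) + pot b K (X (Suc k) \<omega>)) * indicator {\<omega>. X k \<omega> = s} \<omega> \<partial>N)
     = (\<integral>\<^sup>+\<omega>. pot b (Suc K) (X k \<omega>) * indicator {\<omega>. X k \<omega> = s} \<omega> \<partial>N)" (is "?l s = ?r s") for s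
  proof (cases "valid s")
    case False
    have "AE \<omega> in N. X k \<omega> \<noteq> s" using AE_valid[of k] by eventually_elim (use False in auto)
    then show ?thesis by (intro nn_integral_cong_AE) (auto elim!: eventually_mono)
  next
    case True
    show ?thesis
    proof (cases s)
      case Fail
      show ?thesis
        using AE_X_Fail[of k] unfolding Fail
        by (intro nn_integral_cong_AE) (auto elim!: eventually_mono simp: pot_def split: split_indicator)
    next
      case (St i j)
      then have i: "i \<le> n" using True by (simp add: valid_def)
      let ?p = "emeasure N {\<omega> \<in> space N. X k \<omega> = St i j}"
      have "?l s = (\<integral>\<^sup>+\<omega>. ennreal (W k \<omega>) * indicator {\<omega>. X k \<omega> = St i j} \<omega>
            + pot b K (X (Suc k) \<omega>) * indicator {\<omega>. X k \<omega> = St i j} \<omega> \<partial>N)"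
        unfolding St by (intro nn_integral_cong) (auto split: split_indicator)
      also have "\<dots> = ?p * ennreal (soj i) + ?p * (\<integral>\<^sup>+s. ennreal (trans_prob n lz lu i s) * pot b K s \<partial>count_space UNIV)"
        using m[of "St i j"] by (subst nn_integral_add) (measurable, simp only: nn_integral_sojourn[OF i] nn_integral_next_state[OF i])
      also have "\<dots> = ?p * ennreal (V b (Suc K) i)"
        unfolding nn_integral_trans_prob[OF i] V_Suc_ennreal[OF b i]
        by (simp add: pot_def distrib_left add_ac)
      also have "\<dots> = (\<integral>\<^sup>+\<omega>. ennreal (V b (Suc K) i) * indicator {\<omega> \<in> space N. X k \<omega> = St i j} \<omega> \<partial>N)"
        by (subst nn_integral_cmult_indicator) (auto simp: mult.commute)
      also have "\<dots> = ?r s"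
        unfolding St by (intro nn_integral_cong) (auto simp: pot_def split: split_indicator)
      finally show ?thesis .
    qed
  qed
  then show ?thesis
    by (subst (1 2) nn_integral_split_countable[OF sigma_finite_measure_axioms, of "X k"]) auto
qed

text \<open>Each step turns one unit of the remaining horizon into collected time, so the mean
  depends on \<open>k + K\<close> only and can be read off at \<open>k = 0\<close>.\<close>

lemma nn_integral_elapsed_pot:
  assumes b: "b \<ge> 0"
  shows "(\<integral>\<^sup>+\<omega>. elapsed k \<omega> + pot b K (X k \<omega>) \<partial>N) = ennreal (V b (k + K) 0)"
proof (induction k arbitrary: K)
  case 0
  have "(\<integral>\<^sup>+\<omega>. elapsed 0 \<omega> + pot b K (X 0 \<omega>) \<partial>N) = (\<integral>\<^sup>+\<omega>. ennreal (V b K 0) \<partial>N)"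
    using AE_X_0 by (intro nn_integral_cong_AE) (auto elim!: eventually_mono simp: elapsed_def pot_def)
  then show ?case by (simp add: emeasure_space_1)
next
  case (Suc k)
  have "(\<integral>\<^sup>+\<omega>. elapsed (Suc k) \<omega> + pot b K (X (Suc k) \<omega>) \<partial>N)
     = (\<integral>\<^sup>+\<omega>. elapsed k \<omega> + ((if X k \<omega> = Fail then 0 else ennreal (W k \<omega>)) + pot b K (X (Suc k) \<omega>)) \<partial>N)"
    by (simp add: elapsed_def add.assoc)
  also have "\<dots> = (\<integral>\<^sup>+\<omega>. elapsed k \<omega> + pot b (Suc K) (X k \<omega>) \<partial>N)"
    by (subst (1 2) nn_integral_add) (auto simp: nn_integral_pot_step[OF b])
  finally show ?case using Suc.IH[of "Suc K"] by simp
qed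

lemma nn_integral_elapsed: "(\<integral>\<^sup>+\<omega>. elapsed k \<omega> \<partial>N) = ennreal (V 0 k 0)"
proof -
  have "pot 0 0 s = 0" for s by (simp add: pot_def split: dstate.split)
  then show ?thesis using nn_integral_elapsed_pot[of 0 k 0] by simp
qed

text \<open>For \<open>K = 0\<close> and \<open>b = 1\<close> the potential is the indicator of
  survival.\<close>

lemma prob_not_Fail: "prob {\<omega> \<in> space N. X k \<omega> \<noteq> Fail} = V 1 k 0 - V 0 k 0"
proof -
  have "pot 1 0 (X k \<omega>) = indicator {\<omega> \<in> space N. X k \<omega> \<noteq> Fail} \<omega>" if "\<omega> \<in> space N" for \<omega>
    using that by (auto simp: pot_def split: dstate.split)
  then have "(\<integral>\<^sup>+\<omega>. pot 1 0 (X k \<omega>) \<partial>N) = emeasure N {\<omega> \<in> space N. X k \<omega> \<noteq> Fail}"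
    by (subst nn_integral_cong[where v="indicator {\<omega> \<in> space N. X k \<omega> \<noteq> Fail}"]) auto
  then have "ennreal (V 0 k 0) + ennreal (prob {\<omega> \<in> space N. X k \<omega> \<noteq> Fail}) = ennreal (V 1 k 0)"
    using nn_integral_elapsed_pot[of 1 k 0] nn_integral_elapsed[of k] by (simp add: nn_integral_add emeasure_eq_measure)
  then show ?thesis using V_nonneg[of 0 0 k] V_nonneg[of 1 0 k] by (simp flip: ennreal_plus)
qed

lemma AE_Fail_reached: "AE \<omega> in N. \<exists>k. X k \<omega> = Fail"
proof -
  let ?S = "{\<omega> \<in> space N. \<forall>k. X k \<omega> \<noteq> Fail}"
  have "(\<lambda>k. prob {\<omega> \<in> space N. X k \<omega> \<noteq> Fail}) \<longlonglongrightarrow> Q 0 - Q 0"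
    unfolding prob_not_Fail by (intro tendsto_intros V_tendsto) simp_all
  moreover have "prob ?S \<le> prob {\<omega> \<in> space N. X k \<omega> \<noteq> Fail}" for k
    by (intro finite_measure_mono) auto
  ultimately have "prob ?S \<le> Q 0 - Q 0"
    by (intro LIMSEQ_le_const) auto
  then have "emeasure N ?S = 0" by (simp add: emeasure_eq_measure measure_le_0_iff)
  then show ?thesis by (intro AE_I'[of ?S]) auto
qed

text \<open>An infimum over hitting indices becomes a supremum of truncated sums, to which monotone
  convergence applies. The premise \<open>hit\<close> excludes the empty infimum, which is
  infinite.\<close>

lemma hit_time_Fail:
  assumes abs: "\<And>k. x k = Fail \<Longrightarrow> x (Suc k) = Fail" and hit: "\<exists>k. x k = Fail"
  shows "hit_time Fail x w = (SUP k. \<Sum>m<k. if x m = Fail then 0 else ennreal (w m))"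
proof -
  define h where "h = (LEAST k. x k = Fail)"
  have h: "x h = Fail" using LeastI_ex[OF hit] by (simp add: h_def)
  have before: "x m \<noteq> Fail" if "m < h" for m
    using not_less_Least[of m "\<lambda>k. x k = Fail"] that by (simp add: h_def)
  have after: "x m = Fail" if "h \<le> m" for m
    using that by (induction m rule: dec_induct) (auto simp: h abs)
  let ?f = "\<lambda>m. if x m = Fail then 0 else ennreal (w m)"
  have "hit_time Fail x w = (\<Sum>m<h. ennreal (w m))"
    unfolding hit_time_def
  proof (rule antisym)
    show "(INF k\<in>{k. x k = Fail}. \<Sum>m<k. ennreal (w m)) \<le> (\<Sum>m<h. ennreal (w m))"
      by (rule INF_lower) (simp add: h)
    show "(\<Sum>m<h. ennreal (w m)) \<le> (INF k\<in>{k. x k = Fail}. \<Sum>m<k. ennreal (w m))"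
    proof (rule INF_greatest)
      fix k assume "k \<in> {k. x k = Fail}"
      then have "h \<le> k" using before by (auto simp: not_less[symmetric])
      then show "(\<Sum>m<h. ennreal (w m)) \<le> (\<Sum>m<k. ennreal (w m))" by (intro sum_mono2) auto
    qed
  qed
  also have "\<dots> = (\<Sum>m<h. ?f m)" using before by (intro sum.cong) auto
  also have "\<dots> = (SUP k. \<Sum>m<k. ?f m)"
  proof (rule antisym)
    show "(\<Sum>m<h. ?f m) \<le> (SUP k. \<Sum>m<k. ?f m)" by (rule SUP_upper) simp
    show "(SUP k. \<Sum>m<k. ?f m) \<le> (\<Sum>m<h. ?f m)"
    proof (rule SUP_least)
      fix k
      have "(\<Sum>m<k. ?f m) \<le> (\<Sum>m<max h k. ?f m)" by (intro sum_mono2) auto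
      also have "\<dots> = (\<Sum>m<h. ?f m)" using after by (intro sum.mono_neutral_right) auto
      finally show "(\<Sum>m<k. ?f m) \<le> (\<Sum>m<h. ?f m)" .
    qed
  qed
  finally show ?thesis .
qed

theorem mean_hit_time_exp_law: "mean_hit_time Fail N X W = ennreal (Q 0)"
proof -
  have "AE \<omega> in N. \<forall>k. X k \<omega> = Fail \<longrightarrow> X (Suc k) \<omega> = Fail"
    using AE_X_Fail by (subst AE_all_countable) auto
  with AE_Fail_reached have "AE \<omega> in N. hit_time Fail (\<lambda>k. X k \<omega>) (\<lambda>k. W k \<omega>) = (SUP k. elapsed k \<omega>)"
    by eventually_elim (simp add: hit_time_Fail elapsed_def)
  then have "mean_hit_time Fail N X W = (\<integral>\<^sup>+\<omega>. (SUP k. elapsed k \<omega>) \<partial>N)"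
    unfolding mean_hit_time_def by (rule nn_integral_cong_AE)
  also have "\<dots> = (SUP k. \<integral>\<^sup>+\<omega>. elapsed k \<omega> \<partial>N)"
    by (rule nn_integral_monotone_convergence_SUP)
       (auto simp: incseq_def le_fun_def elapsed_def intro!: sum_mono2)
  finally have SUP: "mean_hit_time Fail N X W = (SUP k. \<integral>\<^sup>+\<omega>. elapsed k \<omega> \<partial>N)" .
  have "incseq (\<lambda>k. \<integral>\<^sup>+\<omega>. elapsed k \<omega> \<partial>N)"
    by (intro incseq_SucI nn_integral_mono) (simp add: elapsed_def)
  from LIMSEQ_SUP[OF this] have "(\<lambda>k. \<integral>\<^sup>+\<omega>. elapsed k \<omega> \<partial>N) \<longlonglongrightarrow> mean_hit_time Fail N X W"
    unfolding SUP .
  then have "(\<lambda>k. ennreal (V 0 k 0)) \<longlonglongrightarrow> mean_hit_time Fail N X W"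
    by (simp only: nn_integral_elapsed)
  moreover have "(\<lambda>k. ennreal (V 0 k 0)) \<longlonglongrightarrow> ennreal (Q 0)"
    by (intro tendsto_intros V_tendsto) simp
  ultimately show ?thesis by (rule LIMSEQ_unique)
qed

declare measurable_XW [measurable del]

end

end

section \<open>The supply of vehicles and the clocks of the groups\<close>

abbreviation exp_seq :: "real \<Rightarrow> (nat \<Rightarrow> real) measure" where
  "exp_seq l \<equiv> (\<Pi>\<^sub>M i\<in>UNIV. exp_law l)"

lemma sets_exp_seq [measurable_cong, simp]: "sets (exp_seq l) = sets (\<Pi>\<^sub>M i\<in>UNIV. borel)"
  by (intro sets_PiM_cong) auto

lemma space_exp_seq [simp]: "space (exp_seq l) = UNIV"
  by (simp add: space_PiM)

lemma prob_space_exp_seq: "l > 0 \<Longrightarrow> prob_space (exp_seq l)"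
  by (intro prob_space_PiM prob_space_exp_law)

lemma nn_integral_exp_seq_case_nat:
  assumes l: "l > 0" and f[measurable]: "f \<in> borel_measurable (\<Pi>\<^sub>M i\<in>UNIV. borel)"
  shows "(\<integral>\<^sup>+\<xi>. f \<xi> \<partial>exp_seq l) = (\<integral>\<^sup>+x. (\<integral>\<^sup>+\<xi>. f (case_nat x \<xi>) \<partial>exp_seq l) \<partial>exp_law l)"
proof -
  interpret sequence_space "exp_law l"
    by (intro sequence_space.intro product_prob_spaceI prob_space_exp_law l)
  have "(\<integral>\<^sup>+\<xi>. f \<xi> \<partial>exp_seq l) = (\<integral>\<^sup>+\<xi>. f \<xi> \<partial>distr (exp_law l \<Otimes>\<^sub>M exp_seq l) (exp_seq l) (\<lambda>(x, \<xi>). case_nat x \<xi>))"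
    by (simp only: PiM_iter)
  also have "\<dots> = (\<integral>\<^sup>+z. f (case z of (x, \<xi>) \<Rightarrow> case_nat x \<xi>) \<partial>(exp_law l \<Otimes>\<^sub>M exp_seq l))"
    by (rule nn_integral_distr) measurable
  also have "\<dots> = (\<integral>\<^sup>+x. (\<integral>\<^sup>+\<xi>. f (case_nat x \<xi>) \<partial>exp_seq l) \<partial>exp_law l)"
    using sigma_finite_measure.nn_integral_fst[OF prob_space_imp_sigma_finite[OF prob_space_exp_seq[OF l]],
        of "\<lambda>z. f (case z of (x, \<xi>) \<Rightarrow> case_nat x \<xi>)" "exp_law l"] by simp
  finally show ?thesis .
qed

text \<open>The head is a residual time at \<open>t\<close>, but the tail keeps absolute departure
  times: those vehicles have not been inspected yet, so their lifetimes are still fresh. If no entry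
  exceeds \<open>t\<close>, which has probability 0 under \<open>exp_seq\<close>, the value is
  arbitrary.\<close>

definition skip :: "real \<Rightarrow> (nat \<Rightarrow> real) \<Rightarrow> nat \<Rightarrow> real" where
  "skip t \<xi> = (let w = (LEAST w. t < \<xi> w) in case_nat (\<xi> w - t) (\<lambda>k. \<xi> (w + Suc k)))"

lemma measurable_skip:
  assumes [measurable]: "T \<in> borel_measurable M" "F \<in> M \<rightarrow>\<^sub>M (\<Pi>\<^sub>M i\<in>UNIV. borel)"
  shows "(\<lambda>x. skip (T x) (F x)) \<in> M \<rightarrow>\<^sub>M (\<Pi>\<^sub>M i\<in>UNIV. borel)"
proof -
  have [measurable]: "(\<lambda>x. F x k) \<in> borel_measurable M" for k
    using measurable_compose[OF assms(2) measurable_component_singleton[of k UNIV "\<lambda>_. borel"]] by simp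
  have [measurable]: "(\<lambda>x. LEAST w. T x < F x w) \<in> M \<rightarrow>\<^sub>M count_space UNIV"
    by measurable
  have [measurable]: "(\<lambda>x. F x (LEAST w. T x < F x w)) \<in> borel_measurable M"
    by (rule measurable_compose_countable[where g="\<lambda>x. LEAST w. T x < F x w"]) measurable
  have [measurable]: "(\<lambda>x. F x ((LEAST w. T x < F x w) + Suc k)) \<in> borel_measurable M" for k
    by (rule measurable_compose_countable[where g="\<lambda>x. LEAST w. T x < F x w" and f="\<lambda>w x. F x (w + Suc k)"]) measurable
  have "(\<lambda>x. \<lambda>k. F x ((LEAST w. T x < F x w) + Suc k)) \<in> M \<rightarrow>\<^sub>M (\<Pi>\<^sub>M i\<in>UNIV. borel)"
    by (rule measurable_PiM_single') auto
  then show ?thesis unfolding skip_def Let_def by measurable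
qed

lemma measurable_skip' [measurable]: "skip t \<in> (\<Pi>\<^sub>M i\<in>UNIV. borel) \<rightarrow>\<^sub>M (\<Pi>\<^sub>M i\<in>UNIV. borel)"
  by (rule measurable_skip[OF borel_measurable_const measurable_ident_sets[OF refl]])

lemma emeasure_exp_law_atMost:
  assumes "l > 0" "t \<ge> 0"
  shows "emeasure (exp_law l) {..t} = ennreal (1 - exp (- (l * t)))"
proof -
  interpret prob_space "exp_law l" by (rule prob_space_exp_law[OF assms(1)])
  show ?thesis using assms by (simp add: emeasure_eq_measure measure_exp_law_atMost)
qed

text \<open>Subtracting \<open>(1 - a) * I\<close> leaves \<open>a * (I - J) = 0\<close>; finiteness
  allows this to be done in the reals.\<close>

lemma ennreal_eq_mixture:
  assumes a: "0 < a" "a \<le> 1" and I: "I = ennreal a * J + ennreal (1 - a) * I" and fin: "I < \<top>" "J < \<top>"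
  shows "I = J"
proof -
  obtain i j where ij: "I = ennreal i" "J = ennreal j" "i \<ge> 0" "j \<ge> 0"
    using fin by (metis ennreal_cases less_irrefl)
  then have "i = a * j + (1 - a) * i"
    using I a by (simp flip: ennreal_mult ennreal_plus)
  then have "a * (i - j) = 0" by (simp add: algebra_simps)
  then show ?thesis using a ij by simp
qed

text \<open>No entry exceeds \<open>t\<close> iff the first one does not and the rest has the same
  property. The probability of this event thus equals itself times
  \<open>1 - exp (- (l * t))\<close>, and it vanishes. This makes the \<open>LEAST\<close> in
  \<open>skip\<close> and in \<open>vc_step\<close> meaningful.\<close>

lemma AE_exp_seq_exceeds:
  assumes l: "l > 0"
  shows "AE \<xi> in exp_seq l. \<forall>t. \<exists>w. t < \<xi> w"
proof -
  interpret prob_space "exp_seq l" by (rule prob_space_exp_seq[OF l])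
  have 1: "AE \<xi> in exp_seq l. \<exists>w. t < \<xi> w" if t: "t \<ge> 0" for t
  proof -
    let ?S = "{\<xi>. \<forall>w. \<xi> w \<le> t} :: (nat \<Rightarrow> real) set"
    have S[measurable]: "?S \<in> sets (\<Pi>\<^sub>M i\<in>UNIV. borel)"
    proof -
      have "{\<xi> \<in> space (\<Pi>\<^sub>M i\<in>UNIV::nat set. borel). \<forall>w. \<xi> w \<le> t} \<in> sets (\<Pi>\<^sub>M i\<in>UNIV. borel)" by measurable
      then show ?thesis by (simp add: space_PiM)
    qed
    have m: "(\<lambda>x. \<integral>\<^sup>+\<xi>. indicator ?S \<xi> \<partial>exp_seq l) \<in> borel_measurable borel" by measurable
    have "emeasure (exp_seq l) ?S = (\<integral>\<^sup>+x. (\<integral>\<^sup>+\<xi>. indicator ?S (case_nat x \<xi>) \<partial>exp_seq l) \<partial>exp_law l)"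
      using nn_integral_exp_seq_case_nat[OF l, of "indicator ?S"] by simp
    also have "\<dots> = (\<integral>\<^sup>+x. emeasure (exp_seq l) ?S * indicator {..t} x \<partial>exp_law l)"
    proof (intro nn_integral_cong)
      fix x
      have "(case_nat x \<xi> \<in> ?S) \<longleftrightarrow> x \<le> t \<and> \<xi> \<in> ?S" for \<xi> by (auto split: nat.split)
      then have "(\<integral>\<^sup>+\<xi>. indicator ?S (case_nat x \<xi>) \<partial>exp_seq l) = (\<integral>\<^sup>+\<xi>. indicator {..t} x * indicator ?S \<xi> \<partial>exp_seq l)"
        by (intro nn_integral_cong) (auto simp: indicator_def)
      also have "\<dots> = indicator {..t} x * emeasure (exp_seq l) ?S"
        by (rule nn_integral_cmult_indicator) simp
      finally show "(\<integral>\<^sup>+\<xi>. indicator ?S (case_nat x \<xi>) \<partial>exp_seq l) = emeasure (exp_seq l) ?S * indicator {..t} x"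
        by (simp add: mult.commute)
    qed
    also have "\<dots> = emeasure (exp_seq l) ?S * ennreal (1 - exp (- (l * t)))"
      by (subst nn_integral_cmult_indicator) (use l t in \<open>simp_all add: emeasure_exp_law_atMost\<close>)
    finally have "emeasure (exp_seq l) ?S = ennreal (exp (- (l * t))) * 0 + ennreal (1 - exp (- (l * t))) * emeasure (exp_seq l) ?S"
      by (simp add: mult.commute)
    then have "emeasure (exp_seq l) ?S = 0"
      by (rule ennreal_eq_mixture[rotated 2]) (use l t in \<open>auto simp: less_top[symmetric]\<close>)
    then show ?thesis by (intro AE_I'[of ?S]) (auto simp: null_sets_def not_less)
  qed
  then have "AE \<xi> in exp_seq l. \<forall>t::nat. \<exists>w. real t < \<xi> w"
    by (subst AE_all_countable) simp
  then show ?thesis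
  proof eventually_elim
    case (elim \<xi>)
    show ?case
    proof
      fix t :: real
      obtain m :: nat where "t \<le> real m" using real_arch_simple by blast
      then show "\<exists>w. t < \<xi> w" using elim by (metis le_less_trans)
    qed
  qed
qed

lemma skip_case_nat:
  assumes "\<exists>w. t < \<xi> w"
  shows "skip t (case_nat x \<xi>) = (if t < x then case_nat (x - t) \<xi> else skip t \<xi>)"
proof (cases "t < x")
  case True
  then have "(LEAST w. t < case_nat x \<xi> w) = 0" by (intro Least_equality) auto
  then show ?thesis using True by (simp add: skip_def)
next
  case False
  from assms obtain w where "t < \<xi> w" by auto
  then have "(LEAST w. t < case_nat x \<xi> w) = Suc (LEAST m. t < case_nat x \<xi> (Suc m))"
    using False by (intro Least_Suc[of _ "Suc w"]) auto
  then show ?thesis using False by (simp add: skip_def Let_def)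
qed

text \<open>Depending on whether the first vehicle of the supply is still present at time \<open>t\<close>, the law of
  the left-hand side is the fresh law or itself; hence it is a mixture of both, and equal to the former.\<close>

lemma distr_skip:
  assumes l: "l > 0" and t: "t \<ge> 0"
  shows "distr (exp_seq l) (\<Pi>\<^sub>M i\<in>UNIV. borel) (skip t) = exp_seq l"
proof (rule measure_eqI)
  interpret prob_space "exp_seq l" by (rule prob_space_exp_seq[OF l])
  let ?D = "distr (exp_seq l) (\<Pi>\<^sub>M i\<in>UNIV. borel) (skip t)"
  show "sets ?D = sets (exp_seq l)" by simp
  fix A assume "A \<in> sets ?D"
  then have A[measurable]: "A \<in> sets (\<Pi>\<^sub>M i\<in>UNIV. borel)" by simp
  interpret D: prob_space ?D by (rule prob_space_distr) measurable
  let ?g = "\<lambda>x. \<integral>\<^sup>+\<xi>. indicator A (case_nat x \<xi>) \<partial>exp_seq l"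
  have I: "emeasure ?D A = (\<integral>\<^sup>+\<xi>. indicator A (skip t \<xi>) \<partial>exp_seq l)"
    using nn_integral_distr[of "skip t" "exp_seq l" "\<Pi>\<^sub>M i\<in>UNIV. borel" "indicator A"] by simp
  also have "\<dots> = (\<integral>\<^sup>+x. (\<integral>\<^sup>+\<xi>. indicator A (skip t (case_nat x \<xi>)) \<partial>exp_seq l) \<partial>exp_law l)"
    by (rule nn_integral_exp_seq_case_nat[OF l]) measurable
  also have "\<dots> = (\<integral>\<^sup>+x. ?g (x - t) * indicator {t<..} x + emeasure ?D A * indicator {..t} x \<partial>exp_law l)"
  proof (intro nn_integral_cong)
    fix x
    have "AE \<xi> in exp_seq l. indicator A (skip t (case_nat x \<xi>))
      = (indicator A (if t < x then case_nat (x - t) \<xi> else skip t \<xi>) :: ennreal)"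
      using AE_exp_seq_exceeds[OF l] by eventually_elim (simp add: skip_case_nat)
    then have "(\<integral>\<^sup>+\<xi>. indicator A (skip t (case_nat x \<xi>)) \<partial>exp_seq l)
      = (\<integral>\<^sup>+\<xi>. indicator A (if t < x then case_nat (x - t) \<xi> else skip t \<xi>) \<partial>exp_seq l)"
      by (rule nn_integral_cong_AE)
    then show "(\<integral>\<^sup>+\<xi>. indicator A (skip t (case_nat x \<xi>)) \<partial>exp_seq l)
      = ?g (x - t) * indicator {t<..} x + emeasure ?D A * indicator {..t} x"
      by (cases "t < x") (simp_all add: I)
  qed
  also have "\<dots> = (\<integral>\<^sup>+x. ?g (x - t) * indicator {t<..} x \<partial>exp_law l) + (\<integral>\<^sup>+x. emeasure ?D A * indicator {..t} x \<partial>exp_law l)"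
    by (rule nn_integral_add) measurable
  also have "(\<integral>\<^sup>+x. ?g (x - t) * indicator {t<..} x \<partial>exp_law l) = ennreal (exp (- (l * t))) * (\<integral>\<^sup>+x. ?g x \<partial>exp_law l)"
    by (subst exp_law_memoryless[OF l t]) simp_all
  also have "(\<integral>\<^sup>+x. ?g x \<partial>exp_law l) = emeasure (exp_seq l) A"
    using nn_integral_exp_seq_case_nat[OF l, of "indicator A"] by simp
  also have "(\<integral>\<^sup>+x. emeasure ?D A * indicator {..t} x \<partial>exp_law l) = ennreal (1 - exp (- (l * t))) * emeasure ?D A"
    by (subst nn_integral_cmult_indicator) (use l t in \<open>simp_all add: emeasure_exp_law_atMost mult.commute\<close>)
  finally show "emeasure ?D A = emeasure (exp_seq l) A"
    by (rule ennreal_eq_mixture[rotated 2]) (use l t in \<open>auto simp: less_top[symmetric] simp del: emeasure_distr\<close>)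
qed

lemma nn_integral_skip:
  assumes l: "l > 0" and t: "t \<ge> 0" and f: "f \<in> borel_measurable (\<Pi>\<^sub>M i\<in>UNIV. borel)"
  shows "(\<integral>\<^sup>+\<xi>. f (skip t \<xi>) \<partial>exp_seq l) = (\<integral>\<^sup>+\<xi>. f \<xi> \<partial>exp_seq l)"
proof -
  have "(\<integral>\<^sup>+\<xi>. f (skip t \<xi>) \<partial>exp_seq l) = (\<integral>\<^sup>+\<xi>. f \<xi> \<partial>distr (exp_seq l) (\<Pi>\<^sub>M i\<in>UNIV. borel) (skip t))"
    using f by (subst nn_integral_distr) auto
  then show ?thesis by (simp add: distr_skip[OF l t])
qed

text \<open>Group \<open>g\<close> occupies the slots \<open>(g, False)\<close> and \<open>(g, True)\<close>. A slot holds either a vehicle,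
  whose clock \<open>h\<close> rings when it leaves the cloud, or (if \<open>\<tau>\<close> is true) a recruitment in progress,
  whose clock rings on completion. An event replaces the contents of a single slot, and the group
  fails if a vehicle leaves next to a recruitment.\<close>

type_synonym slot = "nat \<times> bool"

definition slots :: "nat \<Rightarrow> slot set" where
  "slots n = {..<n} \<times> UNIV"

definition partner :: "slot \<Rightarrow> slot" where
  "partner e = (fst e, \<not> snd e)"

definition group_clock :: "(slot \<Rightarrow> real) \<Rightarrow> nat \<Rightarrow> real" where
  "group_clock h g = min (h (g, False)) (h (g, True))"

definition first_group :: "nat \<Rightarrow> (slot \<Rightarrow> real) \<Rightarrow> nat" where
  "first_group n h = (LEAST g. g < n \<and> (\<forall>g'<n. group_clock h g \<le> group_clock h g'))"

text \<open>Ties are resolved as in \<^const>\<open>vc_step\<close>: the least group comes first, and in it a completed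
  recruitment comes before the departure of the recruiter.\<close>

definition first_slot :: "nat \<Rightarrow> (slot \<Rightarrow> bool) \<Rightarrow> (slot \<Rightarrow> real) \<Rightarrow> slot" where
  "first_slot n \<tau> h = (let g = first_group n h in
     (g, \<not> (h (g, False) < h (g, True) \<or> h (g, False) = h (g, True) \<and> \<not> \<tau> (g, True))))"

text \<open>The failure time if it is among the first \<open>K\<close> events, and otherwise the time of the
  \<open>K\<close>-th event plus \<open>b\<close>.\<close>

fun slot_time :: "nat \<Rightarrow> real \<Rightarrow> nat \<Rightarrow> (slot \<Rightarrow> bool) \<Rightarrow> real \<Rightarrow> (slot \<Rightarrow> real) \<Rightarrow> (nat \<Rightarrow> real) \<Rightarrow> (nat \<Rightarrow> real) \<Rightarrow> real" where
  "slot_time n b 0 \<tau> t h \<xi> \<upsilon> = t + b"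
| "slot_time n b (Suc K) \<tau> t h \<xi> \<upsilon> = (let e = first_slot n \<tau> h in
     if \<tau> (partner e) then h e
     else if \<tau> e then slot_time n b K (\<tau>(e := False)) (h e) (h(e := h e + skip (h e) \<xi> 0)) (\<lambda>k. skip (h e) \<xi> (Suc k)) \<upsilon>
     else slot_time n b K (\<tau>(e := True)) (h e) (h(e := h e + \<upsilon> 0)) \<xi> (\<lambda>k. \<upsilon> (Suc k)))"

section \<open>The slot that rings first\<close>

lemma finite_slots [simp]: "finite (slots n)"
  by (simp add: slots_def)

lemma card_slots: "card (slots n) = 2 * n"
  by (simp add: slots_def card_cartesian_product)

lemma partner_partner [simp]: "partner (partner e) = e"
  by (simp add: partner_def)

lemma partner_neq [simp]: "partner e \<noteq> e"
  by (cases e) (simp add: partner_def)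

lemma partner_in_slots [simp]: "partner e \<in> slots n \<longleftrightarrow> e \<in> slots n"
  by (cases e) (auto simp: partner_def slots_def)

lemma first_group:
  assumes "n \<ge> 1"
  shows "first_group n h < n" "g < n \<Longrightarrow> group_clock h (first_group n h) \<le> group_clock h g"
proof -
  have "Min (group_clock h ` {..<n}) \<in> group_clock h ` {..<n}"
    by (rule Min_in) (use assms in \<open>auto simp: lessThan_empty_iff\<close>)
  then obtain g0 where "g0 < n" "group_clock h g0 = Min (group_clock h ` {..<n})" by auto
  then have "g0 < n \<and> (\<forall>g'<n. group_clock h g0 \<le> group_clock h g')" by auto
  from LeastI[of "\<lambda>g. g < n \<and> (\<forall>g'<n. group_clock h g \<le> group_clock h g')", OF this]
  show "first_group n h < n" "g < n \<Longrightarrow> group_clock h (first_group n h) \<le> group_clock h g"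
    by (auto simp: first_group_def)
qed

lemma first_slot_clock: "h (first_slot n \<tau> h) = group_clock h (first_group n h)"
  by (cases "h (first_group n h, False) < h (first_group n h, True) \<or>
        h (first_group n h, False) = h (first_group n h, True) \<and> \<not> \<tau> (first_group n h, True)")
    (auto simp: first_slot_def group_clock_def Let_def)

lemma first_slot:
  assumes n: "n \<ge> 1"
  shows "first_slot n \<tau> h \<in> slots n" "e \<in> slots n \<Longrightarrow> h (first_slot n \<tau> h) \<le> h e"
proof -
  show "first_slot n \<tau> h \<in> slots n"
    using first_group(1)[OF n] by (simp add: first_slot_def slots_def Let_def)
  assume "e \<in> slots n"
  then obtain g \<beta> where e: "e = (g, \<beta>)" "g < n" by (auto simp: slots_def)
  have "h (first_slot n \<tau> h) = group_clock h (first_group n h)" by (rule first_slot_clock)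
  also have "\<dots> \<le> group_clock h g" by (rule first_group(2)[OF n e(2)])
  also have "\<dots> \<le> h e" by (cases \<beta>) (auto simp: e group_clock_def)
  finally show "h (first_slot n \<tau> h) \<le> h e" .
qed

text \<open>A strict minimum is found under every rule for ties, so the almost sure arguments never
  meet that rule.\<close>

lemma first_slot_eqI:
  assumes "n \<ge> 1" "e \<in> slots n" "\<And>e'. e' \<in> slots n \<Longrightarrow> e' \<noteq> e \<Longrightarrow> h e < h e'"
  shows "first_slot n \<tau> h = e"
proof (rule ccontr)
  assume "first_slot n \<tau> h \<noteq> e"
  then have "h e < h (first_slot n \<tau> h)" by (rule assms(3)[OF first_slot(1)[OF assms(1)]])
  moreover have "h (first_slot n \<tau> h) \<le> h e" by (rule first_slot(2)[OF assms(1,2)])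
  ultimately show False by simp
qed

lemma measurable_count_space_into:
  assumes "f \<in> M \<rightarrow>\<^sub>M count_space UNIV" "\<And>x. x \<in> space M \<Longrightarrow> f x \<in> A"
  shows "f \<in> M \<rightarrow>\<^sub>M count_space A"
  using assms by (auto simp: measurable_def)

lemma measurable_slot:
  assumes "H \<in> M \<rightarrow>\<^sub>M (\<Pi>\<^sub>M e\<in>slots n. borel)" "e \<in> slots n"
  shows "(\<lambda>x. H x e :: real) \<in> borel_measurable M"
  using measurable_compose[OF assms(1) measurable_component_singleton[OF assms(2)]] by simp

lemma measurable_first_slot:
  assumes n: "n \<ge> 1" and H: "H \<in> M \<rightarrow>\<^sub>M (\<Pi>\<^sub>M e\<in>slots n. borel)"
  shows "(\<lambda>x. first_slot n \<tau> (H x)) \<in> M \<rightarrow>\<^sub>M count_space (slots n)"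
proof -
  have s: "(\<lambda>x. H x (g, \<beta>)) \<in> borel_measurable M" if "g < n" for g \<beta>
    by (rule measurable_slot[OF H]) (simp add: slots_def that)
  have c: "(\<lambda>x. group_clock (H x) g) \<in> borel_measurable M" if "g < n" for g
    unfolding group_clock_def using s[OF that] by measurable
  have g: "(\<lambda>x. first_group n (H x)) \<in> M \<rightarrow>\<^sub>M count_space UNIV"
    unfolding first_group_def
  proof (rule measurable_Least)
    fix g
    show "(\<lambda>x. g < n \<and> (\<forall>g'<n. group_clock (H x) g \<le> group_clock (H x) g')) \<in> M \<rightarrow>\<^sub>M count_space UNIV"
    proof (cases "g < n")
      case True
      have "Measurable.pred M (\<lambda>x. \<forall>g'\<in>{..<n}. group_clock (H x) g \<le> group_clock (H x) g')"
      proof (rule pred_intros_finite)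
        fix g' assume "g' \<in> {..<n}"
        then have [measurable]: "(\<lambda>x. group_clock (H x) g') \<in> borel_measurable M" by (auto intro: c)
        have [measurable]: "(\<lambda>x. group_clock (H x) g) \<in> borel_measurable M" by (rule c[OF True])
        show "Measurable.pred M (\<lambda>x. group_clock (H x) g \<le> group_clock (H x) g')"
          by measurable
      qed simp
      moreover have "(\<lambda>x. g < n \<and> (\<forall>g'<n. group_clock (H x) g \<le> group_clock (H x) g'))
        = (\<lambda>x. \<forall>g'\<in>{..<n}. group_clock (H x) g \<le> group_clock (H x) g')"
        using True by auto
      ultimately show ?thesis by (simp only:)
    qed simp
  qed
  then have g': "(\<lambda>x. first_group n (H x)) \<in> M \<rightarrow>\<^sub>M count_space {..<n}"
    by (rule measurable_count_space_into) (simp add: first_group(1)[OF n])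
  have "(\<lambda>x. let g = first_group n (H x) in
     (g, \<not> (H x (g, False) < H x (g, True) \<or> H x (g, False) = H x (g, True) \<and> \<not> \<tau> (g, True)))) \<in> M \<rightarrow>\<^sub>M count_space UNIV"
    unfolding Let_def
  proof (rule measurable_compose_countable'[OF _ g'])
    fix g assume "g \<in> {..<n}"
    then have [measurable]: "(\<lambda>x. H x (g, \<beta>)) \<in> borel_measurable M" for \<beta> using s by auto
    have "Measurable.pred M (\<lambda>x. \<not> (H x (g, False) < H x (g, True) \<or> H x (g, False) = H x (g, True) \<and> \<not> \<tau> (g, True)))"
      by measurable
    from measurable_compose[OF this, of "Pair g" "count_space UNIV"]
    show "(\<lambda>x. (g, \<not> (H x (g, False) < H x (g, True) \<or> H x (g, False) = H x (g, True) \<and> \<not> \<tau> (g, True)))) \<in> M \<rightarrow>\<^sub>M count_space UNIV"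
      by simp
  qed simp
  then have "(\<lambda>x. first_slot n \<tau> (H x)) \<in> M \<rightarrow>\<^sub>M count_space UNIV" by (simp add: first_slot_def)
  then show ?thesis
    by (rule measurable_count_space_into) (rule first_slot(1)[OF n])
qed

text \<open>The configuration \<open>\<tau>\<close> stays a fixed parameter: after splitting over
  the finitely many values of the first slot it is deterministic again, while the other arguments
  may depend on \<open>x\<close>.\<close>

lemma measurable_slot_time:
  assumes n: "n \<ge> 1"
    and "T \<in> borel_measurable M" "H \<in> M \<rightarrow>\<^sub>M (\<Pi>\<^sub>M e\<in>slots n. borel)"
    and "F \<in> M \<rightarrow>\<^sub>M (\<Pi>\<^sub>M i\<in>UNIV. borel)" "G \<in> M \<rightarrow>\<^sub>M (\<Pi>\<^sub>M i\<in>UNIV. borel)"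
  shows "(\<lambda>x. slot_time n b K \<tau> (T x) (H x) (F x) (G x)) \<in> borel_measurable M"
  using assms(2-)
proof (induction K arbitrary: \<tau> T H F G)
  case 0
  then show ?case by simp
next
  case (Suc K)
  note [measurable] = Suc.prems
  have shift: "(\<lambda>x k. F x (Suc k)) \<in> M \<rightarrow>\<^sub>M (\<Pi>\<^sub>M i\<in>UNIV. borel)" if "F \<in> M \<rightarrow>\<^sub>M (\<Pi>\<^sub>M i\<in>UNIV. borel)"
    for F :: "_ \<Rightarrow> nat \<Rightarrow> real"
    by (rule measurable_PiM_single') (use measurable_compose[OF that measurable_component_singleton] in auto)
  have comp: "(\<lambda>x. F x k) \<in> borel_measurable M" if "F \<in> M \<rightarrow>\<^sub>M (\<Pi>\<^sub>M i\<in>UNIV. borel)"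
    for F :: "_ \<Rightarrow> nat \<Rightarrow> real" and k
    using measurable_compose[OF that measurable_component_singleton[of k]] by simp
  show ?case
    unfolding slot_time.simps Let_def
  proof (rule measurable_compose_countable'[OF _ measurable_first_slot[OF n Suc.prems(2)]])
    fix e assume e: "e \<in> slots n"
    have He[measurable]: "(\<lambda>x. H x e) \<in> borel_measurable M" by (rule measurable_slot[OF Suc.prems(2) e])
    have upd: "(\<lambda>x. (H x)(e := f x)) \<in> M \<rightarrow>\<^sub>M (\<Pi>\<^sub>M e\<in>slots n. borel)" if "f \<in> borel_measurable M" for f
      by (rule measurable_fun_upd[where J="slots n"]) (use that e Suc.prems(2) in auto)
    have sk: "(\<lambda>x. skip (H x e) (F x)) \<in> M \<rightarrow>\<^sub>M (\<Pi>\<^sub>M i\<in>UNIV. borel)"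
      by (rule measurable_skip) (fact He, fact Suc.prems(3))
    have "(\<lambda>x. slot_time n b K (\<tau>(e := False)) (H x e) ((H x)(e := H x e + skip (H x e) (F x) 0)) (\<lambda>k. skip (H x e) (F x) (Suc k)) (G x)) \<in> borel_measurable M"
      by (rule Suc.IH[OF He upd[OF borel_measurable_add[OF He comp[OF sk]]] shift[OF sk] Suc.prems(4)])
    moreover have "(\<lambda>x. slot_time n b K (\<tau>(e := True)) (H x e) ((H x)(e := H x e + G x 0)) (F x) (\<lambda>k. G x (Suc k))) \<in> borel_measurable M"
      by (rule Suc.IH[OF He upd[OF borel_measurable_add[OF He comp[OF Suc.prems(4)]]] Suc.prems(3) shift[OF Suc.prems(4)]])
    ultimately show "(\<lambda>x. if \<tau> (partner e) then H x e
       else if \<tau> e then slot_time n b K (\<tau>(e := False)) (H x e) ((H x)(e := H x e + skip (H x e) (F x) 0)) (\<lambda>k. skip (H x e) (F x) (Suc k)) (G x)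
       else slot_time n b K (\<tau>(e := True)) (H x e) ((H x)(e := H x e + G x 0)) (F x) (\<lambda>k. G x (Suc k))) \<in> borel_measurable M"
      using He by (cases "\<tau> (partner e)"; cases "\<tau> e") (simp_all only: if_True if_False)
  qed (simp add: countable_finite)
qed

section \<open>Mean values of the slot process\<close>

context exp_cloud
begin

definition rate :: "(slot \<Rightarrow> bool) \<Rightarrow> slot \<Rightarrow> real" where
  "rate \<tau> e = (if \<tau> e then lu else lz)"

abbreviation slot_law :: "(slot \<Rightarrow> bool) \<Rightarrow> (slot \<Rightarrow> real) measure" where
  "slot_law \<tau> \<equiv> \<Pi>\<^sub>M e\<in>slots n. exp_law (rate \<tau> e)"

text \<open>Absolute ringing times, obtained from residual times \<open>x\<close> at time
  \<open>t\<close>. The restriction keeps the result in the space of the product measure.\<close>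

definition clocks :: "real \<Rightarrow> (slot \<Rightarrow> real) \<Rightarrow> slot \<Rightarrow> real" where
  "clocks t x = (\<lambda>e\<in>slots n. t + x e)"

definition valid_config :: "(slot \<Rightarrow> bool) \<Rightarrow> bool" where
  "valid_config \<tau> \<longleftrightarrow> (\<forall>e. \<not> (\<tau> e \<and> \<tau> (partner e)))"

lemma rate_pos: "rate \<tau> e > 0"
  using lz lu by (simp add: rate_def)

lemma sets_slot_law [simp, measurable_cong]: "sets (slot_law \<tau>) = sets (\<Pi>\<^sub>M e\<in>slots n. borel)"
  by (intro sets_PiM_cong) auto

lemma prob_space_slot_law: "prob_space (slot_law \<tau>)"
  by (intro prob_space_PiM prob_space_exp_law rate_pos)

lemma measurable_clocks [measurable]: "clocks t \<in> (\<Pi>\<^sub>M e\<in>slots n. borel) \<rightarrow>\<^sub>M (\<Pi>\<^sub>M e\<in>slots n. borel)"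
  unfolding clocks_def by measurable

lemma clocks_update: "e \<in> slots n \<Longrightarrow> (clocks t x)(e := t + y) = clocks t (x(e := y))"
  by (auto simp: clocks_def fun_eq_iff)

interpretation Zs: prob_space "exp_seq lz" by (rule prob_space_exp_seq[OF lz])
interpretation Us: prob_space "exp_seq lu" by (rule prob_space_exp_seq[OF lu])

text \<open>The supply and the recruitment durations are averaged out while the clocks stay
  explicit, so that \<open>exp_law_competition\<close> can be applied to the clocks.\<close>

definition future :: "real \<Rightarrow> nat \<Rightarrow> (slot \<Rightarrow> bool) \<Rightarrow> real \<Rightarrow> (slot \<Rightarrow> real) \<Rightarrow> ennreal" where
  "future b K \<tau> t x = (\<integral>\<^sup>+\<xi>. (\<integral>\<^sup>+\<upsilon>. ennreal (slot_time n b K \<tau> t x \<xi> \<upsilon>) \<partial>exp_seq lu) \<partial>exp_seq lz)"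

lemmas measurable_slot_time' [measurable (raw)] = measurable_slot_time[OF n]

lemma measurable_future [measurable]: "future b K \<tau> t \<in> borel_measurable (\<Pi>\<^sub>M e\<in>slots n. borel)"
  unfolding future_def by measurable

text \<open>After an event the redrawn clock appears as the inner integral; Fubini brings it into
  the order of \<open>nn_integral_PiM_exp_law_update\<close>.\<close>

lemma nn_integral_slot_law_update:
  assumes e: "e \<in> slots n" and g[measurable]: "g \<in> borel_measurable (\<Pi>\<^sub>M e\<in>slots n. borel)"
  shows "(\<integral>\<^sup>+x. (\<integral>\<^sup>+y. g (x(e := y)) \<partial>exp_law (if \<beta> then lu else lz)) \<partial>slot_law \<tau>) = (\<integral>\<^sup>+x. g x \<partial>slot_law (\<tau>(e := \<beta>)))"
proof -
  let ?a = "if \<beta> then lu else lz"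
  have a: "?a > 0" using lz lu by simp
  interpret A: prob_space "exp_law ?a" by (rule prob_space_exp_law[OF a])
  interpret S: prob_space "slot_law \<tau>" by (rule prob_space_slot_law)
  interpret pair_sigma_finite "exp_law ?a" "slot_law \<tau>" ..
  have "(\<lambda>z. (snd z)(e := fst z)) \<in> exp_law ?a \<Otimes>\<^sub>M slot_law \<tau> \<rightarrow>\<^sub>M (\<Pi>\<^sub>M e\<in>slots n. borel)"
    by (rule measurable_fun_upd[where J="slots n"]) (use e in \<open>auto simp: insert_absorb\<close>)
  then have "case_prod (\<lambda>y x. g (x(e := y))) \<in> borel_measurable (exp_law ?a \<Otimes>\<^sub>M slot_law \<tau>)"
    unfolding case_prod_beta' by measurable
  from Fubini'[OF this]
  have "(\<integral>\<^sup>+x. (\<integral>\<^sup>+y. g (x(e := y)) \<partial>exp_law ?a) \<partial>slot_law \<tau>) = (\<integral>\<^sup>+y. (\<integral>\<^sup>+x. g (x(e := y)) \<partial>slot_law \<tau>) \<partial>exp_law ?a)" .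
  also have "\<dots> = (\<integral>\<^sup>+x. g x \<partial>(\<Pi>\<^sub>M e'\<in>slots n. exp_law (((rate \<tau>)(e := ?a)) e')))"
    by (rule nn_integral_PiM_exp_law_update[OF rate_pos a finite_slots e]) simp
  also have "(rate \<tau>)(e := ?a) = rate (\<tau>(e := \<beta>))"
    by (auto simp: rate_def fun_eq_iff)
  finally show ?thesis .
qed

lemma clocks_update_measurable:
  assumes e: "e \<in> slots n" and x: "x \<in> space (\<Pi>\<^sub>M e\<in>slots n. borel)"
    and [measurable]: "f \<in> borel_measurable M"
  shows "(\<lambda>y. (clocks t x)(e := f y)) \<in> M \<rightarrow>\<^sub>M (\<Pi>\<^sub>M e\<in>slots n. borel)"
proof (rule measurable_fun_upd[where J="slots n"])
  show "(\<lambda>y. clocks t x) \<in> M \<rightarrow>\<^sub>M (\<Pi>\<^sub>M e\<in>slots n. borel)"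
    using measurable_space[OF measurable_clocks x] by (rule measurable_const)
qed (use e in \<open>auto simp: insert_absorb\<close>)

lemma measurable_seq_0:
  assumes "f \<in> M \<rightarrow>\<^sub>M (\<Pi>\<^sub>M i\<in>UNIV::nat set. borel)"
  shows "(\<lambda>x. f x 0 :: real) \<in> borel_measurable M"
  using measurable_compose[OF assms measurable_component_singleton[of 0]] by simp

lemma measurable_seq_Suc:
  assumes "f \<in> M \<rightarrow>\<^sub>M (\<Pi>\<^sub>M i\<in>UNIV::nat set. borel)"
  shows "(\<lambda>x k. f x (Suc k) :: real) \<in> M \<rightarrow>\<^sub>M (\<Pi>\<^sub>M i\<in>UNIV::nat set. borel)"
  by (rule measurable_PiM_single') (use measurable_compose[OF assms measurable_component_singleton] in auto)

text \<open>By \<open>nn_integral_skip\<close> the supply seen at time \<open>t\<close> is an i.i.d.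
  sequence again. Its head becomes the clock of slot \<open>e\<close>, and its tail is the new
  supply.\<close>

lemma future_recruited:
  assumes e: "e \<in> slots n" and t: "t \<ge> 0"
  shows "(\<integral>\<^sup>+x. (\<integral>\<^sup>+\<xi>. (\<integral>\<^sup>+\<upsilon>. ennreal (slot_time n b K (\<tau>(e := False)) t ((clocks t x)(e := t + skip t \<xi> 0))
       (\<lambda>k. skip t \<xi> (Suc k)) \<upsilon>) \<partial>exp_seq lu) \<partial>exp_seq lz) \<partial>slot_law \<tau>)
    = (\<integral>\<^sup>+x. future b K (\<tau>(e := False)) t (clocks t x) \<partial>slot_law (\<tau>(e := False)))"
proof -
  let ?s = "slot_time n b K (\<tau>(e := False)) t"
  have "(\<integral>\<^sup>+x. (\<integral>\<^sup>+\<xi>. (\<integral>\<^sup>+\<upsilon>. ennreal (?s ((clocks t x)(e := t + skip t \<xi> 0)) (\<lambda>k. skip t \<xi> (Suc k)) \<upsilon>) \<partial>exp_seq lu) \<partial>exp_seq lz) \<partial>slot_law \<tau>)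
     = (\<integral>\<^sup>+x. (\<integral>\<^sup>+y. future b K (\<tau>(e := False)) t (clocks t (x(e := y))) \<partial>exp_law lz) \<partial>slot_law \<tau>)"
  proof (intro nn_integral_cong)
    fix x assume "x \<in> space (slot_law \<tau>)"
    then have x: "x \<in> space (\<Pi>\<^sub>M e\<in>slots n. borel)" by (simp add: space_PiM)
    let ?f = "\<lambda>\<xi>. \<integral>\<^sup>+\<upsilon>. ennreal (?s ((clocks t x)(e := t + \<xi> 0)) (\<lambda>k. \<xi> (Suc k)) \<upsilon>) \<partial>exp_seq lu"
    have [measurable]: "(\<lambda>z. (clocks t x)(e := t + fst z 0)) \<in> (\<Pi>\<^sub>M i\<in>UNIV::nat set. borel) \<Otimes>\<^sub>M exp_seq lu \<rightarrow>\<^sub>M (\<Pi>\<^sub>M e\<in>slots n. borel)"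
      by (intro clocks_update_measurable[OF e x] borel_measurable_add borel_measurable_const measurable_seq_0) measurable
    have [measurable]: "(\<lambda>z k. fst z (Suc k) :: real) \<in> (\<Pi>\<^sub>M i\<in>UNIV::nat set. borel) \<Otimes>\<^sub>M exp_seq lu \<rightarrow>\<^sub>M (\<Pi>\<^sub>M i\<in>UNIV. borel)"
      by (rule measurable_seq_Suc[of fst]) measurable
    have m: "?f \<in> borel_measurable (\<Pi>\<^sub>M i\<in>UNIV. borel)"
      by measurable
    have "(\<integral>\<^sup>+\<xi>. ?f (skip t \<xi>) \<partial>exp_seq lz) = (\<integral>\<^sup>+\<xi>. ?f \<xi> \<partial>exp_seq lz)"
      by (rule nn_integral_skip[OF lz t m])
    also have "\<dots> = (\<integral>\<^sup>+y. (\<integral>\<^sup>+\<xi>. ?f (case_nat y \<xi>) \<partial>exp_seq lz) \<partial>exp_law lz)"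
      by (rule nn_integral_exp_seq_case_nat[OF lz m])
    also have "\<dots> = (\<integral>\<^sup>+y. future b K (\<tau>(e := False)) t (clocks t (x(e := y))) \<partial>exp_law lz)"
      by (simp add: future_def clocks_update[OF e])
    finally show "(\<integral>\<^sup>+\<xi>. ?f (skip t \<xi>) \<partial>exp_seq lz) = (\<integral>\<^sup>+y. future b K (\<tau>(e := False)) t (clocks t (x(e := y))) \<partial>exp_law lz)" .
  qed
  also have "\<dots> = (\<integral>\<^sup>+x. future b K (\<tau>(e := False)) t (clocks t x) \<partial>slot_law (\<tau>(e := False)))"
    using nn_integral_slot_law_update[OF e, where g="\<lambda>x. future b K (\<tau>(e := False)) t (clocks t x)" and \<beta>=False and \<tau>=\<tau>] by simp
  finally show ?thesis .
qed

text \<open>Recruitment durations count from their start and are consumed one after the other, so no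
  \<open>skip\<close> occurs and the head of the sequence is the new clock.\<close>

lemma future_recruiting:
  assumes e: "e \<in> slots n"
  shows "(\<integral>\<^sup>+x. (\<integral>\<^sup>+\<xi>. (\<integral>\<^sup>+\<upsilon>. ennreal (slot_time n b K (\<tau>(e := True)) t ((clocks t x)(e := t + \<upsilon> 0))
       \<xi> (\<lambda>k. \<upsilon> (Suc k))) \<partial>exp_seq lu) \<partial>exp_seq lz) \<partial>slot_law \<tau>)
    = (\<integral>\<^sup>+x. future b K (\<tau>(e := True)) t (clocks t x) \<partial>slot_law (\<tau>(e := True)))"
proof -
  let ?s = "slot_time n b K (\<tau>(e := True)) t"
  interpret E: prob_space "exp_law lu" by (rule prob_space_exp_law[OF lu])
  interpret EZ: pair_sigma_finite "exp_law lu" "exp_seq lz" ..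
  have "(\<integral>\<^sup>+x. (\<integral>\<^sup>+\<xi>. (\<integral>\<^sup>+\<upsilon>. ennreal (?s ((clocks t x)(e := t + \<upsilon> 0)) \<xi> (\<lambda>k. \<upsilon> (Suc k))) \<partial>exp_seq lu) \<partial>exp_seq lz) \<partial>slot_law \<tau>)
     = (\<integral>\<^sup>+x. (\<integral>\<^sup>+y. future b K (\<tau>(e := True)) t (clocks t (x(e := y))) \<partial>exp_law lu) \<partial>slot_law \<tau>)"
  proof (intro nn_integral_cong)
    fix x assume "x \<in> space (slot_law \<tau>)"
    then have x: "x \<in> space (\<Pi>\<^sub>M e\<in>slots n. borel)" by (simp add: space_PiM)
    let ?f = "\<lambda>\<xi> \<upsilon>. ennreal (?s ((clocks t x)(e := t + \<upsilon> 0)) \<xi> (\<lambda>k. \<upsilon> (Suc k)))"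
    have [measurable]: "(\<lambda>\<upsilon>. (clocks t x)(e := t + \<upsilon> 0)) \<in> (\<Pi>\<^sub>M i\<in>UNIV::nat set. borel) \<rightarrow>\<^sub>M (\<Pi>\<^sub>M e\<in>slots n. borel)"
      by (intro clocks_update_measurable[OF e x] borel_measurable_add borel_measurable_const measurable_seq_0 measurable_ident_sets refl)
    have [measurable]: "(\<lambda>\<upsilon> k. \<upsilon> (Suc k) :: real) \<in> (\<Pi>\<^sub>M i\<in>UNIV::nat set. borel) \<rightarrow>\<^sub>M (\<Pi>\<^sub>M i\<in>UNIV. borel)"
      by (rule measurable_seq_Suc[of "\<lambda>\<upsilon>. \<upsilon>"]) (rule measurable_ident_sets[OF refl])
    have upd: "(\<lambda>z. (clocks t x)(e := t + fst (fst z))) \<in> (exp_law lu \<Otimes>\<^sub>M exp_seq lz) \<Otimes>\<^sub>M exp_seq lu \<rightarrow>\<^sub>M (\<Pi>\<^sub>M e\<in>slots n. borel)"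
      by (rule clocks_update_measurable[OF e x]) measurable
    let ?g = "\<lambda>y \<xi>. \<integral>\<^sup>+\<upsilon>. ennreal (?s ((clocks t x)(e := t + y)) \<xi> \<upsilon>) \<partial>exp_seq lu"
    have m: "?f \<xi> \<in> borel_measurable (\<Pi>\<^sub>M i\<in>UNIV. borel)" for \<xi>
    proof -
      have "(\<lambda>\<upsilon>. \<xi>) \<in> (\<Pi>\<^sub>M i\<in>UNIV::nat set. borel) \<rightarrow>\<^sub>M (\<Pi>\<^sub>M i\<in>UNIV. borel)"
        by (rule measurable_const) (simp add: space_PiM)
      then show ?thesis by measurable
    qed
    have "(\<integral>\<^sup>+\<upsilon>. ?f \<xi> \<upsilon> \<partial>exp_seq lu) = (\<integral>\<^sup>+y. ?g y \<xi> \<partial>exp_law lu)" for \<xi>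
      by (rule trans[OF nn_integral_exp_seq_case_nat[OF lu m[of \<xi>]]]) simp
    then have "(\<integral>\<^sup>+\<xi>. (\<integral>\<^sup>+\<upsilon>. ?f \<xi> \<upsilon> \<partial>exp_seq lu) \<partial>exp_seq lz) = (\<integral>\<^sup>+\<xi>. (\<integral>\<^sup>+y. ?g y \<xi> \<partial>exp_law lu) \<partial>exp_seq lz)"
      by (simp only:)
    \<comment> \<open>The new clock is drawn inside the integral over the supply and has to be moved
      outside.\<close>
    also have "\<dots> = (\<integral>\<^sup>+y. (\<integral>\<^sup>+\<xi>. ?g y \<xi> \<partial>exp_seq lz) \<partial>exp_law lu)"
    proof (rule EZ.Fubini')
      show "case_prod ?g \<in> borel_measurable (exp_law lu \<Otimes>\<^sub>M exp_seq lz)"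
        unfolding case_prod_beta'
      proof (rule Us.borel_measurable_nn_integral)
        let ?P = "(exp_law lu \<Otimes>\<^sub>M exp_seq lz) \<Otimes>\<^sub>M exp_seq lu"
        have "(\<lambda>z. snd (fst z)) \<in> ?P \<rightarrow>\<^sub>M (\<Pi>\<^sub>M i\<in>UNIV. borel)" "snd \<in> ?P \<rightarrow>\<^sub>M (\<Pi>\<^sub>M i\<in>UNIV. borel)"
          by measurable
        from measurable_compose[OF measurable_slot_time[OF n borel_measurable_const upd this] measurable_ennreal]
        show "(\<lambda>(z, \<upsilon>). ennreal (?s ((clocks t x)(e := t + fst z)) (snd z) \<upsilon>)) \<in> borel_measurable ?P"
          unfolding case_prod_beta' .
      qed
    qed
    also have "\<dots> = (\<integral>\<^sup>+y. future b K (\<tau>(e := True)) t (clocks t (x(e := y))) \<partial>exp_law lu)"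
      by (simp add: future_def clocks_update[OF e])
    finally show "(\<integral>\<^sup>+\<xi>. (\<integral>\<^sup>+\<upsilon>. ?f \<xi> \<upsilon> \<partial>exp_seq lu) \<partial>exp_seq lz) = (\<integral>\<^sup>+y. future b K (\<tau>(e := True)) t (clocks t (x(e := y))) \<partial>exp_law lu)" .
  qed
  also have "\<dots> = (\<integral>\<^sup>+x. future b K (\<tau>(e := True)) t (clocks t x) \<partial>slot_law (\<tau>(e := True)))"
    using nn_integral_slot_law_update[OF e, where g="\<lambda>x. future b K (\<tau>(e := True)) t (clocks t x)" and \<beta>=True and \<tau>=\<tau>] by simp
  finally show ?thesis .
qed

lemma AE_slot_law_pos: "AE x in slot_law \<tau>. \<forall>e\<in>slots n. x e > 0"
proof (rule AE_finite_allI[OF finite_slots])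
  fix e assume "e \<in> slots n"
  then show "AE x in slot_law \<tau>. x e > 0"
    by (rule AE_PiM_component[OF prob_space_exp_law[OF rate_pos]]) (rule AE_exp_law_pos)
qed

text \<open>The argument of \<open>future\<close> has the form delivered by
  \<open>exp_law_competition\<close>: slot \<open>e\<close> rings at \<open>t + s\<close>, and all
  others ring strictly later because their residual times are almost surely positive.\<close>

lemma future_first_event:
  assumes e: "e \<in> slots n"
  shows "AE x in slot_law \<tau>. future b (Suc K) \<tau> t (clocks t ((\<lambda>e\<in>slots n. s + x e)(e := s)))
    = (if \<tau> (partner e) then ennreal (t + s)
       else if \<tau> e then (\<integral>\<^sup>+\<xi>. (\<integral>\<^sup>+\<upsilon>. ennreal (slot_time n b K (\<tau>(e := False)) (t + s)
         ((clocks (t + s) x)(e := t + s + skip (t + s) \<xi> 0)) (\<lambda>k. skip (t + s) \<xi> (Suc k)) \<upsilon>) \<partial>exp_seq lu) \<partial>exp_seq lz)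
       else (\<integral>\<^sup>+\<xi>. (\<integral>\<^sup>+\<upsilon>. ennreal (slot_time n b K (\<tau>(e := True)) (t + s)
         ((clocks (t + s) x)(e := t + s + \<upsilon> 0)) \<xi> (\<lambda>k. \<upsilon> (Suc k))) \<partial>exp_seq lu) \<partial>exp_seq lz))"
  using AE_slot_law_pos
proof eventually_elim
  case (elim x)
  let ?h = "clocks t ((\<lambda>e\<in>slots n. s + x e)(e := s))"
  have h: "?h = (clocks (t + s) x)(e := t + s)"
    using e by (auto simp: clocks_def fun_eq_iff)
  have "first_slot n \<tau> ?h = e"
    using elim e by (intro first_slot_eqI[OF n]) (auto simp: h clocks_def)
  moreover have "?h e = t + s" by (simp add: h)
  moreover have "?h(e := y) = (clocks (t + s) x)(e := y)" for y by (simp add: h)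
  ultimately show ?case
    using Zs.emeasure_space_1 Us.emeasure_space_1 by (simp add: future_def Let_def)
qed

lemma card_valid_config:
  assumes "valid_config \<tau>"
  shows "card {e \<in> slots n. \<tau> e} + card {e \<in> slots n. \<tau> (partner e)} + card {e \<in> slots n. \<not> \<tau> e \<and> \<not> \<tau> (partner e)} = 2 * n"
    and "card {e \<in> slots n. \<tau> (partner e)} = card {e \<in> slots n. \<tau> e}"
    and "card {e \<in> slots n. \<tau> e} \<le> n"
proof -
  let ?A = "{e \<in> slots n. \<tau> e}" and ?B = "{e \<in> slots n. \<tau> (partner e)}" and ?C = "{e \<in> slots n. \<not> \<tau> e \<and> \<not> \<tau> (partner e)}"
  have "slots n = (?A \<union> ?B) \<union> ?C" by auto
  then have "card (slots n) = card ((?A \<union> ?B) \<union> ?C)" by simp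
  also have "\<dots> = card (?A \<union> ?B) + card ?C" by (rule card_Un_disjoint) auto
  also have "card (?A \<union> ?B) = card ?A + card ?B"
    using assms by (intro card_Un_disjoint) (auto simp: valid_config_def)
  finally show 1: "card ?A + card ?B + card ?C = 2 * n" by (simp add: card_slots)
  have "bij_betw partner ?B ?A"
    by (rule bij_betwI[where g=partner]) auto
  then show 2: "card ?B = card ?A" by (rule bij_betw_same_card)
  show "card ?A \<le> n" using 1 2 by linarith
qed

text \<open>The values \<open>x\<close>, \<open>y\<close> and \<open>z\<close> belong to recruiters,
  recruitments and vehicles of complete groups; \<open>partner\<close> matches the first two
  classes.\<close>

lemma sum_over_config:
  assumes \<tau>: "valid_config \<tau>"
  shows "(\<Sum>e\<in>slots n. if \<tau> (partner e) then x else if \<tau> e then y else z)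
    = real (card {e \<in> slots n. \<tau> e}) * x + real (card {e \<in> slots n. \<tau> e}) * y
      + (2 * real n - 2 * real (card {e \<in> slots n. \<tau> e})) * (z :: real)"
proof -
  let ?A = "{e \<in> slots n. \<tau> e}" and ?B = "{e \<in> slots n. \<tau> (partner e)}" and ?C = "{e \<in> slots n. \<not> \<tau> e \<and> \<not> \<tau> (partner e)}"
  let ?f = "\<lambda>e. if \<tau> (partner e) then x else if \<tau> e then y else z"
  have "sum ?f (slots n) = sum ?f ((?B \<union> ?A) \<union> ?C)" by (intro sum.cong) auto
  also have "\<dots> = sum ?f (?B \<union> ?A) + sum ?f ?C" by (rule sum.union_disjoint) auto
  also have "sum ?f (?B \<union> ?A) = sum ?f ?B + sum ?f ?A"
    using \<tau> by (intro sum.union_disjoint) (auto simp: valid_config_def)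
  also have "sum ?f ?B = real (card ?B) * x" by simp
  also have "sum ?f ?A = (\<Sum>e\<in>?A. y)"
    using \<tau> by (intro sum.cong) (auto simp: valid_config_def)
  also have "sum ?f ?C = real (card ?C) * z" by simp
  also have "real (card ?C) = 2 * real n - 2 * real (card ?A)"
    using card_valid_config(1,2)[OF \<tau>] by linarith
  finally show ?thesis by (simp add: card_valid_config(2)[OF \<tau>])
qed

lemma nn_integral_exp_law_shift:
  assumes "l > 0" "a \<ge> 0"
  shows "(\<integral>\<^sup>+s. ennreal (a + s) \<partial>exp_law l) = ennreal (a + 1 / l)"
proof -
  interpret prob_space "exp_law l" by (rule prob_space_exp_law[OF assms(1)])
  have "(\<integral>\<^sup>+s. ennreal (a + s) \<partial>exp_law l) = (\<integral>\<^sup>+s. ennreal a + ennreal s \<partial>exp_law l)"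
    using AE_exp_law_nonneg[of l] assms by (intro nn_integral_cong_AE) (auto elim!: eventually_mono)
  also have "\<dots> = (\<integral>\<^sup>+s. ennreal a \<partial>exp_law l) + (\<integral>\<^sup>+s. ennreal s \<partial>exp_law l)"
    by (rule nn_integral_add) measurable
  also have "\<dots> = ennreal a + ennreal (1 / l)"
    using emeasure_space_1 by (simp add: nn_integral_exp_law_ident[OF assms(1)])
  finally show ?thesis using assms by simp
qed

text \<open>The induction generalises over \<open>t\<close> and \<open>\<tau>\<close>, since each
  event other than a failure restarts the same mean at a later time in another configuration. Of the
  configuration only the number of recruitments survives in the result.\<close>

theorem slot_time_expectation:
  assumes b: "b \<ge> 0" and "t \<ge> 0" and "valid_config \<tau>"
  shows "(\<integral>\<^sup>+x. future b K \<tau> t (clocks t x) \<partial>slot_law \<tau>) = ennreal (t + V b K (card {e \<in> slots n. \<tau> e}))"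
  using assms(2,3)
proof (induction K arbitrary: t \<tau>)
  case 0
  then show ?case
    using Zs.emeasure_space_1 Us.emeasure_space_1 prob_space.emeasure_space_1[OF prob_space_slot_law]
    by (simp add: future_def)
next
  case (Suc K)
  define i where "i = card {e \<in> slots n. \<tau> e}"
  have i: "i \<le> n" unfolding i_def by (rule card_valid_config(3)[OF Suc.prems(2)])
  \<comment> \<open>The mean value still to be collected after slot \<open>e\<close> has rung:
    nothing after a failure, otherwise that of the level below or above.\<close>
  define v where "v e = (if \<tau> (partner e) then 0 else if \<tau> e then V b K (i - 1) else V b K (i + 1))" for e
  have D: "D i > 0" by (rule D_pos[OF i])
  have sum_rate: "sum (rate \<tau>) (slots n) = D i"
  proof -
    have "sum (rate \<tau>) (slots n) = (\<Sum>e\<in>slots n. if \<tau> (partner e) then lz else if \<tau> e then lu else lz)"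
      using Suc.prems(2) by (intro sum.cong) (auto simp: rate_def valid_config_def)
    then show ?thesis
      using sum_over_config[OF Suc.prems(2), of lz lu lz] by (simp add: total_rate_def i_def algebra_simps)
  qed
  have start: "valid_config (\<tau>(e := True)) \<and> card {e' \<in> slots n. (\<tau>(e := True)) e'} = i + 1 \<and> i + 1 \<le> n"
    if e: "e \<in> slots n" "\<not> \<tau> e" "\<not> \<tau> (partner e)" for e
  proof -
    have v: "valid_config (\<tau>(e := True))"
      unfolding valid_config_def
    proof
      fix e'
      show "\<not> ((\<tau>(e := True)) e' \<and> (\<tau>(e := True)) (partner e'))"
      proof (cases "e' = e")
        case True
        then show ?thesis using e by simp
      next
        case False
        have "\<not> (\<tau> e' \<and> \<tau> (partner e'))" using Suc.prems(2) unfolding valid_config_def by blast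
        moreover have "e' = partner e" if "partner e' = e" using that by auto
        ultimately show ?thesis using False e by auto
      qed
    qed
    moreover have "{e' \<in> slots n. (\<tau>(e := True)) e'} = insert e {e \<in> slots n. \<tau> e}"
      using e by auto
    then have "card {e' \<in> slots n. (\<tau>(e := True)) e'} = i + 1"
      using e by (simp add: i_def)
    ultimately show ?thesis using card_valid_config(3)[OF v] by simp
  qed
  have finish: "valid_config (\<tau>(e := False)) \<and> card {e' \<in> slots n. (\<tau>(e := False)) e'} = i - 1"
    if e: "e \<in> slots n" "\<tau> e" for e
  proof -
    have "{e' \<in> slots n. (\<tau>(e := False)) e'} = {e \<in> slots n. \<tau> e} - {e}" by auto
    then have "card {e' \<in> slots n. (\<tau>(e := False)) e'} = i - 1"
      using e by (simp add: i_def)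
    then show ?thesis using Suc.prems(2) by (auto simp: valid_config_def)
  qed
  have v_nonneg: "v e \<ge> 0" if "e \<in> slots n" for e
    using V_nonneg[OF b] i start[OF that] by (auto simp: v_def)
  have step: "(\<integral>\<^sup>+x. future b (Suc K) \<tau> t (clocks t ((\<lambda>e\<in>slots n. s + x e)(e := s))) \<partial>slot_law \<tau>)
     = ennreal (t + v e + s)" if e: "e \<in> slots n" and s: "s > 0" for e s
  proof -
    have ts: "t + s \<ge> 0" using s Suc.prems by simp
    note F = nn_integral_cong_AE[OF future_first_event[OF e, where \<tau> = \<tau> and b = b and K = K and t = t and s = s]]
    consider "\<tau> (partner e)" | "\<not> \<tau> (partner e)" "\<tau> e" | "\<not> \<tau> (partner e)" "\<not> \<tau> e" by auto
    then show ?thesis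
    proof cases
      case 1
      then show ?thesis
        unfolding F using prob_space.emeasure_space_1[OF prob_space_slot_law] by (simp add: v_def)
    next
      case 2
      then show ?thesis
        unfolding F using future_recruited[OF e ts, where b=b and K=K and \<tau>=\<tau>] Suc.IH[OF ts, of "\<tau>(e := False)"] finish[OF e]
        by (simp add: v_def add_ac del: fun_upd_apply)
    next
      case 3
      then show ?thesis
        unfolding F using future_recruiting[OF e, where b=b and K=K and \<tau>=\<tau> and t="t + s"] Suc.IH[OF ts, of "\<tau>(e := True)"] start[OF e]
        by (simp add: v_def add_ac del: fun_upd_apply)
    qed
  qed
  have "(\<integral>\<^sup>+x. future b (Suc K) \<tau> t (clocks t x) \<partial>slot_law \<tau>)
     = (\<Sum>e\<in>slots n. ennreal (rate \<tau> e / D i) * (\<integral>\<^sup>+s. (\<integral>\<^sup>+x. future b (Suc K) \<tau> t (clocks t ((\<lambda>e\<in>slots n. s + x e)(e := s)))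
           \<partial>slot_law \<tau>) \<partial>exp_law (D i)))"
  proof -
    have "slots n \<noteq> {}" using n card_slots[of n] by auto
    then show ?thesis
      unfolding sum_rate[symmetric]
      by (intro exp_law_competition rate_pos) simp_all
  qed
  also have "\<dots> = (\<Sum>e\<in>slots n. ennreal (rate \<tau> e / D i) * ennreal (t + v e + 1 / D i))"
  proof (intro sum.cong refl)
    fix e assume e: "e \<in> slots n"
    have "(\<integral>\<^sup>+s. (\<integral>\<^sup>+x. future b (Suc K) \<tau> t (clocks t ((\<lambda>e\<in>slots n. s + x e)(e := s))) \<partial>slot_law \<tau>) \<partial>exp_law (D i))
       = (\<integral>\<^sup>+s. ennreal (t + v e + s) \<partial>exp_law (D i))"
      using AE_exp_law_pos[of "D i"] by (intro nn_integral_cong_AE) (auto elim!: eventually_mono simp: step[OF e])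
    also have "\<dots> = ennreal (t + v e + 1 / D i)"
      using Suc.prems(1) v_nonneg[OF e] by (intro nn_integral_exp_law_shift D) simp
    finally show "ennreal (rate \<tau> e / D i) * (\<integral>\<^sup>+s. (\<integral>\<^sup>+x. future b (Suc K) \<tau> t (clocks t ((\<lambda>e\<in>slots n. s + x e)(e := s)))
           \<partial>slot_law \<tau>) \<partial>exp_law (D i)) = ennreal (rate \<tau> e / D i) * ennreal (t + v e + 1 / D i)"
      by simp
  qed
  also have "\<dots> = ennreal (\<Sum>e\<in>slots n. rate \<tau> e / D i * (t + v e + 1 / D i))"
  proof -
    have "rate \<tau> e / D i \<ge> 0" "t + v e + 1 / D i \<ge> 0" if "e \<in> slots n" for e
      using rate_pos[of \<tau> e] D Suc.prems(1) v_nonneg[OF that] by (simp_all add: less_imp_le)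
    then have "(\<Sum>e\<in>slots n. ennreal (rate \<tau> e / D i) * ennreal (t + v e + 1 / D i))
       = (\<Sum>e\<in>slots n. ennreal (rate \<tau> e / D i * (t + v e + 1 / D i)))"
      and "\<And>e. e \<in> slots n \<Longrightarrow> rate \<tau> e / D i * (t + v e + 1 / D i) \<ge> 0"
      by (auto intro!: sum.cong mult_nonneg_nonneg simp only: ennreal_mult)
    then show ?thesis by (simp only: sum_ennreal)
  qed
  \<comment> \<open>The weights add up to 1, so the constant part gives \<open>t\<close> plus the
    mean sojourn. The \<open>i\<close> recruitments and the \<open>2 * (n - i)\<close> vehicles of
    complete groups give the two neighbour terms of \<open>V\<close>.\<close>
  also have "(\<Sum>e\<in>slots n. rate \<tau> e / D i * (t + v e + 1 / D i)) = t + V b (Suc K) i"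
  proof -
    have "(\<Sum>e\<in>slots n. rate \<tau> e / D i * (t + v e + 1 / D i))
      = (\<Sum>e\<in>slots n. rate \<tau> e * (t + 1 / D i) / D i + rate \<tau> e * v e / D i)"
      by (intro sum.cong) (auto simp: algebra_simps add_divide_distrib)
    also have "\<dots> = sum (rate \<tau>) (slots n) * (t + 1 / D i) / D i + (\<Sum>e\<in>slots n. rate \<tau> e * v e) / D i"
      by (simp add: sum.distrib sum_distrib_right sum_divide_distrib)
    also have "sum (rate \<tau>) (slots n) * (t + 1 / D i) / D i = t + 1 / D i"
      using D by (simp add: sum_rate)
    also have "(\<Sum>e\<in>slots n. rate \<tau> e * v e)
      = (\<Sum>e\<in>slots n. if \<tau> (partner e) then 0 else if \<tau> e then lu * V b K (i - 1) else lz * V b K (i + 1))"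
      by (intro sum.cong) (auto simp: rate_def v_def)
    also have "\<dots> = real i * (lu * V b K (i - 1)) + (2 * real n - 2 * real i) * (lz * V b K (i + 1))"
      using sum_over_config[OF Suc.prems(2), of 0] by (simp add: i_def)
    also have "t + 1 / D i + (real i * (lu * V b K (i - 1)) + (2 * real n - 2 * real i) * (lz * V b K (i + 1))) / D i
      = t + V b (Suc K) i"
      by (simp add: down_prob_def up_prob_def mean_sojourn_def add_divide_distrib diff_divide_distrib algebra_simps)
    finally show ?thesis .
  qed
  finally show ?case by (simp add: i_def)
qed

end

section \<open>The clocks follow the vehicular cloud\<close>

text \<open>The witness \<open>\<beta>\<close> leaves open which slot holds which vehicle: a
  replacement enters the slot of the departed vehicle but is listed second in \<open>Duo\<close>, so
  the two orders drift apart.\<close>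

fun group_matches :: "(nat \<Rightarrow> real) \<Rightarrow> (slot \<Rightarrow> bool) \<Rightarrow> (slot \<Rightarrow> real) \<Rightarrow> nat \<Rightarrow> group_state \<Rightarrow> bool" where
  "group_matches z \<tau> h g (Duo v w) \<longleftrightarrow>
     (\<exists>\<beta>. \<not> \<tau> (g, \<beta>) \<and> \<not> \<tau> (g, \<not> \<beta>) \<and> h (g, \<beta>) = z v \<and> h (g, \<not> \<beta>) = z w)"
| "group_matches z \<tau> h g (Solo v r) \<longleftrightarrow>
     (\<exists>\<beta>. \<not> \<tau> (g, \<beta>) \<and> \<tau> (g, \<not> \<beta>) \<and> h (g, \<beta>) = z v \<and> h (g, \<not> \<beta>) = r)"

lemma group_matches_event: "group_matches z \<tau> h g G \<Longrightarrow> group_event z G = group_clock h g"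
proof (cases G)
  case (Duo v w)
  assume "group_matches z \<tau> h g G"
  then obtain \<beta> where "h (g, \<beta>) = z v" "h (g, \<not> \<beta>) = z w" using Duo by auto
  then show ?thesis by (cases \<beta>) (auto simp: Duo group_clock_def min.commute)
next
  case (Solo v r)
  assume "group_matches z \<tau> h g G"
  then obtain \<beta> where "h (g, \<beta>) = z v" "h (g, \<not> \<beta>) = r" using Solo by auto
  then show ?thesis by (cases \<beta>) (auto simp: Solo group_clock_def min.commute)
qed

lemma first_group_event:
  assumes n: "n \<ge> 1" and G: "\<And>g. g < n \<Longrightarrow> group_matches z \<tau> h g (G g)"
  shows "Min ((\<lambda>g. group_event z (G g)) ` {..<n}) = group_clock h (first_group n h)"
    and "(LEAST g. g < n \<and> group_event z (G g) = group_clock h (first_group n h)) = first_group n h"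
proof -
  have ev: "group_event z (G g) = group_clock h g" if "g < n" for g
    using group_matches_event[OF G[OF that]] .
  show m: "Min ((\<lambda>g. group_event z (G g)) ` {..<n}) = group_clock h (first_group n h)"
  proof (rule Min_eqI)
    show "group_clock h (first_group n h) \<in> (\<lambda>g. group_event z (G g)) ` {..<n}"
      using first_group(1)[OF n, of h] by (intro image_eqI[where x="first_group n h"]) (auto simp: ev)
  qed (auto simp: ev first_group(2)[OF n])
  have "(\<lambda>g. g < n \<and> group_event z (G g) = group_clock h (first_group n h))
     = (\<lambda>g. g < n \<and> (\<forall>g'<n. group_clock h g \<le> group_clock h g'))"
  proof (intro ext conj_cong refl)
    fix g assume g: "g < n"
    show "group_event z (G g) = group_clock h (first_group n h) \<longleftrightarrow> (\<forall>g'<n. group_clock h g \<le> group_clock h g')"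
      using first_group(1)[OF n, of h] first_group(2)[OF n, where h=h] g by (auto simp: ev intro: antisym)
  qed
  then show "(LEAST g. g < n \<and> group_event z (G g) = group_clock h (first_group n h)) = first_group n h"
    by (simp only: first_group_def[of n h, symmetric])
qed

lemma fst_first_slot: "fst (first_slot n \<tau> h) = first_group n h"
  by (simp add: first_slot_def Let_def)

text \<open>\<open>vc_step\<close> searches the vehicle numbers from \<open>v\<close> on, while
  \<open>skip\<close> searches the supply shifted by \<open>v\<close>; both find the same
  vehicle.\<close>

lemma skip_new_vehicle:
  assumes "\<exists>w. t < z (v + w)"
  defines "w \<equiv> (LEAST w. v \<le> w \<and> t < z w)"
  shows "t + skip t (\<lambda>k. z (v + k)) 0 = z w" and "skip t (\<lambda>k. z (v + k)) (Suc k) = z (Suc w + k)"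
proof -
  let ?m = "LEAST m. t < z (v + m)"
  have "t < z (v + ?m)" using LeastI_ex[OF assms(1)] .
  then have "w = v + ?m"
    unfolding w_def
  proof (intro Least_equality)
    fix y assume y: "v \<le> y \<and> t < z y"
    then have "?m \<le> y - v" by (intro Least_le) simp
    then show "v + ?m \<le> y" using y by linarith
  qed simp
  then show "t + skip t (\<lambda>k. z (v + k)) 0 = z w" "skip t (\<lambda>k. z (v + k)) (Suc k) = z (Suc w + k)"
    by (simp_all add: skip_def Let_def add_ac)
qed

definition state_matches ::
    "nat \<Rightarrow> (nat \<Rightarrow> real) \<Rightarrow> (slot \<Rightarrow> bool) \<Rightarrow> (slot \<Rightarrow> real) \<Rightarrow> (nat \<Rightarrow> group_state) \<Rightarrow> bool" where
  "state_matches n z \<tau> h G \<longleftrightarrow> (\<forall>g<n. group_matches z \<tau> h g (G g))"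

lemma group_matches_cong:
  "(\<And>\<beta>. \<tau> (g, \<beta>) = \<tau>' (g, \<beta>)) \<Longrightarrow> (\<And>\<beta>. h (g, \<beta>) = h' (g, \<beta>)) \<Longrightarrow>
    group_matches z \<tau> h g G = group_matches z \<tau>' h' g G"
  by (cases G) simp_all

lemma state_matches_update:
  assumes "state_matches n z \<tau> h G" "group_matches z (\<tau>(e := \<beta>)) (h(e := y)) (fst e) G'"
  shows "state_matches n z (\<tau>(e := \<beta>)) (h(e := y)) (G(fst e := G'))"
  unfolding state_matches_def
proof (intro allI impI)
  fix g assume g: "g < n"
  show "group_matches z (\<tau>(e := \<beta>)) (h(e := y)) g ((G(fst e := G')) g)"
  proof (cases "g = fst e")
    case False
    then have "group_matches z (\<tau>(e := \<beta>)) (h(e := y)) g (G g) = group_matches z \<tau> h g (G g)"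
      by (intro group_matches_cong) auto
    then show ?thesis using False assms(1) g by (simp add: state_matches_def)
  qed (use assms(2) in simp)
qed

text \<open>The correspondence is pathwise and has no exception for ties, because both sides decide
  them alike; the supply only has to be unbounded.\<close>

lemma vc_step_matches:
  assumes n: "n \<ge> 1" and G: "state_matches n z \<tau> h G" and ex: "\<And>t. \<exists>w. t < z (v + w)"
  defines "e \<equiv> first_slot n \<tau> h"
  shows "\<tau> (partner e) \<Longrightarrow> vc_step n z u (Running G v m) = Failed (h e)"
    and "\<not> \<tau> (partner e) \<Longrightarrow> \<tau> e \<Longrightarrow>
      \<exists>G' w. vc_step n z u (Running G v m) = Running G' (Suc w) m \<and> v \<le> w \<and>
        state_matches n z (\<tau>(e := False)) (h(e := h e + skip (h e) (\<lambda>k. z (v + k)) 0)) G' \<and>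
        (\<lambda>k. skip (h e) (\<lambda>k. z (v + k)) (Suc k)) = (\<lambda>k. z (Suc w + k))"
    and "\<not> \<tau> (partner e) \<Longrightarrow> \<not> \<tau> e \<Longrightarrow>
      \<exists>G'. vc_step n z u (Running G v m) = Running G' v (Suc m) \<and>
        state_matches n z (\<tau>(e := True)) (h(e := h e + u m)) G'"
proof -
  define g where "g = first_group n h"
  have g: "g < n" using first_group(1)[OF n] by (simp add: g_def)
  have match: "group_matches z \<tau> h g' (G g')" if "g' < n" for g'
    using G that by (simp add: state_matches_def)
  have he: "h e = group_clock h g" unfolding e_def g_def by (rule first_slot_clock)
  obtain \<beta> where e: "e = (g, \<beta>)" using fst_first_slot[of n \<tau> h] by (cases e) (auto simp: e_def g_def)
  have le: "h (g, \<beta>) \<le> h (g, \<not> \<beta>)" using he by (cases \<beta>) (auto simp: e group_clock_def)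
  \<comment> \<open>If a recruiter departs at the very time of completion, \<open>first_slot\<close>
    selects the recruitment, in agreement with the strict test \<open>z a < c\<close> of
    \<open>vc_step\<close>.\<close>
  have tie: "\<tau> (g, \<beta>)" if "h (g, \<beta>) = h (g, \<not> \<beta>)" "\<tau> (g, \<not> \<beta>)"
    using that e unfolding e_def first_slot_def g_def[symmetric] Let_def by (cases \<beta>) auto
  have p: "partner e = (g, \<not> \<beta>)" by (simp add: e partner_def)
  have least: "Min ((\<lambda>g. group_event z (G g)) ` {..<n}) = h e"
      "(LEAST g. g < n \<and> group_event z (G g) = h e) = g"
    using first_group_event[OF n match] by (simp_all only: he g_def)
  have step: "vc_step n z u (Running G v m) = (case G g of
           Duo a b \<Rightarrow> Running (G(g := Solo (if z a \<le> z b then b else a) (h e + u m))) v (Suc m)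
         | Solo a c \<Rightarrow>
             if z a < c then Failed (h e)
             else let w = (LEAST w. v \<le> w \<and> h e < z w) in Running (G(g := Duo a w)) (Suc w) m)"
    by (simp only: vc_step.simps least Let_def)
  have upd: "group_matches z (\<tau>(e := \<sigma>)) (h(e := y)) g G' \<Longrightarrow> state_matches n z (\<tau>(e := \<sigma>)) (h(e := y)) (G(g := G'))" for \<sigma> y G'
    using state_matches_update[OF G, of e \<sigma> y G'] by (simp add: e)
  show "vc_step n z u (Running G v m) = Failed (h e)" if fail: "\<tau> (partner e)"
  proof (cases "G g")
    case (Duo a b)
    then obtain \<gamma> where "\<not> \<tau> (g, \<gamma>)" "\<not> \<tau> (g, \<not> \<gamma>)" using match[OF g] by auto
    then show ?thesis using fail p by (cases \<beta>; cases \<gamma>) auto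
  next
    case (Solo a c)
    then obtain \<gamma> where \<gamma>: "\<not> \<tau> (g, \<gamma>)" "\<tau> (g, \<not> \<gamma>)" "h (g, \<gamma>) = z a" "h (g, \<not> \<gamma>) = c"
      using match[OF g] by auto
    then have "\<gamma> = \<beta>" using fail p by (cases \<beta>; cases \<gamma>) auto
    then have "z a < c" using le tie \<gamma> by (cases "z a = c") auto
    then show ?thesis using Solo step by simp
  qed
  show "\<exists>G' w. vc_step n z u (Running G v m) = Running G' (Suc w) m \<and> v \<le> w \<and>
        state_matches n z (\<tau>(e := False)) (h(e := h e + skip (h e) (\<lambda>k. z (v + k)) 0)) G' \<and>
        (\<lambda>k. skip (h e) (\<lambda>k. z (v + k)) (Suc k)) = (\<lambda>k. z (Suc w + k))"
    if \<tau>: "\<not> \<tau> (partner e)" "\<tau> e"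
  proof (cases "G g")
    case (Duo a b)
    then obtain \<gamma> where "\<not> \<tau> (g, \<gamma>)" "\<not> \<tau> (g, \<not> \<gamma>)" using match[OF g] by auto
    then show ?thesis using \<tau> e by (cases \<beta>; cases \<gamma>) auto
  next
    case (Solo a c)
    then obtain \<gamma> where \<gamma>: "\<not> \<tau> (g, \<gamma>)" "\<tau> (g, \<not> \<gamma>)" "h (g, \<gamma>) = z a" "h (g, \<not> \<gamma>) = c"
      using match[OF g] by auto
    then have \<gamma>\<beta>: "\<gamma> = (\<not> \<beta>)" using \<tau> e by (cases \<beta>; cases \<gamma>) auto
    then have za: "h (g, \<not> \<beta>) = z a" "h (g, \<beta>) = c" "\<not> z a < c" using le \<gamma> by auto
    define w where "w = (LEAST w. v \<le> w \<and> h e < z w)"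
    have new: "h e + skip (h e) (\<lambda>k. z (v + k)) 0 = z w" "(\<lambda>k. skip (h e) (\<lambda>k. z (v + k)) (Suc k)) = (\<lambda>k. z (Suc w + k))"
      using skip_new_vehicle[OF ex[of "h e"]] by (simp_all add: w_def)
    obtain w0 where "h e < z (v + w0)" using ex by blast
    then have "v \<le> w \<and> h e < z w" 
      using LeastI[of "\<lambda>w. v \<le> w \<and> h e < z w" "v + w0"] by (simp add: w_def)
    then have "v \<le> w" by simp
    moreover have "group_matches z (\<tau>(e := False)) (h(e := z w)) g (Duo a w)"
      unfolding group_matches.simps using \<tau> e p za by (intro exI[of _ "\<not> \<beta>"]) auto
    ultimately show ?thesis
      using step Solo za(3) upd[of False "z w" "Duo a w"] new by (auto simp: Let_def w_def[symmetric])
  qed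
  show "\<exists>G'. vc_step n z u (Running G v m) = Running G' v (Suc m) \<and>
        state_matches n z (\<tau>(e := True)) (h(e := h e + u m)) G'"
    if \<tau>: "\<not> \<tau> (partner e)" "\<not> \<tau> e"
  proof (cases "G g")
    case (Duo a b)
    then obtain \<gamma> where \<gamma>: "\<not> \<tau> (g, \<gamma>)" "\<not> \<tau> (g, \<not> \<gamma>)" "h (g, \<gamma>) = z a" "h (g, \<not> \<gamma>) = z b"
      using match[OF g] by auto
    \<comment> \<open>The slot that does not ring holds the later departure. If both coincide,
      either vehicle will do, since only clock values are matched.\<close>
    have "h (g, \<not> \<beta>) = z (if z a \<le> z b then b else a)"
      using \<gamma>(3,4) le by (cases \<beta>; cases \<gamma>) auto
    then have "group_matches z (\<tau>(e := True)) (h(e := h e + u m)) g (Solo (if z a \<le> z b then b else a) (h e + u m))"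
      unfolding group_matches.simps using \<tau> e p by (intro exI[of _ "\<not> \<beta>"]) auto
    then show ?thesis using step Duo upd by auto
  next
    case (Solo a c)
    then obtain \<gamma> where "\<not> \<tau> (g, \<gamma>)" "\<tau> (g, \<not> \<gamma>)" using match[OF g] by auto
    then show ?thesis using \<tau> e p by (cases \<beta>; cases \<gamma>) auto
  qed
qed

lemma vc_step_funpow_Failed: "(vc_step n z u ^^ k) (Failed t) = Failed t"
  by (induction k) simp_all

lemma unbounded_shift:
  fixes z :: "nat \<Rightarrow> real"
  assumes "\<And>t. \<exists>w. t < z w"
  shows "\<exists>w. t < z (v + w)"
proof -
  obtain w where w: "Max (insert t (z ` {..<v})) < z w" using assms by blast
  then have "\<not> w < v" by (auto simp: not_less)
  then have "z (v + (w - v)) = z w" by simp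
  moreover have "t < z w" using w by simp
  ultimately show ?thesis by metis
qed

text \<open>The charge \<open>b\<close> is added before a failure and absent after it, so a
  comparison of \<open>b = 1\<close> with \<open>b = 0\<close> reveals whether a failure has
  occurred. The time \<open>t\<close> is arbitrary because the first event replaces it.\<close>

lemma slot_time_vc_step:
  assumes n: "n \<ge> 1" and z: "\<And>t. \<exists>w. t < z w" and "state_matches n z \<tau> h G"
  shows "case (vc_step n z u ^^ K) (Running G v m) of
      Running _ _ _ \<Rightarrow> slot_time n b K \<tau> t h (\<lambda>k. z (v + k)) (\<lambda>k. u (m + k))
        = slot_time n 0 K \<tau> t h (\<lambda>k. z (v + k)) (\<lambda>k. u (m + k)) + b
    | Failed s \<Rightarrow> slot_time n b K \<tau> t h (\<lambda>k. z (v + k)) (\<lambda>k. u (m + k)) = s"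
  using assms(3)
proof (induction K arbitrary: \<tau> t h G v m)
  case 0
  then show ?case by simp
next
  case (Suc K)
  define e where "e = first_slot n \<tau> h"
  have ex: "\<exists>w. t < z (v + w)" for t by (rule unbounded_shift[OF z])
  note step = vc_step_matches[OF n Suc.prems ex, folded e_def]
  have pow: "(vc_step n z u ^^ Suc K) (Running G v m) = (vc_step n z u ^^ K) (vc_step n z u (Running G v m))"
    by (simp only: funpow_Suc_right comp_apply)
  consider "\<tau> (partner e)" | "\<not> \<tau> (partner e)" "\<tau> e" | "\<not> \<tau> (partner e)" "\<not> \<tau> e" by auto
  then show ?case
  proof cases
    case 1
    then show ?thesis
      unfolding pow step(1)[OF 1] vc_step_funpow_Failed by (simp add: e_def[symmetric] Let_def)
  next
    case 2
    from step(2)[OF 2] obtain G' w where s: "vc_step n z u (Running G v m) = Running G' (Suc w) m"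
      "state_matches n z (\<tau>(e := False)) (h(e := h e + skip (h e) (\<lambda>k. z (v + k)) 0)) G'"
      "(\<lambda>k. skip (h e) (\<lambda>k. z (v + k)) (Suc k)) = (\<lambda>k. z (Suc w + k))" by blast
    show ?thesis
      unfolding pow s(1) slot_time.simps e_def[symmetric] Let_def s(3)
      using Suc.IH[OF s(2), where v="Suc w" and m=m and t="h e"] 2 by (simp only: if_False if_True)
  next
    case 3
    from step(3)[OF 3] obtain G' where s: "vc_step n z u (Running G v m) = Running G' v (Suc m)"
      "state_matches n z (\<tau>(e := True)) (h(e := h e + u m)) G'" by blast
    show ?thesis
      unfolding pow s(1) slot_time.simps e_def[symmetric] Let_def
      using Suc.IH[OF s(2), where v=v and m="Suc m" and t="h e"] 3 by (simp only: if_False if_True add_0_right add_Suc add_Suc_right)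
  qed
qed

text \<open>The head of the skipped supply and the recruitment durations are nonnegative, so a
  replaced clock rings no earlier than the event that replaces it, and \<open>h e\<close> is again a
  lower bound of all clocks.\<close>

lemma slot_time_ge:
  assumes n: "n \<ge> 1" and "\<And>t. \<exists>w. t < \<xi> w" and "\<And>m. \<upsilon> m \<ge> 0" and "\<And>e. e \<in> slots n \<Longrightarrow> t \<le> h e"
  shows "t \<le> slot_time n 0 K \<tau> t h \<xi> \<upsilon>" and "slot_time n 0 K \<tau> t h \<xi> \<upsilon> \<le> slot_time n 0 (Suc K) \<tau> t h \<xi> \<upsilon>"
proof -
  have "t \<le> slot_time n 0 K \<tau> t h \<xi> \<upsilon> \<and> slot_time n 0 K \<tau> t h \<xi> \<upsilon> \<le> slot_time n 0 (Suc K) \<tau> t h \<xi> \<upsilon>"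
    using assms(2-)
  proof (induction K arbitrary: \<tau> t h \<xi> \<upsilon>)
    case 0
    then show ?case using first_slot(1)[OF n] by (simp add: Let_def)
  next
    case (Suc K)
    define e where "e = first_slot n \<tau> h"
    have te: "t \<le> h e" using Suc.prems(3) first_slot(1)[OF n] by (simp add: e_def)
    have min: "h e \<le> h e'" if "e' \<in> slots n" for e' using first_slot(2)[OF n that] by (simp add: e_def)
    have upd: "h e \<le> (h(e := h e + y)) e'" if "y \<ge> 0" "e' \<in> slots n" for y e'
      using min[OF that(2)] that(1) by simp
    define w where "w = (LEAST w. h e < \<xi> w)"
    have "h e < \<xi> w" unfolding w_def by (rule LeastI_ex) (rule Suc.prems(1))
    then have sk0: "skip (h e) \<xi> 0 \<ge> 0" by (simp add: skip_def w_def Let_def)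
    have sk: "(\<lambda>k. skip (h e) \<xi> (Suc k)) = (\<lambda>k. \<xi> (Suc w + k))" by (simp add: skip_def w_def Let_def)
    have ex: "\<exists>w'. t' < \<xi> (Suc w + w')" for t' by (rule unbounded_shift[OF Suc.prems(1)])
    have A: "h e \<le> slot_time n 0 K (\<tau>(e := False)) (h e) (h(e := h e + skip (h e) \<xi> 0)) (\<lambda>k. skip (h e) \<xi> (Suc k)) \<upsilon> \<and>
       slot_time n 0 K (\<tau>(e := False)) (h e) (h(e := h e + skip (h e) \<xi> 0)) (\<lambda>k. skip (h e) \<xi> (Suc k)) \<upsilon>
       \<le> slot_time n 0 (Suc K) (\<tau>(e := False)) (h e) (h(e := h e + skip (h e) \<xi> 0)) (\<lambda>k. skip (h e) \<xi> (Suc k)) \<upsilon>"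
      unfolding sk by (rule Suc.IH[OF ex Suc.prems(2) upd[OF sk0]])
    have B: "h e \<le> slot_time n 0 K (\<tau>(e := True)) (h e) (h(e := h e + \<upsilon> 0)) \<xi> (\<lambda>k. \<upsilon> (Suc k)) \<and>
       slot_time n 0 K (\<tau>(e := True)) (h e) (h(e := h e + \<upsilon> 0)) \<xi> (\<lambda>k. \<upsilon> (Suc k))
       \<le> slot_time n 0 (Suc K) (\<tau>(e := True)) (h e) (h(e := h e + \<upsilon> 0)) \<xi> (\<lambda>k. \<upsilon> (Suc k))"
      by (rule Suc.IH[OF Suc.prems(1,2) upd[OF Suc.prems(2)]])
    show ?case
      using A B te
      unfolding slot_time.simps(2)[of n 0 "Suc K" \<tau> t] slot_time.simps(2)[of n 0 K \<tau> t] Let_def e_def[symmetric]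
      by auto
  qed
  then show "t \<le> slot_time n 0 K \<tau> t h \<xi> \<upsilon>" "slot_time n 0 K \<tau> t h \<xi> \<upsilon> \<le> slot_time n 0 (Suc K) \<tau> t h \<xi> \<upsilon>"
    by auto
qed

definition initial_clocks :: "nat \<Rightarrow> (nat \<Rightarrow> real) \<Rightarrow> slot \<Rightarrow> real" where
  "initial_clocks n z = (\<lambda>e\<in>slots n. z (2 * fst e + of_bool (snd e)))"

definition initial_time :: "nat \<Rightarrow> real \<Rightarrow> nat \<Rightarrow> (nat \<Rightarrow> real) \<Rightarrow> (nat \<Rightarrow> real) \<Rightarrow> real" where
  "initial_time n b K z u = slot_time n b K (\<lambda>_. False) 0 (initial_clocks n z) (\<lambda>k. z (2 * n + k)) u"

lemma initial_time_vc:
  assumes n: "n \<ge> 1" and z: "\<And>t. \<exists>w. t < z w"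
  shows "case (vc_step n z u ^^ K) (vc_init n) of
      Running _ _ _ \<Rightarrow> initial_time n b K z u = initial_time n 0 K z u + b
    | Failed s \<Rightarrow> initial_time n b K z u = s"
proof -
  have "state_matches n z (\<lambda>_. False) (initial_clocks n z) (\<lambda>g. Duo (2 * g) (2 * g + 1))"
    by (auto simp: state_matches_def initial_clocks_def slots_def intro!: exI[of _ False])
  from slot_time_vc_step[OF n z this, where K=K and v="2 * n" and m=0 and b=b and t=0 and u=u]
  show ?thesis unfolding add_0 by (simp only: vc_init_def initial_time_def)
qed

lemma initial_time_mono:
  assumes n: "n \<ge> 1" and z: "\<And>t. \<exists>w. t < z w" and "\<And>v. z v \<ge> 0" and "\<And>m. u m \<ge> 0"
  shows "0 \<le> initial_time n 0 K z u" and "initial_time n 0 K z u \<le> initial_time n 0 (Suc K) z u"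
  unfolding initial_time_def
  by (rule slot_time_ge[OF n unbounded_shift[OF z]]; use assms(3,4) in \<open>simp add: initial_clocks_def\<close>)+

text \<open>The failed state is absorbing, so there is a single failure time, and the truncated
  times increase until they equal it. The premise \<open>fail\<close> expresses that a failure
  occurs by clock times alone.\<close>

lemma vc_failure_time_eq_SUP:
  assumes n: "n \<ge> 1" and z: "\<And>t. \<exists>w. t < z w" and nn: "\<And>v. z v \<ge> 0" "\<And>m. u m \<ge> 0"
    and fail: "\<exists>K. initial_time n 1 K z u = initial_time n 0 K z u"
  shows "vc_failure_time n z u = (SUP K. ennreal (initial_time n 0 K z u))"
proof -
  from fail obtain K where K: "initial_time n 1 K z u = initial_time n 0 K z u" by blast
  obtain s where s: "(vc_step n z u ^^ K) (vc_init n) = Failed s"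
    using initial_time_vc[OF n z, where u=u and K=K and b=1] K by (cases "(vc_step n z u ^^ K) (vc_init n)") auto
  have later: "(vc_step n z u ^^ k) (vc_init n) = Failed s" if "K \<le> k" for k
  proof -
    have "(vc_step n z u ^^ k) (vc_init n) = (vc_step n z u ^^ (k - K)) ((vc_step n z u ^^ K) (vc_init n))"
      using funpow_add[of "k - K" K "vc_step n z u"] that by simp
    then show ?thesis by (simp add: s vc_step_funpow_Failed)
  qed
  have unique: "t = s" if "(vc_step n z u ^^ k) (vc_init n) = Failed t" for k t
  proof -
    have "Failed s = (vc_step n z u ^^ (max k K - k)) ((vc_step n z u ^^ k) (vc_init n))"
      using later[of "max k K"] funpow_add[of "max k K - k" k "vc_step n z u"] by simp
    then show ?thesis by (simp add: that vc_step_funpow_Failed)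
  qed
  have "{t. \<exists>k. (vc_step n z u ^^ k) (vc_init n) = Failed t} = {s}"
    using s unique by blast
  then have 1: "vc_failure_time n z u = ennreal s" by (simp add: vc_failure_time_def)
  have eq: "initial_time n 0 k z u = s" if "K \<le> k" for k
    using initial_time_vc[OF n z, where u=u and K=k and b=0] later[OF that] by simp
  have "incseq (\<lambda>k. initial_time n 0 k z u)"
    by (rule incseq_SucI) (rule initial_time_mono(2)[OF n z nn])
  then have le: "initial_time n 0 k z u \<le> s" for k
    using eq[of "max k K"] by (auto simp: incseq_def dest: spec[of _ "max k K"])
  have "(SUP K. ennreal (initial_time n 0 K z u)) = ennreal s"
  proof (rule antisym)
    show "(SUP K. ennreal (initial_time n 0 K z u)) \<le> ennreal s"
      by (rule SUP_least) (rule ennreal_leI[OF le])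
    show "ennreal s \<le> (SUP K. ennreal (initial_time n 0 K z u))"
      by (rule SUP_upper2[of K]) (simp_all add: eq)
  qed
  then show ?thesis using 1 by simp
qed

section \<open>The joint law of the initial clocks and the supply\<close>

lemma initial_clocks_comb_seq: "initial_clocks n (comb_seq (2 * n) z z') = initial_clocks n z"
proof -
  have "2 * fst e + of_bool (snd e) < 2 * n" if "e \<in> slots n" for e
    using that by (cases "snd e") (auto simp: slots_def)
  then show ?thesis unfolding initial_clocks_def by (intro restrict_ext comb_seq_less)
qed

lemma measurable_initial_clocks:
  "initial_clocks n \<in> (\<Pi>\<^sub>M i\<in>UNIV. borel) \<rightarrow>\<^sub>M (\<Pi>\<^sub>M e\<in>slots n. borel)"
  unfolding initial_clocks_def by measurable

lemma measurable_initial_time: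
  assumes n: "n \<ge> 1"
  shows "(\<lambda>x. initial_time n b K (fst x) (snd x)) \<in> borel_measurable ((\<Pi>\<^sub>M i\<in>UNIV. borel) \<Otimes>\<^sub>M (\<Pi>\<^sub>M i\<in>UNIV. borel))"
  unfolding initial_time_def
proof (rule measurable_slot_time[OF n])
  let ?P = "(\<Pi>\<^sub>M i\<in>UNIV. borel) \<Otimes>\<^sub>M (\<Pi>\<^sub>M i\<in>UNIV. borel) :: ((nat \<Rightarrow> real) \<times> (nat \<Rightarrow> real)) measure"
  show "(\<lambda>x. initial_clocks n (fst x)) \<in> ?P \<rightarrow>\<^sub>M (\<Pi>\<^sub>M e\<in>slots n. borel)"
    by (rule measurable_compose[OF measurable_fst measurable_initial_clocks])
  show "(\<lambda>x k. fst x (2 * n + k)) \<in> ?P \<rightarrow>\<^sub>M (\<Pi>\<^sub>M i\<in>UNIV. borel)"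
    by (rule measurable_PiM_single') measurable
qed measurable

text \<open>With \<open>i = 2 * n\<close> this makes the deployed vehicles and the supply, which
  read disjoint parts of one sequence, functions of two independent sequences.\<close>

lemma nn_integral_exp_seq_comb_seq:
  assumes l: "l > 0" and f[measurable]: "f \<in> borel_measurable (\<Pi>\<^sub>M i\<in>UNIV. borel)"
  shows "(\<integral>\<^sup>+z. f z \<partial>exp_seq l) = (\<integral>\<^sup>+z. (\<integral>\<^sup>+z'. f (comb_seq i z z') \<partial>exp_seq l) \<partial>exp_seq l)"
proof -
  interpret sequence_space "exp_law l"
    by (intro sequence_space.intro product_prob_spaceI prob_space_exp_law l)
  have "(\<integral>\<^sup>+z. f z \<partial>exp_seq l) = (\<integral>\<^sup>+z. f z \<partial>distr (exp_seq l \<Otimes>\<^sub>M exp_seq l) (exp_seq l) (\<lambda>(z, z'). comb_seq i z z'))"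
    by (simp only: PiM_comb_seq)
  also have "\<dots> = (\<integral>\<^sup>+x. f (case x of (z, z') \<Rightarrow> comb_seq i z z') \<partial>(exp_seq l \<Otimes>\<^sub>M exp_seq l))"
    by (rule nn_integral_distr) measurable
  also have "\<dots> = (\<integral>\<^sup>+z. (\<integral>\<^sup>+z'. f (comb_seq i z z') \<partial>exp_seq l) \<partial>exp_seq l)"
    using sigma_finite_measure.nn_integral_fst[OF prob_space_imp_sigma_finite[OF prob_space_exp_seq[OF l]],
        of "\<lambda>x. f (case x of (z, z') \<Rightarrow> comb_seq i z z')" "exp_seq l"] by simp
  finally show ?thesis .
qed

lemma (in prob_space) indep_vars_inj:
  assumes X: "indep_vars (\<lambda>_. N) X UNIV" and f: "inj f"
  shows "indep_vars (\<lambda>_. N) (\<lambda>i. X (f i)) UNIV"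
proof -
  have "indep_vars (\<lambda>j. \<Pi>\<^sub>M i\<in>{f j}. N) (\<lambda>j \<omega>. restrict (\<lambda>i. X i \<omega>) {f j}) UNIV"
    using f by (intro indep_vars_restrict[OF X]) (auto simp: disjoint_family_on_def inj_def)
  from indep_vars_compose2[OF this, of "\<lambda>j y. y (f j)" "\<lambda>_. N"] show ?thesis by simp
qed

lemma distr_sequence_exp_law:
  fixes Y :: "nat \<Rightarrow> 'a \<Rightarrow> real"
  assumes M: "prob_space M" and ind: "prob_space.indep_vars M (\<lambda>_. borel) Y UNIV"
    and Y: "\<And>v. Y v \<in> borel_measurable M" "\<And>v. distr M borel (Y v) = exp_law l"
  shows "distr M (\<Pi>\<^sub>M i\<in>UNIV. borel) (\<lambda>\<omega> v. Y v \<omega>) = exp_seq l"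
proof -
  interpret prob_space M by fact
  show ?thesis
    using indep_vars_iff_distr_eq_PiM'[where I = "UNIV :: nat set" and M' = "\<lambda>_. borel" and X = Y] ind Y
    by (simp add: restrict_UNIV)
qed

context exp_cloud
begin

interpretation Zs: prob_space "exp_seq lz" by (rule prob_space_exp_seq[OF lz])
interpretation Us: prob_space "exp_seq lu" by (rule prob_space_exp_seq[OF lu])

lemma distr_initial_clocks:
  "distr (exp_seq lz) (\<Pi>\<^sub>M e\<in>slots n. borel) (initial_clocks n) = slot_law (\<lambda>_. False)"
proof -
  have r: "exp_law (rate (\<lambda>_. False) e) = exp_law lz" for e by (simp add: rate_def)
  have inj: "inj_on (\<lambda>e. 2 * fst e + of_bool (snd e) :: nat) (slots n)"
  proof (rule inj_onI)
    fix e e' :: slot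
    assume eq: "2 * fst e + of_bool (snd e) = (2 * fst e' + of_bool (snd e') :: nat)"
    \<comment> \<open>Parity recovers the second component of a slot.\<close>
    have "even (2 * fst e + of_bool (snd e) :: nat) \<longleftrightarrow> \<not> snd e"
      "even (2 * fst e' + of_bool (snd e') :: nat) \<longleftrightarrow> \<not> snd e'" by auto
    with eq have "snd e = snd e'" by metis
    with eq show "e = e'" by (simp add: prod_eq_iff)
  qed
  have "slot_law (\<lambda>_. False) = (\<Pi>\<^sub>M e\<in>slots n. exp_law lz)" by (simp add: r)
  also have "\<dots> = distr (exp_seq lz) (\<Pi>\<^sub>M e\<in>slots n. exp_law lz) (initial_clocks n)"
    using distr_PiM_reindex[of UNIV "\<lambda>_. exp_law lz" "\<lambda>e. 2 * fst e + of_bool (snd e)" "slots n"] inj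
      prob_space_exp_law[OF lz] by (simp add: initial_clocks_def[abs_def])
  also have "\<dots> = distr (exp_seq lz) (\<Pi>\<^sub>M e\<in>slots n. borel) (initial_clocks n)"
    by (rule distr_cong) (auto intro!: sets_PiM_cong)
  finally show ?thesis by simp
qed

lemma nn_integral_initial_time:
  assumes b: "b \<ge> 0"
  shows "(\<integral>\<^sup>+z. (\<integral>\<^sup>+u. ennreal (initial_time n b K z u) \<partial>exp_seq lu) \<partial>exp_seq lz) = ennreal (V b K 0)"
proof -
  have "(\<lambda>x. ennreal (initial_time n b K (fst x) (snd x))) \<in> borel_measurable ((\<Pi>\<^sub>M i\<in>UNIV. borel) \<Otimes>\<^sub>M exp_seq lu)"
    using measurable_compose[OF measurable_initial_time[OF n] measurable_ennreal]
    by (simp add: measurable_cong_sets[OF sets_pair_measure_cong[OF refl sets_exp_seq] refl])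
  then have m: "(\<lambda>z. \<integral>\<^sup>+u. ennreal (initial_time n b K z u) \<partial>exp_seq lu) \<in> borel_measurable (\<Pi>\<^sub>M i\<in>UNIV. borel)"
    by (intro Us.borel_measurable_nn_integral) (simp add: case_prod_beta')
  have "(\<integral>\<^sup>+z. (\<integral>\<^sup>+u. ennreal (initial_time n b K z u) \<partial>exp_seq lu) \<partial>exp_seq lz)
     = (\<integral>\<^sup>+z. future b K (\<lambda>_. False) 0 (initial_clocks n z) \<partial>exp_seq lz)"
  proof -
    have "comb_seq (2 * n) z z' (2 * n + k) = z' k" for z z' :: "nat \<Rightarrow> real" and k
      by (simp add: comb_seq_def)
    then show ?thesis
      by (subst nn_integral_exp_seq_comb_seq[OF lz m, of "2 * n"])
         (simp add: initial_time_def initial_clocks_comb_seq future_def)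
  qed
  also have "\<dots> = (\<integral>\<^sup>+x. future b K (\<lambda>_. False) 0 x \<partial>distr (exp_seq lz) (\<Pi>\<^sub>M e\<in>slots n. borel) (initial_clocks n))"
    using measurable_initial_clocks[of n]
    by (subst nn_integral_distr) (auto simp: measurable_cong_sets[OF sets_exp_seq refl])
  also have "\<dots> = (\<integral>\<^sup>+x. future b K (\<lambda>_. False) 0 (clocks 0 x) \<partial>slot_law (\<lambda>_. False))"
    unfolding distr_initial_clocks
  proof (intro nn_integral_cong)
    fix x assume "x \<in> space (slot_law (\<lambda>_. False))"
    then have "clocks 0 x = x"
      by (auto simp: clocks_def space_PiM PiE_def extensional_def fun_eq_iff)
    then show "future b K (\<lambda>_. False) 0 x = future b K (\<lambda>_. False) 0 (clocks 0 x)" by simp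
  qed
  also have "\<dots> = ennreal (V b K 0)"
    using slot_time_expectation[OF b, of 0 "\<lambda>_. False" K] by (simp add: valid_config_def)
  finally show ?thesis .
qed

section \<open>The mean failure time of the cloud\<close>

context
  fixes M :: "'a measure" and Z U :: "nat \<Rightarrow> 'a \<Rightarrow> real"
  assumes vc: "vc_randomness (exp_law lz) (exp_law lu) M Z U"
begin

interpretation prob_space M using vc by (simp add: vc_randomness_def)

lemma measurable_Z: "Z v \<in> borel_measurable M" and measurable_U: "U m \<in> borel_measurable M"
  and distr_Z: "distr M borel (Z v) = exp_law lz" and distr_U: "distr M borel (U m) = exp_law lu"
  and indep_ZU: "indep_vars (\<lambda>_. borel) (case_sum Z U) UNIV"
  using vc by (auto simp: vc_randomness_def)

lemma measurable_Z_seq: "(\<lambda>\<omega> v. Z v \<omega>) \<in> M \<rightarrow>\<^sub>M (\<Pi>\<^sub>M i\<in>UNIV. borel)"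
  and measurable_U_seq: "(\<lambda>\<omega> v. U v \<omega>) \<in> M \<rightarrow>\<^sub>M (\<Pi>\<^sub>M i\<in>UNIV. borel)"
  by (rule measurable_PiM_single', auto intro: measurable_Z measurable_U)+

lemma indep_seqs: "indep_var (\<Pi>\<^sub>M i\<in>UNIV. borel) (\<lambda>\<omega> v. Z v \<omega>) (\<Pi>\<^sub>M i\<in>UNIV. borel) (\<lambda>\<omega> v. U v \<omega>)"
proof -
  have "indep_var (PiM (range Inl) (\<lambda>_. borel)) (\<lambda>\<omega>. restrict (\<lambda>i. case_sum Z U i \<omega>) (range Inl))
     (PiM (range Inr) (\<lambda>_. borel)) (\<lambda>\<omega>. restrict (\<lambda>i. case_sum Z U i \<omega>) (range Inr))"
    by (rule indep_var_restrict[OF indep_ZU]) auto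
  moreover have "(\<lambda>y v. y (Inl v) :: real) \<in> (\<Pi>\<^sub>M i\<in>range (Inl :: nat \<Rightarrow> nat + nat). borel) \<rightarrow>\<^sub>M (\<Pi>\<^sub>M i\<in>UNIV. borel)"
    by (rule measurable_PiM_single') (auto intro!: measurable_component_singleton)
  moreover have "(\<lambda>y v. y (Inr v) :: real) \<in> (\<Pi>\<^sub>M i\<in>range (Inr :: nat \<Rightarrow> nat + nat). borel) \<rightarrow>\<^sub>M (\<Pi>\<^sub>M i\<in>UNIV. borel)"
    by (rule measurable_PiM_single') (auto intro!: measurable_component_singleton)
  ultimately show ?thesis
    by (auto dest: indep_var_compose simp: comp_def)
qed

lemma indep_vars_Z: "indep_vars (\<lambda>_. borel) Z UNIV" and indep_vars_U: "indep_vars (\<lambda>_. borel) U UNIV"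
  using indep_vars_inj[OF indep_ZU, of Inl] indep_vars_inj[OF indep_ZU, of Inr] by simp_all

lemma distr_seqs:
  "distr M ((\<Pi>\<^sub>M i\<in>UNIV. borel) \<Otimes>\<^sub>M (\<Pi>\<^sub>M i\<in>UNIV. borel)) (\<lambda>\<omega>. (\<lambda>v. Z v \<omega>, \<lambda>v. U v \<omega>)) = exp_seq lz \<Otimes>\<^sub>M exp_seq lu"
  using indep_seqs unfolding indep_var_distribution_eq
  by (simp add: distr_sequence_exp_law[OF prob_space_axioms indep_vars_Z measurable_Z distr_Z]
      distr_sequence_exp_law[OF prob_space_axioms indep_vars_U measurable_U distr_U])

definition T :: "real \<Rightarrow> nat \<Rightarrow> 'a \<Rightarrow> real" where
  "T b K \<omega> = initial_time n b K (\<lambda>v. Z v \<omega>) (\<lambda>m. U m \<omega>)"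

lemma measurable_T: "T b K \<in> borel_measurable M"
  using measurable_compose[OF measurable_Pair[OF measurable_Z_seq measurable_U_seq] measurable_initial_time[OF n]]
  by (simp add: T_def[abs_def])

lemma nn_integral_T:
  assumes b: "b \<ge> 0"
  shows "(\<integral>\<^sup>+\<omega>. ennreal (T b K \<omega>) \<partial>M) = ennreal (V b K 0)"
proof -
  let ?P = "(\<Pi>\<^sub>M i\<in>UNIV. borel) \<Otimes>\<^sub>M (\<Pi>\<^sub>M i\<in>UNIV. borel) :: ((nat \<Rightarrow> real) \<times> (nat \<Rightarrow> real)) measure"
  let ?f = "\<lambda>x. ennreal (initial_time n b K (fst x) (snd x))"
  have f: "?f \<in> borel_measurable ?P"
    by (rule measurable_compose[OF measurable_initial_time[OF n] measurable_ennreal])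
  have s: "sets (exp_seq lz \<Otimes>\<^sub>M exp_seq lu) = sets ?P"
    by (intro sets_pair_measure_cong sets_exp_seq)
  have "(\<integral>\<^sup>+\<omega>. ennreal (T b K \<omega>) \<partial>M) = (\<integral>\<^sup>+x. ?f x \<partial>distr M ?P (\<lambda>\<omega>. (\<lambda>v. Z v \<omega>, \<lambda>v. U v \<omega>)))"
    by (subst nn_integral_distr[OF measurable_Pair[OF measurable_Z_seq measurable_U_seq]])
       (use f in \<open>simp_all add: T_def\<close>)
  also have "\<dots> = (\<integral>\<^sup>+x. ?f x \<partial>(exp_seq lz \<Otimes>\<^sub>M exp_seq lu))"
    by (simp only: distr_seqs)
  also have "\<dots> = (\<integral>\<^sup>+z. (\<integral>\<^sup>+u. ennreal (initial_time n b K z u) \<partial>exp_seq lu) \<partial>exp_seq lz)"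
    using Us.nn_integral_fst[of ?f "exp_seq lz"] f by (simp add: measurable_cong_sets[OF s refl])
  finally show ?thesis using nn_integral_initial_time[OF b] by simp
qed

text \<open>These are the premises of the pathwise statements about
  \<open>initial_time\<close>.\<close>

lemma AE_regular:
  "AE \<omega> in M. (\<forall>t. \<exists>v. t < Z v \<omega>) \<and> (\<forall>v. Z v \<omega> \<ge> 0) \<and> (\<forall>m. U m \<omega> \<ge> 0)"
proof -
  have "AE \<omega> in M. \<forall>t. \<exists>v. t < Z v \<omega>"
  proof (rule AE_distrD[OF measurable_Z_seq])
    show "AE z in distr M (\<Pi>\<^sub>M i\<in>UNIV. borel) (\<lambda>\<omega> v. Z v \<omega>). \<forall>t. \<exists>w. t < z w"
      unfolding distr_sequence_exp_law[OF prob_space_axioms indep_vars_Z measurable_Z distr_Z]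
      by (rule AE_exp_seq_exceeds[OF lz])
  qed
  moreover have "AE \<omega> in M. Z v \<omega> \<ge> 0" for v
    by (rule AE_distrD[OF measurable_Z]) (simp only: distr_Z AE_exp_law_nonneg)
  then have "AE \<omega> in M. \<forall>v. Z v \<omega> \<ge> 0" by (simp add: AE_all_countable)
  moreover have "AE \<omega> in M. U m \<omega> \<ge> 0" for m
    by (rule AE_distrD[OF measurable_U]) (simp only: distr_U AE_exp_law_nonneg)
  then have "AE \<omega> in M. \<forall>m. U m \<omega> \<ge> 0" by (simp add: AE_all_countable)
  ultimately show ?thesis by eventually_elim simp
qed

lemma AE_fails: "AE \<omega> in M. \<exists>K. T 1 K \<omega> = T 0 K \<omega>"
proof -
  note [measurable] = measurable_T
  let ?R = "\<lambda>K. {\<omega> \<in> space M. T 1 K \<omega> \<noteq> T 0 K \<omega>}"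
  have R: "prob (?R K) = V 1 K 0 - V 0 K 0" for K
  proof -
    have "AE \<omega> in M. ennreal (T 1 K \<omega>) = ennreal (T 0 K \<omega>) + indicator (?R K) \<omega>"
      using AE_regular AE_space
    proof eventually_elim
      case (elim \<omega>)
      then have ge: "0 \<le> T 0 K \<omega>" unfolding T_def by (intro initial_time_mono(1)[OF n]) auto
      \<comment> \<open>The first alternative holds while the cloud is running, the second after a
        failure; the two means therefore differ by the probability of still running.\<close>
      have "T 1 K \<omega> = T 0 K \<omega> + 1 \<or> T 1 K \<omega> = T 0 K \<omega>"
        using initial_time_vc[OF n, where z="\<lambda>v. Z v \<omega>" and u="\<lambda>m. U m \<omega>" and K=K and b=1]
          initial_time_vc[OF n, where z="\<lambda>v. Z v \<omega>" and u="\<lambda>m. U m \<omega>" and K=K and b=0] elim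
        by (auto simp: T_def split: vc_state.splits)
      then show ?case using ge elim by (auto simp: ennreal_plus)
    qed
    then have "ennreal (V 1 K 0) = (\<integral>\<^sup>+\<omega>. ennreal (T 0 K \<omega>) + indicator (?R K) \<omega> \<partial>M)"
      unfolding nn_integral_T[OF zero_le_one, symmetric] by (rule nn_integral_cong_AE)
    also have "\<dots> = ennreal (V 0 K 0) + ennreal (prob (?R K))"
      by (subst nn_integral_add) (auto simp: nn_integral_T emeasure_eq_measure)
    finally show ?thesis
      using V_nonneg[of 0 0 K] V_nonneg[of 1 0 K] by (simp flip: ennreal_plus)
  qed
  let ?S = "{\<omega> \<in> space M. \<forall>K. T 1 K \<omega> \<noteq> T 0 K \<omega>}"
  have "(\<lambda>K. prob (?R K)) \<longlonglongrightarrow> Q 0 - Q 0"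
    unfolding R by (intro tendsto_intros V_tendsto) simp_all
  moreover have "prob ?S \<le> prob (?R K)" for K
    by (intro finite_measure_mono) auto
  ultimately have "prob ?S \<le> Q 0 - Q 0"
    by (intro LIMSEQ_le_const) auto
  then have "emeasure M ?S = 0" by (simp add: emeasure_eq_measure measure_le_0_iff)
  then show ?thesis by (intro AE_I'[of ?S]) auto
qed

theorem cmttf_exp_law: "cmttf n M Z U = ennreal (Q 0)"
proof -
  have inc: "AE \<omega> in M. \<forall>K. ennreal (T 0 K \<omega>) \<le> ennreal (T 0 (Suc K) \<omega>)"
    using AE_regular unfolding T_def
    by eventually_elim (auto intro!: ennreal_leI initial_time_mono(2)[OF n])
  have "AE \<omega> in M. vc_failure_time n (\<lambda>v. Z v \<omega>) (\<lambda>m. U m \<omega>) = (SUP K. ennreal (T 0 K \<omega>))"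
    using AE_regular AE_fails unfolding T_def
    by eventually_elim (rule vc_failure_time_eq_SUP[OF n], auto)
  then have "cmttf n M Z U = (\<integral>\<^sup>+\<omega>. (SUP K. ennreal (T 0 K \<omega>)) \<partial>M)"
    unfolding cmttf_def by (rule nn_integral_cong_AE)
  also have "\<dots> = (SUP K. \<integral>\<^sup>+\<omega>. ennreal (T 0 K \<omega>) \<partial>M)"
    by (rule nn_integral_monotone_convergence_SUP_AE) (use inc measurable_T in \<open>auto simp: AE_all_countable\<close>)
  also have "\<dots> = (SUP K. ennreal (V 0 K 0))" by (simp add: nn_integral_T)
  finally have SUP: "cmttf n M Z U = (SUP K. ennreal (V 0 K 0))" .
  have "incseq (\<lambda>K. ennreal (V 0 K 0))"
    unfolding nn_integral_T[OF order_refl, symmetric]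
    by (rule incseq_SucI, rule nn_integral_mono_AE) (use inc in \<open>auto elim: eventually_mono\<close>)
  from LIMSEQ_SUP[OF this] have "(\<lambda>K. ennreal (V 0 K 0)) \<longlonglongrightarrow> cmttf n M Z U"
    unfolding SUP .
  moreover have "(\<lambda>K. ennreal (V 0 K 0)) \<longlonglongrightarrow> ennreal (Q 0)"
    by (intro tendsto_intros V_tendsto) simp
  ultimately show ?thesis by (rule LIMSEQ_unique)
qed

end

section \<open>The closed form in the notation of the theorem\<close>

lemma mean_W_eq: "i \<le> n \<Longrightarrow> mean_W n (exp_law lz) (exp_law lu) i j = soj i"
  by (simp add: mean_W_exp_law[OF n _ lz lu] mean_sojourn_def)

text \<open>Both sides belong to the step from level \<open>k - 1\<close> to level \<open>k\<close>;
  the shift of indices arises because \<open>d\<close> is indexed by the level that is left.\<close>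

lemma alpha'_eq: "1 \<le> k \<Longrightarrow> k \<le> n \<Longrightarrow> alpha' n (exp_law lz) (exp_law lu) k = \<alpha> k"
  by (cases k) (simp_all add: alpha'_def \<alpha>_def d_def q_prob_exp_law[OF n _ lz lu] up_prob_def add_ac)

lemma beta'_eq: "i \<le> n \<Longrightarrow> beta' n (exp_law lz) (exp_law lu) i = (\<Prod>k = 1..i. \<alpha> k)"
  by (simp add: beta'_def alpha'_eq)

lemma Q_0_closed_form:
  fixes DZ R :: "real measure"
  assumes "DZ = exp_law lz" "R = exp_law lu"
  shows "Q 0 = mean_W n DZ R 0 0 * (1 + beta' n DZ R 1 * A' n DZ R 2)
       + beta' n DZ R n * mean_W n DZ R n 0
       + (\<Sum>i = 1..n - 1. mean_W n DZ R i 0 *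
            ((real i + 1) * beta' n DZ R (i + 1) * A' n DZ R (i + 2) + beta' n DZ R i))"
proof -
  have "(\<Sum>i = 1..n - 1. soj i * ((real i + 1) * (\<Prod>k = 1..i + 1. \<alpha> k) * A' n DZ R (i + 2) + (\<Prod>k = 1..i. \<alpha> k)))
    = (\<Sum>i = 1..n - 1. mean_W n DZ R i 0 *
            ((real i + 1) * beta' n DZ R (i + 1) * A' n DZ R (i + 2) + beta' n DZ R i))"
    unfolding assms
  proof (intro sum.cong refl)
    fix i assume "i \<in> {1..n - 1}"
    then have "i \<le> n" "i + 1 \<le> n" using n by auto
    then show "soj i * ((real i + 1) * (\<Prod>k = 1..i + 1. \<alpha> k) * A' n (exp_law lz) (exp_law lu) (i + 2) + (\<Prod>k = 1..i. \<alpha> k))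
      = mean_W n (exp_law lz) (exp_law lu) i 0 * ((real i + 1) * beta' n (exp_law lz) (exp_law lu) (i + 1)
        * A' n (exp_law lz) (exp_law lu) (i + 2) + beta' n (exp_law lz) (exp_law lu) i)"
      by (simp only: mean_W_eq beta'_eq)
  qed
  then show ?thesis
    using Q_0 n unfolding assms by (simp add: mean_W_eq beta'_eq)
qed

end

theorem theorem3:
  fixes n :: nat and lz lu :: real and DZ R :: "real measure"
    and M :: "'a measure" and Z U :: "nat \<Rightarrow> 'a \<Rightarrow> real"
    and N :: "'b measure" and X :: "nat \<Rightarrow> 'b \<Rightarrow> dstate" and W :: "nat \<Rightarrow> 'b \<Rightarrow> real"
  assumes "n \<ge> 1" and "lz > 0" and "lu > 0"
    and "DZ = exp_law lz" and "R = exp_law lu"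
    and "vc_randomness DZ R M Z U"
    and "dsmp n DZ R 0 0 N X W"
  shows "cmttf n M Z U = mean_hit_time Fail N X W \<and>
    mean_hit_time Fail N X W = ennreal
      (mean_W n DZ R 0 0 * (1 + beta' n DZ R 1 * A' n DZ R 2)
       + beta' n DZ R n * mean_W n DZ R n 0
       + (\<Sum>i = 1..n - 1. mean_W n DZ R i 0 *
            ((real i + 1) * beta' n DZ R (i + 1) * A' n DZ R (i + 2) + beta' n DZ R i)))"
proof -
  interpret exp_cloud n lz lu by unfold_locales (rule assms)+
  have "cmttf n M Z U = ennreal (Q 0)"
    by (rule cmttf_exp_law) (use assms in simp)
  moreover have "mean_hit_time Fail N X W = ennreal (Q 0)"
    by (rule mean_hit_time_exp_law) (use assms in simp)
  ultimately show ?thesis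
    by (simp only: Q_0_closed_form[OF assms(4,5), symmetric])
qed

end
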